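(* Let $R$ be a principal ideal domain and $A$ a unital associative $R$-algebra. Let $G$ be a digraph containing vertices $v,u$ with $v$ of valence $1$, incident only to an edge $e_1$ joining $v$ and $u$, and $u$ of valence $2$, incident to $e_1$ and to an edge $e_2$ joining $u$ to another vertex. Let $G'$ be the digraph obtained from $G$ by removing $v$ and $e_1$, and $G''$ the digraph obtained from $G'$ by removing $u$ and $e_2$. Then: (1) if $e_1,e_2$ are coherently oriented (i.e. $u$ is the target of one and the source of the other), there is a short exact sequence of cochain complexes \[0\to C^{*-1}_\mu(G';A)\to C^*_\mu(G;A)\to C^*_\mu(G';A)\otimes A\to 0;\] (2) if $e_1,e_2$ are not coherently oriented, there is a short exact sequence of cochain complexes \[0\to C^{*-1}_\mu(G'';A)\otimes A\to C^*_\mu(G;A)\to C^*_\mu(G';A)\otimes A\to 0,\] where all tensor products are over $R$ (with $A$ concentrated in degree $0$).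
   Context: Digraph: finite vertex set $V$, edges $E\subseteq (V\times V)\setminus\{(v,v)\}$. A multipath of $G$ is a spanning subgraph each of whose connected components is a single vertex or a simple directed path (no repeated vertex, not a cycle). Multipath cochain complex with coefficients in $A$: fix a total order of $V(G)$. For a multipath $H$ with connected components $c_0<\dots<c_k$ (ordered by their minimal vertex), set $\mathcal F_A(H)=A_{c_0}\otimes_R\cdots\otimes_R A_{c_k}$. If $H'=H\cup e$ is a multipath, adding $e$ merges the components $c_i$ and $c_j$ ($i<j$) containing its endpoints into the $i$-th component of $H'$, the other components keeping their relative order; define $\mu_{H\prec H'}\colon\mathcal F_A(H)\to\mathcal F_A(H')$ by replacing the factor in the component of $s(e)$ with $a_{s(e)}\cdot a_{t(e)}$ (product of the entries of the components containing $s(e)$ and $t(e)$) placed in the merged component and deleting the other entry, leaving other factors unchanged. Then $C^n_\mu(G;A)=\bigoplus_{H,\,|E(H)|=n}\mathcal F_A(H)$ and $d=\sum_{H\prec H'}(-1)^{\epsilon(H,H')}\mu_{H\prec H'}$, where $\epsilon(H,H\cup e)$ is the number of edges of $H$ preceding $e$ in a fixed total order of $E(G)$. For a complex $C^*$, $C^{*-1}$ denotes the complex shifted so its degree $n$ part is $C^{n-1}$. *)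

theory Defs
  imports "HOL-Algebra.Ring_Divisibility" "Graph_Theory.Graph_Theory"
begin

section \<open>Modules over a commutative ring\<close>

text \<open>
  The record \<^typ>\<open>('r, 'a) module\<close> extends the ring record. For objects that are only modules the
  multiplicative fields \<open>mult\<close> and \<open>one\<close> carry no meaning and are set to \<^const>\<open>undefined\<close>.
\<close>

text \<open>Unlike the library locale \<open>algebra\<close>, the multiplication need not be commutative.\<close>

locale assoc_algebra = module R A + ring A for R (structure) and A (structure) +
  assumes smult_mult_left:
      "\<lbrakk> r \<in> carrier R; x \<in> carrier A; y \<in> carrier A \<rbrakk> \<Longrightarrow>
        (r \<odot>\<^bsub>A\<^esub> x) \<otimes>\<^bsub>A\<^esub> y = r \<odot>\<^bsub>A\<^esub> (x \<otimes>\<^bsub>A\<^esub> y)"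
    and smult_mult_right:
      "\<lbrakk> r \<in> carrier R; x \<in> carrier A; y \<in> carrier A \<rbrakk> \<Longrightarrow>
        x \<otimes>\<^bsub>A\<^esub> (r \<odot>\<^bsub>A\<^esub> y) = r \<odot>\<^bsub>A\<^esub> (x \<otimes>\<^bsub>A\<^esub> y)"

definition mod_hom ::
  "('r, 'k) ring_scheme \<Rightarrow> ('r, 'a, 'm) module_scheme \<Rightarrow> ('r, 'b, 'n) module_scheme \<Rightarrow> ('a \<Rightarrow> 'b) set"
  where "mod_hom R M N =
    {h \<in> hom (add_monoid M) (add_monoid N).
       \<forall>r\<in>carrier R. \<forall>x\<in>carrier M. h (r \<odot>\<^bsub>M\<^esub> x) = r \<odot>\<^bsub>N\<^esub> h x}"

definition direct_sum :: "'i set \<Rightarrow> ('i \<Rightarrow> ('r, 'a) module) \<Rightarrow> ('r, 'i \<Rightarrow> 'a) module"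
  where "direct_sum I M =
    \<lparr> carrier = {x \<in> (\<Pi>\<^sub>E i\<in>I. carrier (M i)). finite {i \<in> I. x i \<noteq> \<zero>\<^bsub>M i\<^esub>}},
      mult = undefined, one = undefined,
      zero = (\<lambda>i\<in>I. \<zero>\<^bsub>M i\<^esub>),
      add = (\<lambda>x y. \<lambda>i\<in>I. x i \<oplus>\<^bsub>M i\<^esub> y i),
      smult = (\<lambda>r x. \<lambda>i\<in>I. r \<odot>\<^bsub>M i\<^esub> x i) \<rparr>"

definition free_module :: "('r, 'k) ring_scheme \<Rightarrow> 'b set \<Rightarrow> ('r, 'b \<Rightarrow> 'r) module"
  where "free_module R B =
    \<lparr> carrier = {f. (\<forall>b. f b \<in> carrier R) \<and> {b. f b \<noteq> \<zero>\<^bsub>R\<^esub>} \<subseteq> B \<and> finite {b. f b \<noteq> \<zero>\<^bsub>R\<^esub>}},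
      mult = undefined, one = undefined,
      zero = (\<lambda>_. \<zero>\<^bsub>R\<^esub>),
      add = (\<lambda>f g b. f b \<oplus>\<^bsub>R\<^esub> g b),
      smult = (\<lambda>r f b. r \<otimes>\<^bsub>R\<^esub> f b) \<rparr>"

definition gen :: "('r, 'k) ring_scheme \<Rightarrow> 'b \<Rightarrow> 'b \<Rightarrow> 'r"
  where "gen R b = (\<lambda>b'. if b' = b then \<one>\<^bsub>R\<^esub> else \<zero>\<^bsub>R\<^esub>)"

text \<open>The linear extension to the free module of a map \<open>\<phi>\<close> given on basis elements.\<close>

definition lin_ext ::
  "('r, 'k) ring_scheme \<Rightarrow> ('r, 'a, 'm) module_scheme \<Rightarrow> ('b \<Rightarrow> 'a) \<Rightarrow> ('b \<Rightarrow> 'r) \<Rightarrow> 'a"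
  where "lin_ext R M \<phi> f = (\<Oplus>\<^bsub>M\<^esub>b\<in>{b. f b \<noteq> \<zero>\<^bsub>R\<^esub>}. f b \<odot>\<^bsub>M\<^esub> \<phi> b)"

definition submodule_span ::
  "('r, 'k) ring_scheme \<Rightarrow> ('r, 'a, 'm) module_scheme \<Rightarrow> 'a set \<Rightarrow> 'a set"
  where "submodule_span R M S = \<Inter> {N. submodule N R M \<and> S \<subseteq> N}"

definition quotient_module :: "('r, 'a, 'm) module_scheme \<Rightarrow> 'a set \<Rightarrow> ('r, 'a set) module"
  where "quotient_module M N =
    \<lparr> carrier = a_rcosets\<^bsub>M\<^esub> N,
      mult = undefined, one = undefined,
      zero = N,
      add = (\<lambda>X Y. X <+>\<^bsub>M\<^esub> Y),
      smult = (\<lambda>r X. \<Union>x\<in>X. N +>\<^bsub>M\<^esub> (r \<odot>\<^bsub>M\<^esub> x)) \<rparr>"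


section \<open>Tensor products\<close>

subsection \<open>The tensor product of two modules\<close>

definition tensor_rel ::
  "('r, 'k) ring_scheme \<Rightarrow> ('r, 'a, 'm) module_scheme \<Rightarrow> ('r, 'b, 'n) module_scheme \<Rightarrow>
    ('a \<times> 'b \<Rightarrow> 'r) set"
  where "tensor_rel R M N =
    (let F = free_module R (carrier M \<times> carrier N) in
      submodule_span R F
       ({gen R (x \<oplus>\<^bsub>M\<^esub> x', y) \<ominus>\<^bsub>F\<^esub> (gen R (x, y) \<oplus>\<^bsub>F\<^esub> gen R (x', y)) | x x' y.
            x \<in> carrier M \<and> x' \<in> carrier M \<and> y \<in> carrier N} \<union>
        {gen R (x, y \<oplus>\<^bsub>N\<^esub> y') \<ominus>\<^bsub>F\<^esub> (gen R (x, y) \<oplus>\<^bsub>F\<^esub> gen R (x, y')) | x y y'.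
            x \<in> carrier M \<and> y \<in> carrier N \<and> y' \<in> carrier N} \<union>
        {gen R (r \<odot>\<^bsub>M\<^esub> x, y) \<ominus>\<^bsub>F\<^esub> (r \<odot>\<^bsub>F\<^esub> gen R (x, y)) | r x y.
            r \<in> carrier R \<and> x \<in> carrier M \<and> y \<in> carrier N} \<union>
        {gen R (x, r \<odot>\<^bsub>N\<^esub> y) \<ominus>\<^bsub>F\<^esub> (r \<odot>\<^bsub>F\<^esub> gen R (x, y)) | r x y.
            r \<in> carrier R \<and> x \<in> carrier M \<and> y \<in> carrier N}))"

definition tensor ::
  "('r, 'k) ring_scheme \<Rightarrow> ('r, 'a, 'm) module_scheme \<Rightarrow> ('r, 'b, 'n) module_scheme \<Rightarrow>
    ('r, ('a \<times> 'b \<Rightarrow> 'r) set) module"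
  where "tensor R M N =
    quotient_module (free_module R (carrier M \<times> carrier N)) (tensor_rel R M N)"

definition pure_tensor ::
  "('r, 'k) ring_scheme \<Rightarrow> ('r, 'a, 'm) module_scheme \<Rightarrow> ('r, 'b, 'n) module_scheme \<Rightarrow>
    'a \<Rightarrow> 'b \<Rightarrow> ('a \<times> 'b \<Rightarrow> 'r) set"
  where "pure_tensor R M N x y =
    tensor_rel R M N +>\<^bsub>free_module R (carrier M \<times> carrier N)\<^esub> gen R (x, y)"

text \<open>The map \<open>h \<otimes> id\<close> from \<open>M \<otimes> N\<close> to \<open>M' \<otimes> N\<close> induced by \<open>x \<otimes> y \<mapsto> h x \<otimes> y\<close>; the linear extension
  is constant on each coset.\<close>

definition tensor_map_id ::
  "('r, 'k) ring_scheme \<Rightarrow> ('r, 'c, 'l) module_scheme \<Rightarrow> ('r, 'b, 'n) module_scheme \<Rightarrow>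
    ('a \<Rightarrow> 'c) \<Rightarrow> ('a \<times> 'b \<Rightarrow> 'r) set \<Rightarrow> ('c \<times> 'b \<Rightarrow> 'r) set"
  where "tensor_map_id R M' N h X =
    the_elem (lin_ext R (tensor R M' N) (\<lambda>(x, y). pure_tensor R M' N (h x) y) ` X)"

subsection \<open>Tensor powers\<close>

text \<open>\<open>A \<otimes> \<dots> \<otimes> A\<close> with \<open>n\<close> factors, where the list \<open>[a\<^sub>1, \<dots>, a\<^sub>n]\<close> stands for \<open>a\<^sub>1 \<otimes> \<dots> \<otimes> a\<^sub>n\<close>.\<close>

definition tuples :: "('r, 'a, 'm) module_scheme \<Rightarrow> nat \<Rightarrow> 'a list set"
  where "tuples A n = {xs. length xs = n \<and> set xs \<subseteq> carrier A}"

definition power_rel ::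
  "('r, 'k) ring_scheme \<Rightarrow> ('r, 'a, 'm) module_scheme \<Rightarrow> nat \<Rightarrow> ('a list \<Rightarrow> 'r) set"
  where "power_rel R A n =
    (let F = free_module R (tuples A n) in
      submodule_span R F
       ({gen R (xs[i := x \<oplus>\<^bsub>A\<^esub> y]) \<ominus>\<^bsub>F\<^esub> (gen R (xs[i := x]) \<oplus>\<^bsub>F\<^esub> gen R (xs[i := y])) | xs i x y.
            xs \<in> tuples A n \<and> i < n \<and> x \<in> carrier A \<and> y \<in> carrier A} \<union>
        {gen R (xs[i := r \<odot>\<^bsub>A\<^esub> x]) \<ominus>\<^bsub>F\<^esub> (r \<odot>\<^bsub>F\<^esub> gen R (xs[i := x])) | xs i r x.
            xs \<in> tuples A n \<and> i < n \<and> r \<in> carrier R \<and> x \<in> carrier A}))"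

definition tensor_power ::
  "('r, 'k) ring_scheme \<Rightarrow> ('r, 'a, 'm) module_scheme \<Rightarrow> nat \<Rightarrow> ('r, ('a list \<Rightarrow> 'r) set) module"
  where "tensor_power R A n = quotient_module (free_module R (tuples A n)) (power_rel R A n)"

definition pure_power ::
  "('r, 'k) ring_scheme \<Rightarrow> ('r, 'a, 'm) module_scheme \<Rightarrow> 'a list \<Rightarrow> ('a list \<Rightarrow> 'r) set"
  where "pure_power R A xs =
    power_rel R A (length xs) +>\<^bsub>free_module R (tuples A (length xs))\<^esub> gen R xs"


section \<open>Cochain complexes of modules\<close>

text \<open>Complexes are indexed by the integers, so that shifting needs no case distinction.\<close>

record ('r, 'c) cochain =
  obj :: "int \<Rightarrow> ('r, 'c) module"
  diff :: "int \<Rightarrow> 'c \<Rightarrow> 'c"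

definition cochain_complex :: "('r, 'k) ring_scheme \<Rightarrow> ('r, 'c) cochain \<Rightarrow> bool"
  where "cochain_complex R C \<longleftrightarrow>
    (\<forall>n. module R (obj C n) \<and> diff C n \<in> mod_hom R (obj C n) (obj C (n + 1)) \<and>
         (\<forall>x\<in>carrier (obj C n). diff C (n + 1) (diff C n x) = \<zero>\<^bsub>obj C (n + 2)\<^esub>))"

definition cochain_map ::
  "('r, 'k) ring_scheme \<Rightarrow> ('r, 'c) cochain \<Rightarrow> ('r, 'd) cochain \<Rightarrow> (int \<Rightarrow> 'c \<Rightarrow> 'd) \<Rightarrow> bool"
  where "cochain_map R C D f \<longleftrightarrow>
    (\<forall>n. f n \<in> mod_hom R (obj C n) (obj D n) \<and>
         (\<forall>x\<in>carrier (obj C n). f (n + 1) (diff C n x) = diff D n (f n x)))"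

text \<open>\<open>0 \<rightarrow> C \<rightarrow> D \<rightarrow> E \<rightarrow> 0\<close> with maps \<open>f\<close> and \<open>g\<close>.\<close>

definition short_exact ::
  "('r, 'k) ring_scheme \<Rightarrow> ('r, 'c) cochain \<Rightarrow> ('r, 'd) cochain \<Rightarrow> ('r, 'e) cochain \<Rightarrow>
    (int \<Rightarrow> 'c \<Rightarrow> 'd) \<Rightarrow> (int \<Rightarrow> 'd \<Rightarrow> 'e) \<Rightarrow> bool"
  where "short_exact R C D E f g \<longleftrightarrow>
    cochain_complex R C \<and> cochain_complex R D \<and> cochain_complex R E \<and>
    cochain_map R C D f \<and> cochain_map R D E g \<and>
    (\<forall>n. inj_on (f n) (carrier (obj C n)) \<and>
         f n ` carrier (obj C n) = {x \<in> carrier (obj D n). g n x = \<zero>\<^bsub>obj E n\<^esub>} \<and>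
         g n ` carrier (obj D n) = carrier (obj E n))"

text \<open>The shift \<open>C\<^sup>*\<^sup>-\<^sup>1\<close>; no sign is introduced in the differential.\<close>

definition shift :: "('r, 'c) cochain \<Rightarrow> ('r, 'c) cochain"
  where "shift C = \<lparr> obj = (\<lambda>n. obj C (n - 1)), diff = (\<lambda>n. diff C (n - 1)) \<rparr>"

text \<open>\<open>C \<otimes> N\<close>, where the module \<open>N\<close> is concentrated in degree 0.\<close>

definition tensor_complex ::
  "('r, 'k) ring_scheme \<Rightarrow> ('r, 'c) cochain \<Rightarrow> ('r, 'b, 'n) module_scheme \<Rightarrow>
    ('r, ('c \<times> 'b \<Rightarrow> 'r) set) cochain"
  where "tensor_complex R C N =
    \<lparr> obj = (\<lambda>n. tensor R (obj C n) N),
      diff = (\<lambda>n. tensor_map_id R (obj C (n + 1)) N (diff C n)) \<rparr>"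


section \<open>Multipaths\<close>

text \<open>Digraphs in our sense are those of the locale \<^locale>\<open>pair_digraph\<close>: finite, arcs are ordered pairs
  of vertices, no loops.\<close>

definition incident_arcs :: "'v pair_pre_digraph \<Rightarrow> 'v \<Rightarrow> ('v \<times> 'v) set"
  where "incident_arcs G x = in_arcs (with_proj G) x \<union> out_arcs (with_proj G) x"

definition valence :: "'v pair_pre_digraph \<Rightarrow> 'v \<Rightarrow> nat"
  where "valence G x = in_degree (with_proj G) x + out_degree (with_proj G) x"

definition joins :: "'v \<times> 'v \<Rightarrow> 'v \<Rightarrow> 'v \<Rightarrow> bool"
  where "joins e x y \<longleftrightarrow> e = (x, y) \<or> e = (y, x)"

text \<open>Connected components are weak: they are the strong components of the symmetric closure,
  represented by their vertex sets.\<close>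

definition component_of :: "'v pair_pre_digraph \<Rightarrow> 'v \<Rightarrow> 'v set"
  where "component_of H x = pre_digraph.scc_of (with_proj (mk_symmetric (with_proj H))) x"

definition components :: "'v pair_pre_digraph \<Rightarrow> 'v set set"
  where "components H = component_of H ` pverts H"

text \<open>The component with vertex set \<open>c\<close> consists exactly of the vertices and arcs of a directed path
  without repeated vertices; the path with no arcs is the case of a single vertex.\<close>

definition path_component :: "'v pair_pre_digraph \<Rightarrow> 'v set \<Rightarrow> bool"
  where "path_component H c \<longleftrightarrow>
    (\<exists>x p y. pre_digraph.apath (with_proj H) x p y \<and>
       set (pre_digraph.awalk_verts (with_proj H) x p) = verts (with_proj H \<restriction> c) \<and>
       set p = arcs (with_proj H \<restriction> c))"

definition multipaths :: "'v pair_pre_digraph \<Rightarrow> 'v pair_pre_digraph set"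
  where "multipaths G =
    {H. spanning (with_proj H) (with_proj G) \<and> (\<forall>c\<in>components H. path_component H c)}"

definition multipaths_of_size :: "'v pair_pre_digraph \<Rightarrow> int \<Rightarrow> 'v pair_pre_digraph set"
  where "multipaths_of_size G n = {H \<in> multipaths G. int (card (parcs H)) = n}"

text \<open>\<open>H \<prec> H'\<close>, i.e. \<open>H' = H \<union> e\<close> for an arc \<open>e\<close> not in \<open>H\<close>.\<close>

definition precedes :: "'v pair_pre_digraph \<Rightarrow> 'v pair_pre_digraph \<Rightarrow> bool"
  where "precedes H H' \<longleftrightarrow> (\<exists>e. e \<notin> parcs H \<and> H' = H\<lparr>parcs := insert e (parcs H)\<rparr>)"

definition new_arc :: "'v pair_pre_digraph \<Rightarrow> 'v pair_pre_digraph \<Rightarrow> 'v \<times> 'v"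
  where "new_arc H H' = the_elem (parcs H' - parcs H)"


section \<open>The multipath cochain complex\<close>

text \<open>Total orders on vertices and arcs are reflexive relations: \<open>(x, y) \<in> rV\<close> means \<open>x \<le> y\<close>.\<close>

definition min_vertex :: "'v rel \<Rightarrow> 'v set \<Rightarrow> 'v"
  where "min_vertex rV c = (THE x. x \<in> c \<and> (\<forall>y\<in>c. (x, y) \<in> rV))"

text \<open>The components \<open>c\<^sub>0 < \<dots> < c\<^sub>k\<close>, ordered by their minimal vertices.\<close>

definition component_list :: "'v rel \<Rightarrow> 'v pair_pre_digraph \<Rightarrow> 'v set list"
  where "component_list rV H =
    (THE cs. distinct cs \<and> set cs = components H \<and>
       sorted_wrt (\<lambda>c d. (min_vertex rV c, min_vertex rV d) \<in> rV) cs)"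

text \<open>The entry of \<open>a\<^sub>0 \<otimes> \<dots> \<otimes> a\<^sub>k\<close> in the factor indexed by the component \<open>c\<close>.\<close>

definition entry :: "'v rel \<Rightarrow> 'v pair_pre_digraph \<Rightarrow> 'a list \<Rightarrow> 'v set \<Rightarrow> 'a"
  where "entry rV H xs c =
    xs ! (THE i. i < length (component_list rV H) \<and> component_list rV H ! i = c)"

definition multipath_module ::
  "('r, 'k) ring_scheme \<Rightarrow> ('r, 'a, 'm) module_scheme \<Rightarrow> 'v rel \<Rightarrow> 'v pair_pre_digraph \<Rightarrow>
    ('r, ('a list \<Rightarrow> 'r) set) module"
  where "multipath_module R A rV H = tensor_power R A (length (component_list rV H))"

text \<open>
  The effect of \<open>\<mu>\<close> on tuples for \<open>H' = H \<union> e\<close>. The only component of \<open>H'\<close> that is not a component of \<open>H\<close>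
  is the merged one, which contains \<open>s(e) = fst e\<close>. If \<open>e\<close> merges \<open>c\<^sub>i\<close> and \<open>c\<^sub>j\<close> with \<open>i < j\<close>, the merged
  component has the minimal vertex of \<open>c\<^sub>i\<close>, so it is the \<open>i\<close>-th in \<open>component_list rV H'\<close>, and the others
  keep their relative order.
\<close>

definition merge_entries ::
  "('r, 'a, 'm) module_scheme \<Rightarrow> 'v rel \<Rightarrow> 'v pair_pre_digraph \<Rightarrow> 'v pair_pre_digraph \<Rightarrow>
    'a list \<Rightarrow> 'a list"
  where "merge_entries A rV H H' xs =
    (let e = new_arc H H' in
      map (\<lambda>c. if fst e \<in> c
               then entry rV H xs (component_of H (fst e)) \<otimes>\<^bsub>A\<^esub>
                    entry rV H xs (component_of H (snd e))
               else entry rV H xs c)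
        (component_list rV H'))"

definition multipath_mu ::
  "('r, 'k) ring_scheme \<Rightarrow> ('r, 'a, 'm) module_scheme \<Rightarrow> 'v rel \<Rightarrow>
    'v pair_pre_digraph \<Rightarrow> 'v pair_pre_digraph \<Rightarrow> ('a list \<Rightarrow> 'r) set \<Rightarrow> ('a list \<Rightarrow> 'r) set"
  where "multipath_mu R A rV H H' X =
    the_elem (lin_ext R (multipath_module R A rV H')
                (\<lambda>xs. pure_power R A (merge_entries A rV H H' xs)) ` X)"

definition arc_sign :: "('v \<times> 'v) rel \<Rightarrow> 'v pair_pre_digraph \<Rightarrow> 'v pair_pre_digraph \<Rightarrow> nat"
  where "arc_sign rE H H' = card {f \<in> parcs H. (f, new_arc H H') \<in> rE}"

definition multipath_complex ::
  "('r, 'k) ring_scheme \<Rightarrow> ('r, 'a, 'm) module_scheme \<Rightarrow> 'v pair_pre_digraph \<Rightarrow>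
    'v rel \<Rightarrow> ('v \<times> 'v) rel \<Rightarrow> ('r, 'v pair_pre_digraph \<Rightarrow> ('a list \<Rightarrow> 'r) set) cochain"
  where "multipath_complex R A G rV rE =
    \<lparr> obj = (\<lambda>n. direct_sum (multipaths_of_size G n) (multipath_module R A rV)),
      diff = (\<lambda>n x. \<lambda>H'\<in>multipaths_of_size G (n + 1).
        \<Oplus>\<^bsub>multipath_module R A rV H'\<^esub>H\<in>{H \<in> multipaths_of_size G n. precedes H H'}.
          ((\<ominus>\<^bsub>R\<^esub> \<one>\<^bsub>R\<^esub>) [^]\<^bsub>R\<^esub> arc_sign rE H H') \<odot>\<^bsub>multipath_module R A rV H'\<^esub>
            multipath_mu R A rV H H' (x H)) \<rparr>"

end

theory Submission
  imports Defs
begin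

text \<open>
  A spanning subgraph is a multipath iff its arcs form a partial injection without cycles. A multipath of
  \<open>G\<close> that avoids \<open>e1\<close> is a multipath of \<open>G'\<close> plus the isolated vertex \<open>v\<close>. The multipaths that contain
  \<open>e1\<close> are, if \<open>e1\<close> and \<open>e2\<close> are coherently oriented, all \<open>H \<union> e1\<close> with \<open>H\<close> a multipath of \<open>G'\<close>; otherwise \<open>e1\<close>
  excludes \<open>e2\<close>, and they are all \<open>H \<union> e1\<close> with \<open>H\<close> a multipath of \<open>G''\<close>. The differential only adds arcs, so
  the summands of the multipaths containing \<open>e1\<close> form a subcomplex, and the others form the quotient. An
  additional component \<open>{v}\<close> or \<open>{u, v}\<close> contributes one more tensor factor \<open>A\<close> on which the differential is
  the identity, whereas prolonging the path through \<open>u\<close> by \<open>e1\<close> only relabels a component. The orders on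
  vertices permute tensor factors, and the orders on arcs change signs by the parity of the number of
  inversions.
\<close>

section \<open>Homomorphisms of modules\<close>

text \<open>The modules are concrete quotients, so the two sides of a desired isomorphism have
  different elements: \<open>C \<otimes> A\<close> is a quotient of a free module over a direct sum,
  not itself a direct sum of tensor products. Complexes are therefore compared through matrices. A
  finite biproduct is a system of injections and projections subject to equations, which tensoring
  preserves, and exactness reduces to isomorphisms of single summands that intertwine matrix
  entries. In one summand, the position of a tensor factor depends on the vertex order; writing
  tuples as functions on the set of components turns \<open>\<mu>\<close> into a formula free of
  positions. The signs force one more correction: the arc orders of \<open>G\<close>,
  \<open>G'\<close> and \<open>G''\<close> are unrelated, and \<open>e1\<close>, present throughout
  the subcomplex, flips the sign of every arc that it precedes. So the isomorphism at the arc set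
  \<open>E\<close> is multiplied by a sign \<open>\<zeta> E\<close> whose change along each new arc
  is the discrepancy between the two differentials.\<close>

lemma mod_homI:
  assumes "\<And>x. x \<in> carrier M \<Longrightarrow> h x \<in> carrier N"
    and "\<And>x y. x \<in> carrier M \<Longrightarrow> y \<in> carrier M \<Longrightarrow> h (x \<oplus>\<^bsub>M\<^esub> y) = h x \<oplus>\<^bsub>N\<^esub> h y"
    and "\<And>r x. r \<in> carrier R \<Longrightarrow> x \<in> carrier M \<Longrightarrow> h (r \<odot>\<^bsub>M\<^esub> x) = r \<odot>\<^bsub>N\<^esub> h x"
  shows "h \<in> mod_hom R M N"
  using assms by (auto simp: mod_hom_def hom_def)

lemma mod_hom_closed: "h \<in> mod_hom R M N \<Longrightarrow> x \<in> carrier M \<Longrightarrow> h x \<in> carrier N"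
  by (auto simp: mod_hom_def hom_def)

lemma mod_hom_add:
  "h \<in> mod_hom R M N \<Longrightarrow> x \<in> carrier M \<Longrightarrow> y \<in> carrier M \<Longrightarrow> h (x \<oplus>\<^bsub>M\<^esub> y) = h x \<oplus>\<^bsub>N\<^esub> h y"
  by (auto simp: mod_hom_def hom_def)

lemma mod_hom_smult:
  "h \<in> mod_hom R M N \<Longrightarrow> r \<in> carrier R \<Longrightarrow> x \<in> carrier M \<Longrightarrow> h (r \<odot>\<^bsub>M\<^esub> x) = r \<odot>\<^bsub>N\<^esub> h x"
  by (auto simp: mod_hom_def)

lemma mod_hom_cong:
  assumes "h \<in> mod_hom R M N" "module R M" "\<And>x. x \<in> carrier M \<Longrightarrow> k x = h x"
  shows "k \<in> mod_hom R M N"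
proof -
  interpret M: module R M by fact
  show ?thesis
    using assms(1,3) by (intro mod_homI) (auto simp: mod_hom_closed mod_hom_add mod_hom_smult)
qed

lemma mod_hom_comp:
  assumes "h \<in> mod_hom R M N" "k \<in> mod_hom R N P"
  shows "(\<lambda>x. k (h x)) \<in> mod_hom R M P"
  using assms by (intro mod_homI) (auto simp: mod_hom_closed mod_hom_add mod_hom_smult)

lemma mod_hom_id: "(\<lambda>x. x) \<in> mod_hom R M M"
  by (intro mod_homI) auto

lemma mod_hom_zero:
  assumes "h \<in> mod_hom R M N" "module R M" "module R N"
  shows "h \<zero>\<^bsub>M\<^esub> = \<zero>\<^bsub>N\<^esub>"
proof -
  interpret M: module R M by fact
  interpret N: module R N by fact
  have "h \<zero>\<^bsub>M\<^esub> = h (\<zero>\<^bsub>R\<^esub> \<odot>\<^bsub>M\<^esub> \<zero>\<^bsub>M\<^esub>)"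
    by simp
  also have "\<dots> = \<zero>\<^bsub>R\<^esub> \<odot>\<^bsub>N\<^esub> h \<zero>\<^bsub>M\<^esub>"
    using assms(1) by (intro mod_hom_smult) auto
  also have "\<dots> = \<zero>\<^bsub>N\<^esub>"
    using assms(1) by (simp add: mod_hom_closed)
  finally show ?thesis .
qed

lemma mod_hom_minus:
  assumes "h \<in> mod_hom R M N" "module R M" "module R N" "x \<in> carrier M" "y \<in> carrier M"
  shows "h (x \<ominus>\<^bsub>M\<^esub> y) = h x \<ominus>\<^bsub>N\<^esub> h y"
proof -
  interpret M: module R M by fact
  interpret N: module R N by fact
  have e: "\<ominus>\<^bsub>M\<^esub> y = (\<ominus>\<^bsub>R\<^esub> \<one>\<^bsub>R\<^esub>) \<odot>\<^bsub>M\<^esub> y" "\<ominus>\<^bsub>N\<^esub> h y = (\<ominus>\<^bsub>R\<^esub> \<one>\<^bsub>R\<^esub>) \<odot>\<^bsub>N\<^esub> h y"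
    using assms by (simp_all add: M.smult_l_minus N.smult_l_minus mod_hom_closed)
  show ?thesis
    unfolding a_minus_def e using assms by (simp add: mod_hom_add mod_hom_smult)
qed

lemma mod_hom_finsum:
  assumes "h \<in> mod_hom R M N" "module R M" "module R N" "finite I" "f \<in> I \<rightarrow> carrier M"
  shows "h (\<Oplus>\<^bsub>M\<^esub>i\<in>I. f i) = (\<Oplus>\<^bsub>N\<^esub>i\<in>I. h (f i))"
proof -
  interpret M: module R M by fact
  interpret N: module R N by fact
  from assms(4,5) show ?thesis
  proof (induction I)
    case empty
    then show ?case using assms by (simp add: mod_hom_zero)
  next
    case (insert i I)
    then have "(\<lambda>i. h (f i)) \<in> I \<rightarrow> carrier N" "h (f i) \<in> carrier N"
      using mod_hom_closed[OF assms(1)] by auto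
    with insert show ?case
      by (simp add: mod_hom_add[OF assms(1)] M.finsum_closed Pi_def)
  qed
qed

lemma mod_hom_zero_map:
  assumes "module R N"
  shows "(\<lambda>_. \<zero>\<^bsub>N\<^esub>) \<in> mod_hom R M N"
proof -
  interpret N: module R N by fact
  show ?thesis by (intro mod_homI) auto
qed

lemma mod_hom_add_map:
  assumes "module R N" "h \<in> mod_hom R M N" "k \<in> mod_hom R M N"
  shows "(\<lambda>x. h x \<oplus>\<^bsub>N\<^esub> k x) \<in> mod_hom R M N"
proof -
  interpret N: module R N by fact
  show ?thesis
    using assms(2,3)
    by (intro mod_homI)
      (auto simp: mod_hom_closed mod_hom_add mod_hom_smult N.smult_r_distr N.a_ac)
qed

lemma mod_hom_smult_map:
  assumes "module R N" "h \<in> mod_hom R M N" "r \<in> carrier R"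
  shows "(\<lambda>x. r \<odot>\<^bsub>N\<^esub> h x) \<in> mod_hom R M N"
proof -
  interpret N: module R N by fact
  \<comment> \<open>Multiplication by \<open>r\<close> respects scalars because \<open>R\<close> is
    commutative.\<close>
  have c: "r \<odot>\<^bsub>N\<^esub> (s \<odot>\<^bsub>N\<^esub> x) = s \<odot>\<^bsub>N\<^esub> (r \<odot>\<^bsub>N\<^esub> x)" if "s \<in> carrier R" "x \<in> carrier N" for s x
    using that assms(3) by (metis N.smult_assoc1 N.R.m_comm)
  show ?thesis
    using assms(2,3)
    by (intro mod_homI) (auto simp: mod_hom_closed mod_hom_add mod_hom_smult N.smult_r_distr c)
qed

lemma mod_hom_finsum_map:
  assumes "module R N" "finite I" "\<And>i. i \<in> I \<Longrightarrow> h i \<in> mod_hom R M N"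
  shows "(\<lambda>x. \<Oplus>\<^bsub>N\<^esub>i\<in>I. h i x) \<in> mod_hom R M N"
proof -
  interpret N: module R N by fact
  have cl: "(\<lambda>i. h i x) \<in> I \<rightarrow> carrier N" if "x \<in> carrier M" for x
    using assms(3) that by (blast intro: mod_hom_closed)
  show ?thesis
  proof (rule mod_homI)
    fix x y assume xy: "x \<in> carrier M" "y \<in> carrier M"
    have "(\<Oplus>\<^bsub>N\<^esub>i\<in>I. h i (x \<oplus>\<^bsub>M\<^esub> y)) = (\<Oplus>\<^bsub>N\<^esub>i\<in>I. h i x \<oplus>\<^bsub>N\<^esub> h i y)"
      using xy assms(3) cl[OF xy(1)] cl[OF xy(2)]
      by (intro N.finsum_cong') (auto simp: Pi_def intro!: mod_hom_add)
    also have "\<dots> = (\<Oplus>\<^bsub>N\<^esub>i\<in>I. h i x) \<oplus>\<^bsub>N\<^esub> (\<Oplus>\<^bsub>N\<^esub>i\<in>I. h i y)"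
      using cl xy by (intro N.finsum_addf) auto
    finally show "(\<Oplus>\<^bsub>N\<^esub>i\<in>I. h i (x \<oplus>\<^bsub>M\<^esub> y)) = (\<Oplus>\<^bsub>N\<^esub>i\<in>I. h i x) \<oplus>\<^bsub>N\<^esub> (\<Oplus>\<^bsub>N\<^esub>i\<in>I. h i y)" .
  next
    fix r x assume rx: "r \<in> carrier R" "x \<in> carrier M"
    have "(\<Oplus>\<^bsub>N\<^esub>i\<in>I. h i (r \<odot>\<^bsub>M\<^esub> x)) = (\<Oplus>\<^bsub>N\<^esub>i\<in>I. r \<odot>\<^bsub>N\<^esub> h i x)"
      using rx assms(3) cl[OF rx(2)] by (intro N.finsum_cong') (auto simp: Pi_def intro!: mod_hom_smult)
    also have "\<dots> = r \<odot>\<^bsub>N\<^esub> (\<Oplus>\<^bsub>N\<^esub>i\<in>I. h i x)"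
      using N.finsum_smult_ldistr[OF assms(2) rx(1) cl[OF rx(2)]] by simp
    finally show "(\<Oplus>\<^bsub>N\<^esub>i\<in>I. h i (r \<odot>\<^bsub>M\<^esub> x)) = r \<odot>\<^bsub>N\<^esub> (\<Oplus>\<^bsub>N\<^esub>i\<in>I. h i x)" .
  qed (use cl in \<open>auto intro!: N.finsum_closed\<close>)
qed

lemma mod_hom_inv_into:
  assumes "module R M" "h \<in> mod_hom R M N" "bij_betw h (carrier M) (carrier N)"
  shows "inv_into (carrier M) h \<in> mod_hom R N M"
proof -
  interpret M: module R M by fact
  let ?k = "inv_into (carrier M) h"
  have k: "?k y \<in> carrier M" "h (?k y) = y" if "y \<in> carrier N" for y
    using assms(3) that by (auto simp: bij_betw_def inv_into_into f_inv_into_f)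
  have kh: "?k (h x) = x" if "x \<in> carrier M" for x
    using assms(3) that by (auto simp: bij_betw_def)
  show ?thesis
  proof (rule mod_homI)
    fix x y assume xy: "x \<in> carrier N" "y \<in> carrier N"
    then have "?k (h (?k x \<oplus>\<^bsub>M\<^esub> ?k y)) = ?k x \<oplus>\<^bsub>M\<^esub> ?k y"
      using k by (intro kh) auto
    then show "?k (x \<oplus>\<^bsub>N\<^esub> y) = ?k x \<oplus>\<^bsub>M\<^esub> ?k y"
      using xy k by (simp add: mod_hom_add[OF assms(2)])
  next
    fix r x assume rx: "r \<in> carrier R" "x \<in> carrier N"
    then have "?k (h (r \<odot>\<^bsub>M\<^esub> ?k x)) = r \<odot>\<^bsub>M\<^esub> ?k x"
      using k by (intro kh) auto
    then show "?k (r \<odot>\<^bsub>N\<^esub> x) = r \<odot>\<^bsub>M\<^esub> ?k x"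
      using rx k by (simp add: mod_hom_smult[OF assms(2)])
  qed (use k in auto)
qed

section \<open>Modules presented by generators and relations\<close>

lemma free_module_simps:
  "\<zero>\<^bsub>free_module R B\<^esub> = (\<lambda>_. \<zero>\<^bsub>R\<^esub>)"
  "f \<oplus>\<^bsub>free_module R B\<^esub> g = (\<lambda>b. f b \<oplus>\<^bsub>R\<^esub> g b)"
  "r \<odot>\<^bsub>free_module R B\<^esub> f = (\<lambda>b. r \<otimes>\<^bsub>R\<^esub> f b)"
  by (simp_all add: free_module_def)

lemma free_moduleD:
  assumes "f \<in> carrier (free_module R B)"
  shows "f b \<in> carrier R" "{b. f b \<noteq> \<zero>\<^bsub>R\<^esub>} \<subseteq> B" "finite {b. f b \<noteq> \<zero>\<^bsub>R\<^esub>}"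
  using assms by (auto simp: free_module_def)

lemma free_moduleI:
  assumes "\<And>b. f b \<in> carrier R" "finite S" "S \<subseteq> B" "\<And>b. b \<notin> S \<Longrightarrow> f b = \<zero>\<^bsub>R\<^esub>"
  shows "f \<in> carrier (free_module R B)"
proof -
  have "{b. f b \<noteq> \<zero>\<^bsub>R\<^esub>} \<subseteq> S"
    using assms(4) by auto
  then show ?thesis
    using assms finite_subset[of _ S] by (auto simp: free_module_def)
qed

lemma free_module_module:
  assumes "cring R"
  shows "module R (free_module R B)"
proof -
  interpret R: cring R by fact
  let ?F = "free_module R B"
  have add: "(\<lambda>b. f b \<oplus>\<^bsub>R\<^esub> g b) \<in> carrier ?F" if "f \<in> carrier ?F" "g \<in> carrier ?F" for f g
    using free_moduleD[OF that(1)] free_moduleD[OF that(2)]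
    by (intro free_moduleI[of _ _ "{b. f b \<noteq> \<zero>\<^bsub>R\<^esub>} \<union> {b. g b \<noteq> \<zero>\<^bsub>R\<^esub>}"]) auto
  have smult: "(\<lambda>b. r \<otimes>\<^bsub>R\<^esub> f b) \<in> carrier ?F" if "r \<in> carrier R" "f \<in> carrier ?F" for r f
    using free_moduleD[OF that(2)] that(1)
    by (intro free_moduleI[of _ _ "{b. f b \<noteq> \<zero>\<^bsub>R\<^esub>}"]) auto
  have zero: "(\<lambda>_. \<zero>\<^bsub>R\<^esub>) \<in> carrier ?F"
    by (intro free_moduleI[of _ _ "{}"]) auto
  show ?thesis
  proof (rule moduleI)
    show "abelian_group ?F"
    proof (rule abelian_groupI)
      fix f assume f: "f \<in> carrier ?F"
      have "(\<lambda>b. (\<ominus>\<^bsub>R\<^esub> \<one>\<^bsub>R\<^esub>) \<otimes>\<^bsub>R\<^esub> f b) \<in> carrier ?F"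
        using f by (intro smult) auto
      moreover have "(\<ominus>\<^bsub>R\<^esub> \<one>\<^bsub>R\<^esub>) \<otimes>\<^bsub>R\<^esub> f b \<oplus>\<^bsub>R\<^esub> f b = \<zero>\<^bsub>R\<^esub>" for b
        using free_moduleD(1)[OF f] by (simp add: R.l_minus R.l_neg)
      ultimately show "\<exists>g\<in>carrier ?F. g \<oplus>\<^bsub>?F\<^esub> f = \<zero>\<^bsub>?F\<^esub>"
        by (auto simp: free_module_simps intro!: bexI[of _ "\<lambda>b. (\<ominus>\<^bsub>R\<^esub> \<one>\<^bsub>R\<^esub>) \<otimes>\<^bsub>R\<^esub> f b"])
    qed (auto simp: free_module_simps add zero fun_eq_iff R.a_ac free_moduleD)
  qed (auto simp: free_module_simps smult assms fun_eq_iff R.l_distr R.r_distr R.m_assoc free_moduleD)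
qed

lemma gen_closed:
  assumes "cring R" "b \<in> B"
  shows "gen R b \<in> carrier (free_module R B)"
proof -
  interpret R: cring R by fact
  show ?thesis
    using assms(2) by (intro free_moduleI[of _ _ "{b}"]) (auto simp: gen_def)
qed

context module
begin

text \<open>The sum in \<open>lin_ext\<close> runs over the support of \<open>f\<close>, which
  changes under addition and scaling; summing over one larger finite set makes different arguments
  comparable, the extra terms having coefficient zero.\<close>

lemma lin_ext_superset:
  assumes "f \<in> carrier (free_module R B)" "finite S" "{b. f b \<noteq> \<zero>} \<subseteq> S"
    and "\<And>b. b \<in> S \<Longrightarrow> \<phi> b \<in> carrier M"
  shows "lin_ext R M \<phi> f = (\<Oplus>\<^bsub>M\<^esub>b\<in>S. f b \<odot>\<^bsub>M\<^esub> \<phi> b)"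
  unfolding lin_ext_def using assms free_moduleD(1)[OF assms(1)]
  by (intro M.add.finprod_mono_neutral_cong_left) auto

lemma lin_ext_hom:
  assumes "\<phi> \<in> B \<rightarrow> carrier M"
  shows "lin_ext R M \<phi> \<in> mod_hom R (free_module R B) M"
proof -
  interpret F: module R "free_module R B"
    by (rule free_module_module) (rule R.cring_axioms)
  have cl: "(\<lambda>b. f b \<odot>\<^bsub>M\<^esub> \<phi> b) \<in> S \<rightarrow> carrier M"
    if "f \<in> carrier (free_module R B)" "S \<subseteq> B" for f S
    using assms that free_moduleD(1)[OF that(1)] by auto
  note su = lin_ext_superset
  show ?thesis
  proof (rule mod_homI)
    fix f assume f: "f \<in> carrier (free_module R B)"
    show "lin_ext R M \<phi> f \<in> carrier M"
      unfolding lin_ext_def using cl[OF f free_moduleD(2)[OF f]] by (intro M.finsum_closed)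
    fix g assume g: "g \<in> carrier (free_module R B)"
    let ?S = "{b. f b \<noteq> \<zero>} \<union> {b. g b \<noteq> \<zero>}"
    have S: "finite ?S" "?S \<subseteq> B" "\<And>b. b \<in> ?S \<Longrightarrow> \<phi> b \<in> carrier M"
      using free_moduleD[OF f] free_moduleD[OF g] assms by auto
    have fg: "(\<lambda>b. f b \<oplus> g b) \<in> carrier (free_module R B)"
      using F.a_closed[OF f g] by (simp add: free_module_simps)
    have "lin_ext R M \<phi> (f \<oplus>\<^bsub>free_module R B\<^esub> g) = (\<Oplus>\<^bsub>M\<^esub>b\<in>?S. (f b \<oplus> g b) \<odot>\<^bsub>M\<^esub> \<phi> b)"
      unfolding free_module_simps
      by (rule su[OF fg S(1) _ S(3)]) auto
    also have "\<dots> = (\<Oplus>\<^bsub>M\<^esub>b\<in>?S. f b \<odot>\<^bsub>M\<^esub> \<phi> b \<oplus>\<^bsub>M\<^esub> g b \<odot>\<^bsub>M\<^esub> \<phi> b)"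
      using S free_moduleD(1)[OF f] free_moduleD(1)[OF g]
      by (intro M.finsum_cong') (auto simp: smult_l_distr)
    also have "\<dots> = (\<Oplus>\<^bsub>M\<^esub>b\<in>?S. f b \<odot>\<^bsub>M\<^esub> \<phi> b) \<oplus>\<^bsub>M\<^esub> (\<Oplus>\<^bsub>M\<^esub>b\<in>?S. g b \<odot>\<^bsub>M\<^esub> \<phi> b)"
      using cl[OF f S(2)] cl[OF g S(2)] by (intro M.finsum_addf) auto
    also have "\<dots> = lin_ext R M \<phi> f \<oplus>\<^bsub>M\<^esub> lin_ext R M \<phi> g"
      using su[OF f S(1) _ S(3)] su[OF g S(1) _ S(3)] by auto
    finally show "lin_ext R M \<phi> (f \<oplus>\<^bsub>free_module R B\<^esub> g) = lin_ext R M \<phi> f \<oplus>\<^bsub>M\<^esub> lin_ext R M \<phi> g" .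
  next
    fix r f assume rf: "r \<in> carrier R" "f \<in> carrier (free_module R B)"
    let ?S = "{b. f b \<noteq> \<zero>}"
    have S: "finite ?S" "?S \<subseteq> B" "\<And>b. b \<in> ?S \<Longrightarrow> \<phi> b \<in> carrier M"
      using free_moduleD[OF rf(2)] assms by auto
    have rf': "(\<lambda>b. r \<otimes> f b) \<in> carrier (free_module R B)"
      using F.smult_closed[OF rf] by (simp add: free_module_simps)
    have "lin_ext R M \<phi> (r \<odot>\<^bsub>free_module R B\<^esub> f) = (\<Oplus>\<^bsub>M\<^esub>b\<in>?S. (r \<otimes> f b) \<odot>\<^bsub>M\<^esub> \<phi> b)"
      unfolding free_module_simps
      by (rule su[OF rf' S(1) _ S(3)]) (use rf(1) in auto)
    also have "\<dots> = (\<Oplus>\<^bsub>M\<^esub>b\<in>?S. r \<odot>\<^bsub>M\<^esub> (f b \<odot>\<^bsub>M\<^esub> \<phi> b))"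
      using S free_moduleD(1)[OF rf(2)] rf(1) by (intro M.finsum_cong') (auto simp: smult_assoc1)
    also have "\<dots> = r \<odot>\<^bsub>M\<^esub> (\<Oplus>\<^bsub>M\<^esub>b\<in>?S. f b \<odot>\<^bsub>M\<^esub> \<phi> b)"
      using finsum_smult_ldistr[OF S(1) rf(1) cl[OF rf(2) S(2)]] by simp
    also have "\<dots> = r \<odot>\<^bsub>M\<^esub> lin_ext R M \<phi> f"
      by (simp add: lin_ext_def)
    finally show "lin_ext R M \<phi> (r \<odot>\<^bsub>free_module R B\<^esub> f) = r \<odot>\<^bsub>M\<^esub> lin_ext R M \<phi> f" .
  qed
qed

lemma lin_ext_gen:
  assumes "\<phi> b \<in> carrier M"
  shows "lin_ext R M \<phi> (gen R b) = \<phi> b"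
proof -
  have "gen R b \<in> carrier (free_module R {b})"
    by (rule gen_closed) (auto intro: R.cring_axioms)
  then have "lin_ext R M \<phi> (gen R b) = (\<Oplus>\<^bsub>M\<^esub>b'\<in>{b}. gen R b b' \<odot>\<^bsub>M\<^esub> \<phi> b')"
    using assms by (intro lin_ext_superset) (auto simp: gen_def)
  then show ?thesis
    using assms by (simp add: gen_def)
qed

text \<open>Induction on a finite set containing the support: clearing the coefficient at one basis
  element \<open>b\<close> splits off the multiple \<open>f b\<close> of
  \<open>gen R b\<close>.\<close>

lemma free_module_hom_ext:
  assumes "h \<in> mod_hom R (free_module R B) M" "k \<in> mod_hom R (free_module R B) M"
    and "\<And>b. b \<in> B \<Longrightarrow> h (gen R b) = k (gen R b)" "f \<in> carrier (free_module R B)"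
  shows "h f = k f"
proof -
  let ?F = "free_module R B"
  interpret F: module R ?F
    by (rule free_module_module) (rule R.cring_axioms)
  have "finite S \<Longrightarrow> S \<subseteq> B \<Longrightarrow> f \<in> carrier ?F \<Longrightarrow> {b. f b \<noteq> \<zero>} \<subseteq> S \<Longrightarrow> h f = k f" for S f
  proof (induction S arbitrary: f rule: finite_induct)
    case empty
    then have "f = \<zero>\<^bsub>?F\<^esub>"
      by (auto simp: free_module_simps)
    then show ?case
      using mod_hom_zero[OF assms(1) F.module_axioms module_axioms]
        mod_hom_zero[OF assms(2) F.module_axioms module_axioms] by simp
  next
    case (insert b S)
    let ?g = "\<lambda>x. if x = b then \<zero> else f x"
    have g: "?g \<in> carrier ?F"
      using insert free_moduleD[OF insert.prems(2)] by (intro free_moduleI[of _ _ S]) auto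
    have b: "gen R b \<in> carrier ?F" "b \<in> B"
      using insert by (auto intro: gen_closed R.cring_axioms)
    have f: "f = ?g \<oplus>\<^bsub>?F\<^esub> f b \<odot>\<^bsub>?F\<^esub> gen R b"
      using free_moduleD(1)[OF insert.prems(2)] by (auto simp: free_module_simps gen_def)
    have gg: "h ?g = k ?g"
      using insert.prems insert.hyps g by (intro insert.IH) auto
    show ?case
      using g b free_moduleD(1)[OF insert.prems(2), of b] assms(3)[OF b(2)] gg
      by (subst (1 2) f) (simp add: mod_hom_add[OF assms(1)] mod_hom_add[OF assms(2)]
          mod_hom_smult[OF assms(1)] mod_hom_smult[OF assms(2)])
  qed
  from this[of "{b. f b \<noteq> \<zero>}"] show ?thesis
    using free_moduleD[OF assms(4)] assms(4) by simp
qed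

lemma submodule_span_submodule:
  assumes "S \<subseteq> carrier M"
  shows "submodule (submodule_span R M S) R M"
proof (rule submoduleI)
  show "submodule_span R M S \<subseteq> carrier M"
    using assms carrier_is_submodule by (auto simp: submodule_span_def)
qed (auto simp: submodule_span_def dest: submoduleE intro: submodule.smult_closed
    subgroup.one_closed[OF submodule.axioms(1), simplified])

lemma submodule_span_superset: "S \<subseteq> submodule_span R M S"
  by (auto simp: submodule_span_def)

lemma submodule_kernel:
  assumes "h \<in> mod_hom R M N" "module R N"
  shows "submodule {x \<in> carrier M. h x = \<zero>\<^bsub>N\<^esub>} R M"
proof -
  interpret N: module R N by fact
  have m: "h (\<ominus>\<^bsub>M\<^esub> x) = \<ominus>\<^bsub>N\<^esub> h x" if "x \<in> carrier M" for x
    using mod_hom_minus[OF assms(1) module_axioms assms(2), of "\<zero>\<^bsub>M\<^esub>" x] that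
      mod_hom_zero[OF assms(1) module_axioms assms(2)] mod_hom_closed[OF assms(1) that]
    by (simp add: a_minus_def)
  show ?thesis
    using assms by (intro submoduleI) (auto simp: m mod_hom_add mod_hom_smult mod_hom_zero[OF _ module_axioms])
qed

text \<open>The kernel is one of the submodules that the span intersects. So vanishing on relators
  alone makes a map descend to the quotient.\<close>

lemma hom_submodule_span_zero:
  assumes "h \<in> mod_hom R M N" "module R N" "S \<subseteq> carrier M" "\<And>x. x \<in> S \<Longrightarrow> h x = \<zero>\<^bsub>N\<^esub>"
    and "x \<in> submodule_span R M S"
  shows "h x = \<zero>\<^bsub>N\<^esub>"
  using assms(5) submodule_kernel[OF assms(1,2)] assms(3,4) unfolding submodule_span_def by blast

end

section \<open>Quotient modules and presentations\<close>

lemma quotient_module_simps: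
  "carrier (quotient_module M N) = a_rcosets\<^bsub>M\<^esub> N"
  "\<zero>\<^bsub>quotient_module M N\<^esub> = N"
  "X \<oplus>\<^bsub>quotient_module M N\<^esub> Y = X <+>\<^bsub>M\<^esub> Y"
  "r \<odot>\<^bsub>quotient_module M N\<^esub> X = (\<Union>x\<in>X. N +>\<^bsub>M\<^esub> (r \<odot>\<^bsub>M\<^esub> x))"
  by (simp_all add: quotient_module_def)

locale quotient = module R M for R (structure) and M (structure) +
  fixes N
  assumes sub: "submodule N R M"
begin

sublocale S: abelian_subgroup N M
  using sub by (intro abelian_subgroupI3 additive_subgroupI) (auto simp: submodule_def abelian_group_axioms)

lemma carrier_quotient: "carrier (quotient_module M N) = (\<lambda>x. N +>\<^bsub>M\<^esub> x) ` carrier M"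
  by (auto simp: quotient_module_simps A_RCOSETS_def')

lemma coset_eq_iff:
  assumes "x \<in> carrier M" "y \<in> carrier M"
  shows "N +>\<^bsub>M\<^esub> x = N +>\<^bsub>M\<^esub> y \<longleftrightarrow> x \<ominus>\<^bsub>M\<^esub> y \<in> N"
proof -
  have "x \<in> N +>\<^bsub>M\<^esub> y \<longleftrightarrow> N +>\<^bsub>M\<^esub> x = N +>\<^bsub>M\<^esub> y"
    using assms S.a_repr_independence' S.a_rcos_self by metis
  then show ?thesis
    using assms S.a_rcos_module[of y x] by (simp add: a_minus_def)
qed

text \<open>Scalar multiplication on the quotient is a union over all representatives of the coset.
  They all give the same coset, because \<open>N\<close> is stable under scalars, so the union is
  that single coset.\<close>

lemma smult_coset:
  assumes "r \<in> carrier R" "x \<in> carrier M"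
  shows "r \<odot>\<^bsub>quotient_module M N\<^esub> (N +>\<^bsub>M\<^esub> x) = N +>\<^bsub>M\<^esub> (r \<odot>\<^bsub>M\<^esub> x)"
proof -
  have "N +>\<^bsub>M\<^esub> (r \<odot>\<^bsub>M\<^esub> y) = N +>\<^bsub>M\<^esub> (r \<odot>\<^bsub>M\<^esub> x)" if "y \<in> N +>\<^bsub>M\<^esub> x" for y
  proof -
    have y: "y \<in> carrier M"
      using that assms(2) S.a_elemrcos_carrier by blast
    then have "y \<ominus>\<^bsub>M\<^esub> x \<in> N"
      using coset_eq_iff[OF y assms(2)] that assms(2) S.a_repr_independence' by metis
    then have "r \<odot>\<^bsub>M\<^esub> (y \<ominus>\<^bsub>M\<^esub> x) \<in> N"
      using assms(1) submodule.smult_closed[OF sub] by blast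
    also have "r \<odot>\<^bsub>M\<^esub> (y \<ominus>\<^bsub>M\<^esub> x) = r \<odot>\<^bsub>M\<^esub> y \<ominus>\<^bsub>M\<^esub> r \<odot>\<^bsub>M\<^esub> x"
      using assms y by (simp add: a_minus_def smult_r_distr smult_r_minus)
    finally show ?thesis
      using assms y coset_eq_iff by simp
  qed
  moreover have "x \<in> N +>\<^bsub>M\<^esub> x"
    using assms(2) S.a_rcos_self by blast
  ultimately show ?thesis
    unfolding quotient_module_simps by blast
qed

lemma add_coset:
  assumes "x \<in> carrier M" "y \<in> carrier M"
  shows "(N +>\<^bsub>M\<^esub> x) \<oplus>\<^bsub>quotient_module M N\<^esub> (N +>\<^bsub>M\<^esub> y) = N +>\<^bsub>M\<^esub> (x \<oplus>\<^bsub>M\<^esub> y)"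
  using assms S.a_rcos_sum by (simp add: quotient_module_simps)

lemma quotient_carrierE:
  assumes "X \<in> carrier (quotient_module M N)"
  obtains x where "x \<in> carrier M" "X = N +>\<^bsub>M\<^esub> x"
  using assms by (auto simp: carrier_quotient)

lemma coset_closed: "x \<in> carrier M \<Longrightarrow> N +>\<^bsub>M\<^esub> x \<in> carrier (quotient_module M N)"
  by (simp add: carrier_quotient)

lemma quotient_module_module: "module R (quotient_module M N)"
proof -
  let ?Q = "quotient_module M N"
  have z: "\<zero>\<^bsub>?Q\<^esub> = N +>\<^bsub>M\<^esub> \<zero>\<^bsub>M\<^esub>"
    using S.a_subset by (simp add: quotient_module_simps)
  note [simp del] = M.a_coset_add_zero
  note [simp] = z add_coset smult_coset coset_closed
  show ?thesis
  proof (rule moduleI)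
    show "abelian_group ?Q"
    proof (rule abelian_groupI)
      fix X Y assume "X \<in> carrier ?Q" "Y \<in> carrier ?Q"
      then show "X \<oplus>\<^bsub>?Q\<^esub> Y \<in> carrier ?Q"
        by (elim quotient_carrierE) simp
    next
      fix X Y assume "X \<in> carrier ?Q" "Y \<in> carrier ?Q"
      then show "X \<oplus>\<^bsub>?Q\<^esub> Y = Y \<oplus>\<^bsub>?Q\<^esub> X"
        by (elim quotient_carrierE) (simp add: M.a_comm)
    next
      fix X Y Z assume "X \<in> carrier ?Q" "Y \<in> carrier ?Q" "Z \<in> carrier ?Q"
      then show "X \<oplus>\<^bsub>?Q\<^esub> Y \<oplus>\<^bsub>?Q\<^esub> Z = X \<oplus>\<^bsub>?Q\<^esub> (Y \<oplus>\<^bsub>?Q\<^esub> Z)"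
        by (elim quotient_carrierE) (simp add: M.a_assoc)
    next
      fix X assume X: "X \<in> carrier ?Q"
      from X show "\<zero>\<^bsub>?Q\<^esub> \<oplus>\<^bsub>?Q\<^esub> X = X"
        by (elim quotient_carrierE) simp
      from X obtain x where x: "x \<in> carrier M" "X = N +>\<^bsub>M\<^esub> x"
        by (rule quotient_carrierE)
      then show "\<exists>Y\<in>carrier ?Q. Y \<oplus>\<^bsub>?Q\<^esub> X = \<zero>\<^bsub>?Q\<^esub>"
        by (intro bexI[of _ "N +>\<^bsub>M\<^esub> (\<ominus>\<^bsub>M\<^esub> x)"]) (simp_all add: M.l_neg)
    qed simp
  next
    fix a X assume "a \<in> carrier R" "X \<in> carrier ?Q"
    then show "a \<odot>\<^bsub>?Q\<^esub> X \<in> carrier ?Q"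
      by (elim quotient_carrierE) simp
  next
    fix a b X assume "a \<in> carrier R" "b \<in> carrier R" "X \<in> carrier ?Q"
    then show "(a \<oplus> b) \<odot>\<^bsub>?Q\<^esub> X = a \<odot>\<^bsub>?Q\<^esub> X \<oplus>\<^bsub>?Q\<^esub> b \<odot>\<^bsub>?Q\<^esub> X"
      by (elim quotient_carrierE) (simp add: smult_l_distr)
  next
    fix a X Y assume "a \<in> carrier R" "X \<in> carrier ?Q" "Y \<in> carrier ?Q"
    then show "a \<odot>\<^bsub>?Q\<^esub> (X \<oplus>\<^bsub>?Q\<^esub> Y) = a \<odot>\<^bsub>?Q\<^esub> X \<oplus>\<^bsub>?Q\<^esub> a \<odot>\<^bsub>?Q\<^esub> Y"
      by (elim quotient_carrierE) (simp add: smult_r_distr)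
  next
    fix a b X assume "a \<in> carrier R" "b \<in> carrier R" "X \<in> carrier ?Q"
    then show "a \<otimes> b \<odot>\<^bsub>?Q\<^esub> X = a \<odot>\<^bsub>?Q\<^esub> (b \<odot>\<^bsub>?Q\<^esub> X)"
      by (elim quotient_carrierE) (simp add: smult_assoc1)
  next
    fix X assume "X \<in> carrier ?Q"
    then show "\<one> \<odot>\<^bsub>?Q\<^esub> X = X"
      by (elim quotient_carrierE) simp
  qed (rule R.cring_axioms)
qed

lemma coset_hom: "(\<lambda>x. N +>\<^bsub>M\<^esub> x) \<in> mod_hom R M (quotient_module M N)"
  by (intro mod_homI) (auto simp: carrier_quotient add_coset smult_coset)

text \<open>Both \<open>tensor_map_id\<close> and \<open>multipath_mu\<close> apply
  \<open>the_elem\<close> to the image of a coset. This is meaningful because a map that kills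
  \<open>N\<close> is constant on each coset.\<close>

lemma the_elem_image_coset:
  assumes "h \<in> mod_hom R M P" "module R P" "\<And>n. n \<in> N \<Longrightarrow> h n = \<zero>\<^bsub>P\<^esub>" "x \<in> carrier M"
  shows "the_elem (h ` (N +>\<^bsub>M\<^esub> x)) = h x"
proof -
  interpret P: module R P by fact
  have "h y = h x" if "y \<in> N +>\<^bsub>M\<^esub> x" for y
  proof -
    from that obtain n where n: "n \<in> N" "y = n \<oplus>\<^bsub>M\<^esub> x"
      by (auto simp: a_r_coset_def')
    then have "n \<in> carrier M"
      using S.a_subset by auto
    then show ?thesis
      using n assms by (simp add: mod_hom_add mod_hom_closed)
  qed
  moreover have "x \<in> N +>\<^bsub>M\<^esub> x"
    using assms(4) S.a_rcos_self by blast
  ultimately have "h ` (N +>\<^bsub>M\<^esub> x) = {h x}"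
    by blast
  then show ?thesis by simp
qed

lemma induced_hom:
  assumes "h \<in> mod_hom R M P" "module R P" "\<And>n. n \<in> N \<Longrightarrow> h n = \<zero>\<^bsub>P\<^esub>"
  shows "(\<lambda>X. the_elem (h ` X)) \<in> mod_hom R (quotient_module M N) P"
proof -
  note t = the_elem_image_coset[OF assms]
  show ?thesis
  proof (rule mod_homI; elim quotient_carrierE)
    fix x X assume "x \<in> carrier M" "X = N +>\<^bsub>M\<^esub> x"
    then show "the_elem (h ` X) \<in> carrier P"
      by (simp add: t mod_hom_closed[OF assms(1)])
  next
    fix x X y Y assume "x \<in> carrier M" "X = N +>\<^bsub>M\<^esub> x" "y \<in> carrier M" "Y = N +>\<^bsub>M\<^esub> y"
    then show "the_elem (h ` (X \<oplus>\<^bsub>quotient_module M N\<^esub> Y)) = the_elem (h ` X) \<oplus>\<^bsub>P\<^esub> the_elem (h ` Y)"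
      by (simp add: t add_coset mod_hom_add[OF assms(1)])
  next
    fix r x X assume "r \<in> carrier R" "x \<in> carrier M" "X = N +>\<^bsub>M\<^esub> x"
    then show "the_elem (h ` (r \<odot>\<^bsub>quotient_module M N\<^esub> X)) = r \<odot>\<^bsub>P\<^esub> the_elem (h ` X)"
      by (simp add: t smult_coset mod_hom_smult[OF assms(1)])
  qed
qed

end

text \<open>Common form of the tensor product of two modules and of tensor powers, so that the
  universal property is proved once for both.\<close>

definition presented ::
  "('r, 'k) ring_scheme \<Rightarrow> 'b set \<Rightarrow> ('b \<Rightarrow> 'r) set \<Rightarrow> ('r, ('b \<Rightarrow> 'r) set) module"
  where "presented R B S = quotient_module (free_module R B) (submodule_span R (free_module R B) S)"

definition pgen :: "('r, 'k) ring_scheme \<Rightarrow> 'b set \<Rightarrow> ('b \<Rightarrow> 'r) set \<Rightarrow> 'b \<Rightarrow> ('b \<Rightarrow> 'r) set"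
  where "pgen R B S b = submodule_span R (free_module R B) S +>\<^bsub>free_module R B\<^esub> gen R b"

locale presentation = cring R for R :: "('a, 'k) ring_scheme" (structure) and B :: "'b set" and S :: "('b \<Rightarrow> 'a) set" +
  assumes S_closed: "S \<subseteq> carrier (free_module R B)"
begin

sublocale Q: quotient R "free_module R B" "submodule_span R (free_module R B) S"
proof -
  interpret F: module R "free_module R B"
    by (rule free_module_module) (rule cring_axioms)
  show "quotient R (free_module R B) (submodule_span R (free_module R B) S)"
    by (intro quotient.intro quotient_axioms.intro F.module_axioms F.submodule_span_submodule[OF S_closed])
qed

lemma presented_module: "module R (presented R B S)"
  unfolding presented_def by (rule Q.quotient_module_module)

lemma pgen_closed: "b \<in> B \<Longrightarrow> pgen R B S b \<in> carrier (presented R B S)"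
  unfolding presented_def pgen_def by (intro Q.coset_closed gen_closed cring_axioms)

lemma coset_hom: "(\<lambda>x. submodule_span R (free_module R B) S +>\<^bsub>free_module R B\<^esub> x)
    \<in> mod_hom R (free_module R B) (presented R B S)"
  unfolding presented_def by (rule Q.coset_hom)

lemma coset_relation:
  assumes "x \<ominus>\<^bsub>free_module R B\<^esub> y \<in> S" "x \<in> carrier (free_module R B)" "y \<in> carrier (free_module R B)"
  shows "submodule_span R (free_module R B) S +>\<^bsub>free_module R B\<^esub> x =
    submodule_span R (free_module R B) S +>\<^bsub>free_module R B\<^esub> y"
  using assms Q.coset_eq_iff Q.submodule_span_superset by blast

lemma lin_ext_vanishes:
  assumes "module R M" "\<phi> \<in> B \<rightarrow> carrier M" "\<And>s. s \<in> S \<Longrightarrow> lin_ext R M \<phi> s = \<zero>\<^bsub>M\<^esub>"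
    and "x \<in> submodule_span R (free_module R B) S"
  shows "lin_ext R M \<phi> x = \<zero>\<^bsub>M\<^esub>"
  using Q.hom_submodule_span_zero[OF module.lin_ext_hom[OF assms(1,2)] assms(1) S_closed assms(3,4)] .

lemma presented_hom:
  assumes "module R M" "\<phi> \<in> B \<rightarrow> carrier M" "\<And>s. s \<in> S \<Longrightarrow> lin_ext R M \<phi> s = \<zero>\<^bsub>M\<^esub>"
  shows "(\<lambda>X. the_elem (lin_ext R M \<phi> ` X)) \<in> mod_hom R (presented R B S) M"
  unfolding presented_def
  using Q.induced_hom[OF module.lin_ext_hom[OF assms(1,2)] assms(1) lin_ext_vanishes[OF assms]] .

lemma presented_hom_pgen:
  assumes "module R M" "\<phi> \<in> B \<rightarrow> carrier M" "\<And>s. s \<in> S \<Longrightarrow> lin_ext R M \<phi> s = \<zero>\<^bsub>M\<^esub>" "b \<in> B"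
  shows "the_elem (lin_ext R M \<phi> ` pgen R B S b) = \<phi> b"
proof -
  have "the_elem (lin_ext R M \<phi> ` pgen R B S b) = lin_ext R M \<phi> (gen R b)"
    unfolding pgen_def
    by (rule Q.the_elem_image_coset[OF module.lin_ext_hom[OF assms(1,2)] assms(1) lin_ext_vanishes[OF assms(1-3)]])
      (use assms(4) gen_closed[OF cring_axioms] in auto)
  also have "\<dots> = \<phi> b"
    using assms by (intro module.lin_ext_gen) auto
  finally show ?thesis .
qed

text \<open>Both maps are pulled back along the quotient map to the free module, where they are
  determined by the basis.\<close>

lemma presented_hom_ext:
  assumes "module R M" "h \<in> mod_hom R (presented R B S) M" "k \<in> mod_hom R (presented R B S) M"
    and "\<And>b. b \<in> B \<Longrightarrow> h (pgen R B S b) = k (pgen R B S b)" "X \<in> carrier (presented R B S)"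
  shows "h X = k X"
proof -
  let ?q = "\<lambda>x. submodule_span R (free_module R B) S +>\<^bsub>free_module R B\<^esub> x"
  obtain x where x: "x \<in> carrier (free_module R B)" "X = ?q x"
    using assms(5) unfolding presented_def by (auto simp: Q.carrier_quotient)
  have "h (?q x) = k (?q x)"
    by (rule module.free_module_hom_ext[OF assms(1) mod_hom_comp[OF coset_hom assms(2)]
        mod_hom_comp[OF coset_hom assms(3)]])
      (use x assms(4) in \<open>auto simp: pgen_def\<close>)
  with x show ?thesis by simp
qed

end

section \<open>Universal property of the tensor product\<close>

text \<open>\<open>tensor_rel\<close> is the span of this set; having the set itself exhibits
  \<open>tensor\<close> as a presented module.\<close>

definition tensor_relators ::
  "('r, 'k) ring_scheme \<Rightarrow> ('r, 'a, 'm) module_scheme \<Rightarrow> ('r, 'b, 'n) module_scheme \<Rightarrow>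
    ('a \<times> 'b \<Rightarrow> 'r) set"
  where "tensor_relators R M N =
    (let F = free_module R (carrier M \<times> carrier N) in
       {gen R (x \<oplus>\<^bsub>M\<^esub> x', y) \<ominus>\<^bsub>F\<^esub> (gen R (x, y) \<oplus>\<^bsub>F\<^esub> gen R (x', y)) | x x' y.
            x \<in> carrier M \<and> x' \<in> carrier M \<and> y \<in> carrier N} \<union>
        {gen R (x, y \<oplus>\<^bsub>N\<^esub> y') \<ominus>\<^bsub>F\<^esub> (gen R (x, y) \<oplus>\<^bsub>F\<^esub> gen R (x, y')) | x y y'.
            x \<in> carrier M \<and> y \<in> carrier N \<and> y' \<in> carrier N} \<union>
        {gen R (r \<odot>\<^bsub>M\<^esub> x, y) \<ominus>\<^bsub>F\<^esub> (r \<odot>\<^bsub>F\<^esub> gen R (x, y)) | r x y.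
            r \<in> carrier R \<and> x \<in> carrier M \<and> y \<in> carrier N} \<union>
        {gen R (x, r \<odot>\<^bsub>N\<^esub> y) \<ominus>\<^bsub>F\<^esub> (r \<odot>\<^bsub>F\<^esub> gen R (x, y)) | r x y.
            r \<in> carrier R \<and> x \<in> carrier M \<and> y \<in> carrier N})"

lemma tensor_eq_presented:
  "tensor R M N = presented R (carrier M \<times> carrier N) (tensor_relators R M N)"
  by (simp add: tensor_def presented_def tensor_rel_def tensor_relators_def Let_def)

lemma pure_tensor_eq_pgen:
  "pure_tensor R M N x y = pgen R (carrier M \<times> carrier N) (tensor_relators R M N) (x, y)"
  by (simp add: pure_tensor_def pgen_def tensor_rel_def tensor_relators_def Let_def)

definition bilinear ::
  "('r, 'k) ring_scheme \<Rightarrow> ('r, 'a, 'm) module_scheme \<Rightarrow> ('r, 'b, 'n) module_scheme \<Rightarrow>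
    ('r, 'c, 'l) module_scheme \<Rightarrow> ('a \<Rightarrow> 'b \<Rightarrow> 'c) \<Rightarrow> bool"
  where "bilinear R M N P \<phi> \<longleftrightarrow>
    (\<forall>y\<in>carrier N. (\<lambda>x. \<phi> x y) \<in> mod_hom R M P) \<and> (\<forall>x\<in>carrier M. \<phi> x \<in> mod_hom R N P)"

locale two_modules = M: module R M + N: module R N for R :: "('r, 'k) ring_scheme"
  and M :: "('r, 'a, 'm) module_scheme" and N :: "('r, 'b, 'n) module_scheme"
begin

sublocale F: module R "free_module R (carrier M \<times> carrier N)"
  by (rule free_module_module) (rule M.R.cring_axioms)

sublocale T: presentation R "carrier M \<times> carrier N" "tensor_relators R M N"
proof -
  have "gen R p \<in> carrier (free_module R (carrier M \<times> carrier N))" if "p \<in> carrier M \<times> carrier N" for p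
    using that by (intro gen_closed M.R.cring_axioms)
  then show "presentation R (carrier M \<times> carrier N) (tensor_relators R M N)"
    by (intro presentation.intro presentation_axioms.intro M.R.cring_axioms)
      (auto simp: tensor_relators_def Let_def intro!: F.minus_closed F.a_closed F.smult_closed)
qed

lemma tensor_module: "module R (tensor R M N)"
  unfolding tensor_eq_presented by (rule T.presented_module)

lemma pure_tensor_closed:
  "x \<in> carrier M \<Longrightarrow> y \<in> carrier N \<Longrightarrow> pure_tensor R M N x y \<in> carrier (tensor R M N)"
  unfolding tensor_eq_presented pure_tensor_eq_pgen by (intro T.pgen_closed) auto

lemma pure_tensor_bilinear: "bilinear R M N (tensor R M N) (pure_tensor R M N)"
proof -
  let ?F = "free_module R (carrier M \<times> carrier N)"
  let ?q = "\<lambda>x. submodule_span R ?F (tensor_relators R M N) +>\<^bsub>?F\<^esub> x"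
  have g: "gen R (x, y) \<in> carrier ?F" if "x \<in> carrier M" "y \<in> carrier N" for x y
    using that by (intro gen_closed M.R.cring_axioms) auto
  \<comment> \<open>Each family of relators says that two elements of the free module have the same
    coset; this turns the four families into the four laws of bilinearity.\<close>
  have rel: "?q (gen R p) = ?q f" if "gen R p \<ominus>\<^bsub>?F\<^esub> f \<in> tensor_relators R M N"
    "p \<in> carrier M \<times> carrier N" "f \<in> carrier ?F" for p f
    using that by (intro T.coset_relation gen_closed M.R.cring_axioms)
  have add: "?q (x \<oplus>\<^bsub>?F\<^esub> y) = ?q x \<oplus>\<^bsub>tensor R M N\<^esub> ?q y" if "x \<in> carrier ?F" "y \<in> carrier ?F" for x y
    unfolding tensor_eq_presented using mod_hom_add[OF T.coset_hom that] .
  have smult: "?q (r \<odot>\<^bsub>?F\<^esub> x) = r \<odot>\<^bsub>tensor R M N\<^esub> ?q x" if "r \<in> carrier R" "x \<in> carrier ?F" for r x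
    unfolding tensor_eq_presented using mod_hom_smult[OF T.coset_hom that] .
  have p: "pure_tensor R M N = (\<lambda>x y. ?q (gen R (x, y)))"
    by (simp add: fun_eq_iff pure_tensor_eq_pgen pgen_def)
  have "?q (gen R (x \<oplus>\<^bsub>M\<^esub> x', y)) = ?q (gen R (x, y) \<oplus>\<^bsub>?F\<^esub> gen R (x', y))"
    if "x \<in> carrier M" "x' \<in> carrier M" "y \<in> carrier N" for x x' y
    using that by (intro rel) (auto simp: tensor_relators_def Let_def intro!: F.a_closed g)
  moreover have "?q (gen R (x, y \<oplus>\<^bsub>N\<^esub> y')) = ?q (gen R (x, y) \<oplus>\<^bsub>?F\<^esub> gen R (x, y'))"
    if "x \<in> carrier M" "y \<in> carrier N" "y' \<in> carrier N" for x y y'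
    using that by (intro rel) (auto simp: tensor_relators_def Let_def intro!: F.a_closed g)
  moreover have "?q (gen R (r \<odot>\<^bsub>M\<^esub> x, y)) = ?q (r \<odot>\<^bsub>?F\<^esub> gen R (x, y))"
    if "r \<in> carrier R" "x \<in> carrier M" "y \<in> carrier N" for r x y
    using that by (intro rel) (auto simp: tensor_relators_def Let_def intro!: F.smult_closed g)
  moreover have "?q (gen R (x, r \<odot>\<^bsub>N\<^esub> y)) = ?q (r \<odot>\<^bsub>?F\<^esub> gen R (x, y))"
    if "r \<in> carrier R" "x \<in> carrier M" "y \<in> carrier N" for r x y
    using that by (intro rel) (auto simp: tensor_relators_def Let_def intro!: F.smult_closed g)
  ultimately show ?thesis
    unfolding bilinear_def p
    by (auto intro!: mod_homI simp: add smult g pure_tensor_closed[unfolded p])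
qed

lemma pure_tensor_hom_left: "y \<in> carrier N \<Longrightarrow> (\<lambda>x. pure_tensor R M N x y) \<in> mod_hom R M (tensor R M N)"
  and pure_tensor_hom_right: "x \<in> carrier M \<Longrightarrow> pure_tensor R M N x \<in> mod_hom R N (tensor R M N)"
  using pure_tensor_bilinear by (auto simp: bilinear_def)

text \<open>By bilinearity the linear extension sends each relator to a difference of two equal
  elements.\<close>

lemma bilinear_vanishes:
  assumes "module R P" "bilinear R M N P \<phi>" "s \<in> tensor_relators R M N"
  shows "lin_ext R P (\<lambda>(x, y). \<phi> x y) s = \<zero>\<^bsub>P\<^esub>"
proof -
  interpret P: module R P by fact
  let ?F = "free_module R (carrier M \<times> carrier N)"
  let ?l = "lin_ext R P (\<lambda>(x, y). \<phi> x y)"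
  have cl: "\<phi> x y \<in> carrier P" if "x \<in> carrier M" "y \<in> carrier N" for x y
    using assms(2) that mod_hom_closed unfolding bilinear_def by metis
  have l: "?l \<in> mod_hom R ?F P"
    using cl by (intro P.lin_ext_hom) auto
  have lg: "?l (gen R (x, y)) = \<phi> x y" if "x \<in> carrier M" "y \<in> carrier N" for x y
    using cl that by (subst P.lin_ext_gen) auto
  have g: "gen R (x, y) \<in> carrier ?F" if "x \<in> carrier M" "y \<in> carrier N" for x y
    using that by (intro gen_closed M.R.cring_axioms) auto
  have a1: "\<phi> (x \<oplus>\<^bsub>M\<^esub> x') y = \<phi> x y \<oplus>\<^bsub>P\<^esub> \<phi> x' y"
    if "x \<in> carrier M" "x' \<in> carrier M" "y \<in> carrier N" for x x' y
    using assms(2) that mod_hom_add[of "\<lambda>x. \<phi> x y" R M P x x'] by (auto simp: bilinear_def)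
  have a2: "\<phi> x (y \<oplus>\<^bsub>N\<^esub> y') = \<phi> x y \<oplus>\<^bsub>P\<^esub> \<phi> x y'"
    if "x \<in> carrier M" "y \<in> carrier N" "y' \<in> carrier N" for x y y'
    using assms(2) that mod_hom_add[of "\<phi> x" R N P y y'] by (auto simp: bilinear_def)
  have s1: "\<phi> (r \<odot>\<^bsub>M\<^esub> x) y = r \<odot>\<^bsub>P\<^esub> \<phi> x y"
    if "x \<in> carrier M" "r \<in> carrier R" "y \<in> carrier N" for x r y
    using assms(2) that mod_hom_smult[of "\<lambda>x. \<phi> x y" R M P r x] by (auto simp: bilinear_def)
  have s2: "\<phi> x (r \<odot>\<^bsub>N\<^esub> y) = r \<odot>\<^bsub>P\<^esub> \<phi> x y"
    if "x \<in> carrier M" "r \<in> carrier R" "y \<in> carrier N" for x r y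
    using assms(2) that mod_hom_smult[of "\<phi> x" R N P r y] by (auto simp: bilinear_def)
  have z: "z \<ominus>\<^bsub>P\<^esub> z = \<zero>\<^bsub>P\<^esub>" if "z \<in> carrier P" for z
    using that by (simp add: a_minus_def P.r_neg)
  note lm = mod_hom_minus[OF l F.module_axioms assms(1)] mod_hom_add[OF l] mod_hom_smult[OF l]
  from assms(3) show ?thesis
    unfolding tensor_relators_def Let_def
    by (elim UnE CollectE exE conjE; simp only:)
      (simp_all add: lm g lg cl z a1 a2 s1 s2)
qed

lemma tensor_hom:
  assumes "module R P" "bilinear R M N P \<phi>"
  shows "(\<lambda>X. the_elem (lin_ext R P (\<lambda>(x, y). \<phi> x y) ` X)) \<in> mod_hom R (tensor R M N) P"
    and "x \<in> carrier M \<Longrightarrow> y \<in> carrier N \<Longrightarrow>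
      the_elem (lin_ext R P (\<lambda>(x, y). \<phi> x y) ` pure_tensor R M N x y) = \<phi> x y"
proof -
  have cl: "(\<lambda>(x, y). \<phi> x y) \<in> carrier M \<times> carrier N \<rightarrow> carrier P"
    using assms(2) mod_hom_closed unfolding bilinear_def by fastforce
  show "(\<lambda>X. the_elem (lin_ext R P (\<lambda>(x, y). \<phi> x y) ` X)) \<in> mod_hom R (tensor R M N) P"
    unfolding tensor_eq_presented
    using T.presented_hom[OF assms(1) cl bilinear_vanishes[OF assms]] .
  show "the_elem (lin_ext R P (\<lambda>(x, y). \<phi> x y) ` pure_tensor R M N x y) = \<phi> x y"
    if "x \<in> carrier M" "y \<in> carrier N"
    unfolding pure_tensor_eq_pgen
    using T.presented_hom_pgen[OF assms(1) cl bilinear_vanishes[OF assms], of "(x, y)"] that by simp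
qed

lemma tensor_hom_ext:
  assumes "module R P" "h \<in> mod_hom R (tensor R M N) P" "k \<in> mod_hom R (tensor R M N) P"
    and "\<And>x y. x \<in> carrier M \<Longrightarrow> y \<in> carrier N \<Longrightarrow> h (pure_tensor R M N x y) = k (pure_tensor R M N x y)"
    and "X \<in> carrier (tensor R M N)"
  shows "h X = k X"
  by (rule T.presented_hom_ext[OF assms(1) assms(2,3)[unfolded tensor_eq_presented]
        _ assms(5)[unfolded tensor_eq_presented]])
    (use assms(4) in \<open>auto simp: pure_tensor_eq_pgen\<close>)

end

lemma tensor_map_id:
  assumes "module R M" "module R M'" "module R N" "h \<in> mod_hom R M M'"
  shows tensor_map_id_hom: "tensor_map_id R M' N h \<in> mod_hom R (tensor R M N) (tensor R M' N)"
    and tensor_map_id_pure: "\<And>x y. x \<in> carrier M \<Longrightarrow> y \<in> carrier N \<Longrightarrow>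
      tensor_map_id R M' N h (pure_tensor R M N x y) = pure_tensor R M' N (h x) y"
proof -
  interpret MN: two_modules R M N
    using assms by (intro two_modules.intro)
  interpret MN': two_modules R M' N
    using assms by (intro two_modules.intro)
  have b: "bilinear R M N (tensor R M' N) (\<lambda>x y. pure_tensor R M' N (h x) y)"
    using mod_hom_comp[OF assms(4) MN'.pure_tensor_hom_left] MN'.pure_tensor_hom_right
      mod_hom_closed[OF assms(4)]
    by (auto simp: bilinear_def)
  have e: "tensor_map_id R M' N h =
    (\<lambda>X. the_elem (lin_ext R (tensor R M' N) (\<lambda>(x, y). pure_tensor R M' N (h x) y) ` X))"
    by (simp add: fun_eq_iff tensor_map_id_def)
  show "tensor_map_id R M' N h \<in> mod_hom R (tensor R M N) (tensor R M' N)"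
    unfolding e by (rule MN.tensor_hom(1)[OF MN'.tensor_module b])
  show "tensor_map_id R M' N h (pure_tensor R M N x y) = pure_tensor R M' N (h x) y"
    if "x \<in> carrier M" "y \<in> carrier N" for x y
    unfolding e using MN.tensor_hom(2)[OF MN'.tensor_module b that] .
qed

text \<open>Functoriality, with the composite replaced by any map \<open>l\<close> that agrees with
  it on the carrier. Matrix entries are known on carriers only, so this is the form in which they
  can be substituted.\<close>

lemma tensor_map_id_comp:
  assumes "module R M" "module R M'" "module R M''" "module R N"
    and "h \<in> mod_hom R M M'" "k \<in> mod_hom R M' M''" "l \<in> mod_hom R M M''"
    and "\<And>x. x \<in> carrier M \<Longrightarrow> k (h x) = l x" "X \<in> carrier (tensor R M N)"
  shows "tensor_map_id R M'' N k (tensor_map_id R M' N h X) = tensor_map_id R M'' N l X"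
proof -
  interpret MN: two_modules R M N
    using assms by (intro two_modules.intro)
  interpret MN'': two_modules R M'' N
    using assms by (intro two_modules.intro)
  show ?thesis
  proof (rule MN.tensor_hom_ext[OF MN''.tensor_module _ _ _ assms(9)])
    show "(\<lambda>X. tensor_map_id R M'' N k (tensor_map_id R M' N h X)) \<in> mod_hom R (tensor R M N) (tensor R M'' N)"
      by (rule mod_hom_comp[OF tensor_map_id_hom[OF assms(1,2,4,5)] tensor_map_id_hom[OF assms(2,3,4,6)]])
    show "tensor_map_id R M'' N l \<in> mod_hom R (tensor R M N) (tensor R M'' N)"
      by (rule tensor_map_id_hom[OF assms(1,3,4,7)])
    fix x y assume x: "x \<in> carrier M" and y: "y \<in> carrier N"
    show "tensor_map_id R M'' N k (tensor_map_id R M' N h (pure_tensor R M N x y)) =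
        tensor_map_id R M'' N l (pure_tensor R M N x y)"
      unfolding tensor_map_id_pure[OF assms(1,2,4,5) x y] tensor_map_id_pure[OF assms(1,3,4,7) x y]
        tensor_map_id_pure[OF assms(2,3,4,6) mod_hom_closed[OF assms(5) x] y] assms(8)[OF x] ..
  qed
qed

lemma tensor_map_id_zero:
  assumes "module R M" "module R M'" "module R N" "h \<in> mod_hom R M M'"
    and "\<And>x. x \<in> carrier M \<Longrightarrow> h x = \<zero>\<^bsub>M'\<^esub>" "X \<in> carrier (tensor R M N)"
  shows "tensor_map_id R M' N h X = \<zero>\<^bsub>tensor R M' N\<^esub>"
proof -
  interpret MN: two_modules R M N
    using assms by (intro two_modules.intro)
  interpret MN': two_modules R M' N
    using assms by (intro two_modules.intro)
  show ?thesis
  proof (rule MN.tensor_hom_ext[OF MN'.tensor_module tensor_map_id_hom[OF assms(1-4)]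
        mod_hom_zero_map[OF MN'.tensor_module] _ assms(6)])
    fix x y assume x: "x \<in> carrier M" and y: "y \<in> carrier N"
    show "tensor_map_id R M' N h (pure_tensor R M N x y) = \<zero>\<^bsub>tensor R M' N\<^esub>"
      unfolding tensor_map_id_pure[OF assms(1-4) x y] assms(5)[OF x]
      by (rule mod_hom_zero[OF MN'.pure_tensor_hom_left[OF y] assms(2) MN'.tensor_module])
  qed
qed

lemma tensor_map_id_smult:
  assumes "module R M" "module R M'" "module R N" "h \<in> mod_hom R M M'" "k \<in> mod_hom R M M'"
    and "r \<in> carrier R" "\<And>x. x \<in> carrier M \<Longrightarrow> h x = r \<odot>\<^bsub>M'\<^esub> k x" "X \<in> carrier (tensor R M N)"
  shows "tensor_map_id R M' N h X = r \<odot>\<^bsub>tensor R M' N\<^esub> tensor_map_id R M' N k X"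
proof -
  interpret MN: two_modules R M N
    using assms by (intro two_modules.intro)
  interpret MN': two_modules R M' N
    using assms by (intro two_modules.intro)
  show ?thesis
  proof (rule MN.tensor_hom_ext[OF MN'.tensor_module tensor_map_id_hom[OF assms(1-4)]
        mod_hom_smult_map[OF MN'.tensor_module tensor_map_id_hom[OF assms(1-3,5)] assms(6)] _ assms(8)])
    fix x y assume x: "x \<in> carrier M" and y: "y \<in> carrier N"
    show "tensor_map_id R M' N h (pure_tensor R M N x y) =
        r \<odot>\<^bsub>tensor R M' N\<^esub> tensor_map_id R M' N k (pure_tensor R M N x y)"
      unfolding tensor_map_id_pure[OF assms(1-4) x y] tensor_map_id_pure[OF assms(1-3,5) x y] assms(7)[OF x]
      by (rule mod_hom_smult[OF MN'.pure_tensor_hom_left[OF y] assms(6) mod_hom_closed[OF assms(5) x]])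
  qed
qed

lemma tensor_map_id_id:
  assumes "module R M" "module R N" "X \<in> carrier (tensor R M N)"
  shows "tensor_map_id R M N (\<lambda>x. x) X = X"
proof -
  interpret MN: two_modules R M N
    using assms by (intro two_modules.intro)
  show ?thesis
    by (rule MN.tensor_hom_ext[OF MN.tensor_module tensor_map_id_hom[OF assms(1,1,2) mod_hom_id] mod_hom_id _ assms(3)])
      (rule tensor_map_id_pure[OF assms(1,1,2) mod_hom_id])
qed

section \<open>Finite biproducts\<close>

text \<open>Direct sums up to isomorphism: the equations between injections and projections survive
  tensoring, whereas the concrete functions that make up \<open>direct_sum\<close> do not. Elements
  are compared by their projections, homomorphisms on the images of the injections.\<close>

locale biproduct = module R M for R (structure) and M (structure) +
  fixes I :: "'i set" and Ms :: "'i \<Rightarrow> ('a, 'e) module"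
    and inc :: "'i \<Rightarrow> 'e \<Rightarrow> 'c" and prj :: "'i \<Rightarrow> 'c \<Rightarrow> 'e"
  assumes finite_index: "finite I"
    and summand_module: "i \<in> I \<Longrightarrow> module R (Ms i)"
    and inc_hom: "i \<in> I \<Longrightarrow> inc i \<in> mod_hom R (Ms i) M"
    and prj_hom: "i \<in> I \<Longrightarrow> prj i \<in> mod_hom R M (Ms i)"
    and prj_inc: "i \<in> I \<Longrightarrow> j \<in> I \<Longrightarrow> x \<in> carrier (Ms i) \<Longrightarrow>
      prj j (inc i x) = (if i = j then x else \<zero>\<^bsub>Ms j\<^esub>)"
    and sum_inc_prj: "y \<in> carrier M \<Longrightarrow> (\<Oplus>\<^bsub>M\<^esub>i\<in>I. inc i (prj i y)) = y"
begin

lemma eqI: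
  assumes "x \<in> carrier M" "y \<in> carrier M" "\<And>i. i \<in> I \<Longrightarrow> prj i x = prj i y"
  shows "x = y"
proof -
  have "(\<Oplus>\<^bsub>M\<^esub>i\<in>I. inc i (prj i x)) = (\<Oplus>\<^bsub>M\<^esub>i\<in>I. inc i (prj i y))"
    using assms mod_hom_closed[OF inc_hom] mod_hom_closed[OF prj_hom]
    by (intro M.finsum_cong') auto
  then show ?thesis
    using assms by (simp add: sum_inc_prj)
qed

lemma hom_ext:
  assumes "module R N" "h \<in> mod_hom R M N" "k \<in> mod_hom R M N"
    and "\<And>i x. i \<in> I \<Longrightarrow> x \<in> carrier (Ms i) \<Longrightarrow> h (inc i x) = k (inc i x)" "y \<in> carrier M"
  shows "h y = k y"
proof -
  interpret N: module R N by fact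
  have cl: "(\<lambda>i. inc i (prj i y)) \<in> I \<rightarrow> carrier M"
    using assms(5) mod_hom_closed[OF inc_hom] mod_hom_closed[OF prj_hom] by auto
  have "h (\<Oplus>\<^bsub>M\<^esub>i\<in>I. inc i (prj i y)) = (\<Oplus>\<^bsub>N\<^esub>i\<in>I. h (inc i (prj i y)))"
    by (rule mod_hom_finsum[OF assms(2) module_axioms assms(1) finite_index cl])
  also have "\<dots> = (\<Oplus>\<^bsub>N\<^esub>i\<in>I. k (inc i (prj i y)))"
    using cl assms(4)[OF _ mod_hom_closed[OF prj_hom]] mod_hom_closed[OF assms(3)] assms(5)
    by (intro N.finsum_cong') (auto simp: Pi_def)
  also have "\<dots> = k (\<Oplus>\<^bsub>M\<^esub>i\<in>I. inc i (prj i y))"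
    by (rule mod_hom_finsum[OF assms(3) module_axioms assms(1) finite_index cl, symmetric])
  finally show ?thesis
    using assms(5) by (simp add: sum_inc_prj)
qed

text \<open>The index map \<open>s\<close> allows a family over \<open>J\<close> to be placed into
  the block of \<open>I\<close> that \<open>s\<close> hits. This computes the components of block
  inclusions and of preimages under block projections.\<close>

lemma prj_sum:
  assumes "finite J" "inj_on s J" "s ` J \<subseteq> I" "\<And>j. j \<in> J \<Longrightarrow> z j \<in> carrier (Ms (s j))"
  shows prj_sum_in: "j \<in> J \<Longrightarrow> prj (s j) (\<Oplus>\<^bsub>M\<^esub>j\<in>J. inc (s j) (z j)) = z j"
    and prj_sum_out: "i \<in> I \<Longrightarrow> i \<notin> s ` J \<Longrightarrow> prj i (\<Oplus>\<^bsub>M\<^esub>j\<in>J. inc (s j) (z j)) = \<zero>\<^bsub>Ms i\<^esub>"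
proof -
  have cl: "(\<lambda>j. inc (s j) (z j)) \<in> J \<rightarrow> carrier M"
    using assms(3,4) mod_hom_closed[OF inc_hom] by auto
  have eq: "prj i (\<Oplus>\<^bsub>M\<^esub>j\<in>J. inc (s j) (z j)) = (\<Oplus>\<^bsub>Ms i\<^esub>j\<in>J. prj i (inc (s j) (z j)))" if "i \<in> I" for i
    by (rule mod_hom_finsum[OF prj_hom[OF that] module_axioms summand_module[OF that] assms(1) cl])
  show "prj (s j) (\<Oplus>\<^bsub>M\<^esub>j\<in>J. inc (s j) (z j)) = z j" if j: "j \<in> J"
  proof -
    have i: "s j \<in> I"
      using assms(3) j by auto
    interpret N: module R "Ms (s j)"
      by (rule summand_module[OF i])
    have "(\<Oplus>\<^bsub>Ms (s j)\<^esub>j'\<in>J. prj (s j) (inc (s j') (z j'))) = (\<Oplus>\<^bsub>Ms (s j)\<^esub>j'\<in>J. if j = j' then z j' else \<zero>\<^bsub>Ms (s j)\<^esub>)"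
      using assms i j by (intro N.finsum_cong') (auto simp: prj_inc image_subset_iff dest: inj_onD)
    also have "\<dots> = (\<Oplus>\<^bsub>Ms (s j)\<^esub>j'\<in>J. if j = j' then z j else \<zero>\<^bsub>Ms (s j)\<^esub>)"
      using assms j by (intro N.finsum_cong') auto
    also have "\<dots> = z j"
      using N.finsum_singleton[OF j assms(1), of "\<lambda>_. z j"] assms(4)[OF j] by simp
    finally show ?thesis
      using eq[OF i] by simp
  qed
  show "prj i (\<Oplus>\<^bsub>M\<^esub>j\<in>J. inc (s j) (z j)) = \<zero>\<^bsub>Ms i\<^esub>" if i: "i \<in> I" "i \<notin> s ` J"
  proof -
    interpret N: module R "Ms i"
      by (rule summand_module[OF i(1)])
    have "(\<Oplus>\<^bsub>Ms i\<^esub>j'\<in>J. prj i (inc (s j') (z j'))) = (\<Oplus>\<^bsub>Ms i\<^esub>j'\<in>J. \<zero>\<^bsub>Ms i\<^esub>)"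
      using assms i by (intro N.finsum_cong') (auto simp: prj_inc image_subset_iff)
    then show ?thesis
      using eq[OF i(1)] by simp
  qed
qed

lemma prj_sum_self:
  assumes "\<And>i. i \<in> I \<Longrightarrow> z i \<in> carrier (Ms i)" "j \<in> I"
  shows "prj j (\<Oplus>\<^bsub>M\<^esub>i\<in>I. inc i (z i)) = z j"
  using prj_sum_in[OF finite_index inj_on_id, of z j] assms by simp

end

lemma direct_sum_simps:
  "\<zero>\<^bsub>direct_sum I M\<^esub> = (\<lambda>i\<in>I. \<zero>\<^bsub>M i\<^esub>)"
  "x \<oplus>\<^bsub>direct_sum I M\<^esub> y = (\<lambda>i\<in>I. x i \<oplus>\<^bsub>M i\<^esub> y i)"
  "r \<odot>\<^bsub>direct_sum I M\<^esub> x = (\<lambda>i\<in>I. r \<odot>\<^bsub>M i\<^esub> x i)"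
  by (simp_all add: direct_sum_def)

lemma direct_sum_carrier:
  "finite I \<Longrightarrow> carrier (direct_sum I M) = (\<Pi>\<^sub>E i\<in>I. carrier (M i))"
  by (auto simp: direct_sum_def)

lemma direct_sum_module:
  assumes "cring R" "finite I" "\<And>i. i \<in> I \<Longrightarrow> module R (M i)"
  shows "module R (direct_sum I M)"
proof -
  have grp: "abelian_group (M i)" if "i \<in> I" for i
    using assms(3)[OF that] by (simp add: module_def)
  note mon = abelian_group.axioms(1)[OF grp]
  note simps = direct_sum_simps direct_sum_carrier[OF assms(2)]
  show ?thesis
  proof (rule moduleI)
    show "abelian_group (direct_sum I M)"
    proof (rule abelian_groupI)
      fix x assume "x \<in> carrier (direct_sum I M)"
      then show "\<exists>y\<in>carrier (direct_sum I M). y \<oplus>\<^bsub>direct_sum I M\<^esub> x = \<zero>\<^bsub>direct_sum I M\<^esub>"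
        by (intro bexI[of _ "\<lambda>i\<in>I. \<ominus>\<^bsub>M i\<^esub> x i"])
          (auto simp: simps PiE_iff fun_eq_iff abelian_group.l_neg[OF grp] abelian_group.a_inv_closed[OF grp])
    qed (auto simp: simps PiE_iff extensional_def fun_eq_iff abelian_monoid.a_closed[OF mon]
        abelian_monoid.a_assoc[OF mon] abelian_monoid.a_comm[OF mon]
        abelian_monoid.a_lcomm[OF mon]
        abelian_monoid.zero_closed[OF mon] abelian_monoid.l_zero[OF mon] abelian_monoid.r_zero[OF mon])
  qed (auto simp: simps assms(1) PiE_iff extensional_def fun_eq_iff module.smult_closed[OF assms(3)]
      module.smult_l_distr[OF assms(3)] module.smult_r_distr[OF assms(3)]
      module.smult_assoc1[OF assms(3)] module.smult_one[OF assms(3)])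
qed

lemma direct_sum_biproduct:
  assumes "cring R" "finite I" "\<And>i. i \<in> I \<Longrightarrow> module R (M i)"
  shows "biproduct R (direct_sum I M) I M (\<lambda>i x. \<lambda>j\<in>I. if j = i then x else \<zero>\<^bsub>M j\<^esub>) (\<lambda>i x. x i)"
proof -
  let ?D = "direct_sum I M"
  let ?inc = "\<lambda>i x. \<lambda>j\<in>I. if j = i then x else \<zero>\<^bsub>M j\<^esub>"
  interpret D: module R ?D
    by (rule direct_sum_module[OF assms])
  have grp: "abelian_group (M i)" if "i \<in> I" for i
    using assms(3)[OF that] by (simp add: module_def)
  note mon = abelian_group.axioms(1)[OF grp]
  note simps = direct_sum_simps direct_sum_carrier[OF assms(2)]
  have inc: "?inc i \<in> mod_hom R (M i) ?D" if "i \<in> I" for i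
    using that
    by (intro mod_homI)
      (auto simp: simps PiE_iff fun_eq_iff abelian_monoid.zero_closed[OF mon]
        abelian_monoid.l_zero[OF mon] module.smult_r_null[OF assms(3)])
  have prj: "(\<lambda>x. x i) \<in> mod_hom R ?D (M i)" if "i \<in> I" for i
    using that by (intro mod_homI) (auto simp: simps)
  have sum: "(\<Oplus>\<^bsub>?D\<^esub>i\<in>I. ?inc i (y i)) = y" if y: "y \<in> carrier ?D" for y
  proof
    fix j
    have cl: "(\<lambda>i. ?inc i (y i)) \<in> I \<rightarrow> carrier ?D"
      using y by (intro Pi_I mod_hom_closed[OF inc]) (auto simp: simps)
    show "(\<Oplus>\<^bsub>?D\<^esub>i\<in>I. ?inc i (y i)) j = y j"
    proof (cases "j \<in> I")
      case True
      interpret N: module R "M j"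
        by (rule assms(3)[OF True])
      have "(\<Oplus>\<^bsub>?D\<^esub>i\<in>I. ?inc i (y i)) j = (\<Oplus>\<^bsub>M j\<^esub>i\<in>I. ?inc i (y i) j)"
        by (rule mod_hom_finsum[OF prj[OF True] D.module_axioms N.module_axioms assms(2) cl])
      also have "\<dots> = (\<Oplus>\<^bsub>M j\<^esub>i\<in>I. if j = i then y j else \<zero>\<^bsub>M j\<^esub>)"
        using True y by (intro N.finsum_cong') (auto simp: simps)
      also have "\<dots> = y j"
        using N.finsum_singleton[OF True assms(2), of "\<lambda>_. y j"] y True by (auto simp: simps)
      finally show ?thesis .
    next
      \<comment> \<open>Outside \<open>I\<close> both sides are \<open>undefined\<close>, since
        elements of the carrier are extensional.\<close>
      case False
      then show ?thesis
        using y D.finsum_closed[OF cl] by (auto simp: simps PiE_iff extensional_def)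
    qed
  qed
  show ?thesis
    using assms(2,3) inc prj sum
    by (intro biproduct.intro biproduct_axioms.intro D.module_axioms) auto
qed

text \<open>Tensoring with \<open>N\<close> preserves composition, zero maps and finite sums of
  maps, hence the equations that define a biproduct.\<close>

lemma tensor_biproduct:
  assumes "biproduct R M I Ms inc prj" "module R N"
  shows "biproduct R (tensor R M N) I (\<lambda>i. tensor R (Ms i) N)
    (\<lambda>i. tensor_map_id R M N (inc i)) (\<lambda>i. tensor_map_id R (Ms i) N (prj i))"
proof -
  interpret biproduct R M I Ms inc prj by fact
  interpret MN: two_modules R M N
    using assms(2) module_axioms by (intro two_modules.intro)
  interpret MN: module R "tensor R M N"
    by (rule MN.tensor_module)
  have tm: "module R (tensor R (Ms i) N)" if "i \<in> I" for i
    by (intro two_modules.tensor_module two_modules.intro summand_module that assms(2))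
  note ti = tensor_map_id_hom[OF summand_module module_axioms assms(2) inc_hom]
  note tp = tensor_map_id_hom[OF module_axioms summand_module assms(2) prj_hom]
  have pi: "tensor_map_id R (Ms j) N (prj j) (tensor_map_id R M N (inc i) X) =
      (if i = j then X else \<zero>\<^bsub>tensor R (Ms j) N\<^esub>)"
    if i: "i \<in> I" and j: "j \<in> I" and X: "X \<in> carrier (tensor R (Ms i) N)" for i j X
  proof (cases "i = j")
    case True
    have "tensor_map_id R (Ms j) N (prj j) (tensor_map_id R M N (inc i) X) = tensor_map_id R (Ms i) N (\<lambda>x. x) X"
      unfolding True[symmetric]
      by (rule tensor_map_id_comp[OF summand_module[OF i] module_axioms summand_module[OF i] assms(2)
          inc_hom[OF i] prj_hom[OF i] mod_hom_id _ X]) (simp add: prj_inc i)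
    also have "\<dots> = X"
      by (rule tensor_map_id_id[OF summand_module[OF i] assms(2) X])
    finally show ?thesis
      using True by simp
  next
    case False
    interpret Mj: module R "Ms j"
      by (rule summand_module[OF j])
    have "tensor_map_id R (Ms j) N (prj j) (tensor_map_id R M N (inc i) X) =
        tensor_map_id R (Ms j) N (\<lambda>_. \<zero>\<^bsub>Ms j\<^esub>) X"
      by (rule tensor_map_id_comp[OF summand_module[OF i] module_axioms summand_module[OF j] assms(2)
          inc_hom[OF i] prj_hom[OF j] mod_hom_zero_map[OF summand_module[OF j]] _ X])
        (simp add: prj_inc i j False)
    also have "\<dots> = \<zero>\<^bsub>tensor R (Ms j) N\<^esub>"
      by (rule tensor_map_id_zero[OF summand_module[OF i] summand_module[OF j] assms(2)
          mod_hom_zero_map[OF summand_module[OF j]] _ X]) simp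
    finally show ?thesis
      using False by simp
  qed
  have sum: "(\<Oplus>\<^bsub>tensor R M N\<^esub>i\<in>I. tensor_map_id R M N (inc i) (tensor_map_id R (Ms i) N (prj i) X)) = X"
    if X: "X \<in> carrier (tensor R M N)" for X
  proof (rule MN.tensor_hom_ext[OF MN.module_axioms mod_hom_finsum_map[OF MN.module_axioms finite_index] mod_hom_id _ X])
    show "(\<lambda>X. tensor_map_id R M N (inc i) (tensor_map_id R (Ms i) N (prj i) X)) \<in> mod_hom R (tensor R M N) (tensor R M N)"
      if "i \<in> I" for i
      by (rule mod_hom_comp[OF tp[OF that that] ti[OF that that]])
    fix x y assume x: "x \<in> carrier M" and y: "y \<in> carrier N"
    have ip: "prj i x \<in> carrier (Ms i)" "inc i (prj i x) \<in> carrier M" if "i \<in> I" for i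
      using mod_hom_closed[OF prj_hom[OF that] x] mod_hom_closed[OF inc_hom[OF that]] by auto
    have "(\<Oplus>\<^bsub>tensor R M N\<^esub>i\<in>I. tensor_map_id R M N (inc i) (tensor_map_id R (Ms i) N (prj i) (pure_tensor R M N x y)))
       = (\<Oplus>\<^bsub>tensor R M N\<^esub>i\<in>I. pure_tensor R M N (inc i (prj i x)) y)"
      using x y ip MN.pure_tensor_closed tensor_map_id_pure[OF module_axioms summand_module assms(2) prj_hom]
        tensor_map_id_pure[OF summand_module module_axioms assms(2) inc_hom]
      by (intro MN.finsum_cong') auto
    also have "\<dots> = pure_tensor R M N (\<Oplus>\<^bsub>M\<^esub>i\<in>I. inc i (prj i x)) y"
      using ip by (intro mod_hom_finsum[OF MN.pure_tensor_hom_left[OF y] module_axioms MN.module_axioms finite_index, symmetric]) auto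
    finally show "(\<Oplus>\<^bsub>tensor R M N\<^esub>i\<in>I. tensor_map_id R M N (inc i) (tensor_map_id R (Ms i) N (prj i) (pure_tensor R M N x y)))
       = pure_tensor R M N x y"
      using x by (simp add: sum_inc_prj)
  qed
  show ?thesis
    by (intro biproduct.intro biproduct_axioms.intro MN.module_axioms)
      (rule finite_index tm ti tp pi sum; assumption)+
qed

section \<open>Complexes given by matrices\<close>

text \<open>The objects of \<open>C\<close> may have any element type; what is recorded is that they
  decompose over \<open>I n\<close> and that the differential has the entries \<open>d\<close>. The
  decomposition itself is hidden by the quantifier, so that a complex, its shift and its tensor
  product with a module can be treated alike.\<close>

definition matrix_complex ::
  "('r, 'k) ring_scheme \<Rightarrow> ('r, 'c) cochain \<Rightarrow> (int \<Rightarrow> 'i set) \<Rightarrow> ('i \<Rightarrow> ('r, 'e) module) \<Rightarrow>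
    ('i \<Rightarrow> 'i \<Rightarrow> 'e \<Rightarrow> 'e) \<Rightarrow> bool"
  where "matrix_complex R C I F d \<longleftrightarrow> cochain_complex R C \<and>
    (\<exists>inc prj. \<forall>n. biproduct R (obj C n) (I n) F (inc n) (prj n) \<and>
      (\<forall>i\<in>I n. \<forall>j\<in>I (n + 1). \<forall>x\<in>carrier (F i). prj (n + 1) j (diff C n (inc n i x)) = d i j x))"

text \<open>The shift carries no sign, so the entries \<open>d\<close> stay the same and only the
  index sets move by one degree.\<close>

lemma matrix_complex_shift:
  assumes "matrix_complex R C I F d"
  shows "matrix_complex R (shift C) (\<lambda>n. I (n - 1)) F d"
proof -
  obtain inc prj where b: "\<And>n. biproduct R (obj C n) (I n) F (inc n) (prj n)"
    and d: "\<And>n i j x. i \<in> I n \<Longrightarrow> j \<in> I (n + 1) \<Longrightarrow> x \<in> carrier (F i) \<Longrightarrow>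
      prj (n + 1) j (diff C n (inc n i x)) = d i j x"
    using assms unfolding matrix_complex_def by blast
  have c: "cochain_complex R C"
    using assms by (simp add: matrix_complex_def)
  have "cochain_complex R (shift C)"
    unfolding cochain_complex_def
  proof
    fix n :: int
    have "n - 1 + 1 = n" "n - 1 + 2 = n + 1" "n + 1 - 1 = n" "n + 2 - 1 = n + 1"
      by auto
    then show "module R (obj (shift C) n) \<and>
        diff (shift C) n \<in> mod_hom R (obj (shift C) n) (obj (shift C) (n + 1)) \<and>
        (\<forall>x\<in>carrier (obj (shift C) n).
          diff (shift C) (n + 1) (diff (shift C) n x) = \<zero>\<^bsub>obj (shift C) (n + 2)\<^esub>)"
      using c[unfolded cochain_complex_def, rule_format, of "n - 1"]
      by (simp add: shift_def)
  qed
  moreover have "prj n j (diff C (n - 1) (inc (n - 1) i x)) = d i j x"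
    if "i \<in> I (n - 1)" "j \<in> I n" "x \<in> carrier (F i)" for n i j x
    using d[of i "n - 1" j x] that by simp
  ultimately show ?thesis
    unfolding matrix_complex_def using b
    by (intro conjI exI[of _ "\<lambda>n. inc (n - 1)"] exI[of _ "\<lambda>n. prj (n - 1)"] allI)
      (simp_all add: shift_def)
qed

text \<open>Functoriality applied twice: injection, differential and projection are each tensored
  with the identity of \<open>N\<close>, so their composite is the entry \<open>d i j\<close>
  tensored with the identity.\<close>

lemma matrix_complex_tensor:
  assumes "matrix_complex R C I F d" "module R N"
    and "\<And>n i j. i \<in> I n \<Longrightarrow> j \<in> I (n + 1) \<Longrightarrow> d i j \<in> mod_hom R (F i) (F j)"
  shows "matrix_complex R (tensor_complex R C N) I (\<lambda>i. tensor R (F i) N)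
    (\<lambda>i j. tensor_map_id R (F j) N (d i j))"
proof -
  obtain inc prj where b: "\<And>n. biproduct R (obj C n) (I n) F (inc n) (prj n)"
    and d: "\<And>n i j x. i \<in> I n \<Longrightarrow> j \<in> I (n + 1) \<Longrightarrow> x \<in> carrier (F i) \<Longrightarrow>
      prj (n + 1) j (diff C n (inc n i x)) = d i j x"
    using assms unfolding matrix_complex_def by blast
  have c: "module R (obj C n)" "diff C n \<in> mod_hom R (obj C n) (obj C (n + 1))"
    "\<And>x. x \<in> carrier (obj C n) \<Longrightarrow> diff C (n + 1) (diff C n x) = \<zero>\<^bsub>obj C (n + 2)\<^esub>" for n
    using assms(1) by (auto simp: matrix_complex_def cochain_complex_def)
  have m: "module R (tensor R (obj C n) N)" for n
    by (intro two_modules.tensor_module two_modules.intro c assms(2))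
  have c': "diff C (n + 1) \<in> mod_hom R (obj C (n + 1)) (obj C (n + 2))" for n
    using c(2)[of "n + 1"] by (simp add: add.assoc)
  have "tensor_map_id R (obj C (n + 2)) N (diff C (n + 1))
        (tensor_map_id R (obj C (n + 1)) N (diff C n) X) = \<zero>\<^bsub>tensor R (obj C (n + 2)) N\<^esub>"
    if X: "X \<in> carrier (tensor R (obj C n) N)" for n X
  proof -
    have "tensor_map_id R (obj C (n + 2)) N (diff C (n + 1)) (tensor_map_id R (obj C (n + 1)) N (diff C n) X)
        = tensor_map_id R (obj C (n + 2)) N (\<lambda>_. \<zero>\<^bsub>obj C (n + 2)\<^esub>) X"
      by (rule tensor_map_id_comp[OF c(1) c(1) c(1) assms(2) c(2) c' mod_hom_zero_map[OF c(1)] c(3) X])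
    also have "\<dots> = \<zero>\<^bsub>tensor R (obj C (n + 2)) N\<^esub>"
      by (rule tensor_map_id_zero[OF c(1) c(1) assms(2) mod_hom_zero_map[OF c(1)] refl X])
    finally show ?thesis .
  qed
  then have "cochain_complex R (tensor_complex R C N)"
    unfolding cochain_complex_def tensor_complex_def
    using m tensor_map_id_hom[OF c(1) c(1) assms(2) c(2)] by (simp add: add.assoc)
  moreover have "tensor_map_id R (F j) N (prj (n + 1) j) (tensor_map_id R (obj C (n + 1)) N (diff C n)
      (tensor_map_id R (obj C n) N (inc n i) X)) = tensor_map_id R (F j) N (d i j) X"
    if i: "i \<in> I n" and j: "j \<in> I (n + 1)" and X: "X \<in> carrier (tensor R (F i) N)" for n i j X
  proof -
    note mi = biproduct.summand_module[OF b i] and mj = biproduct.summand_module[OF b j]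
    note hi = biproduct.inc_hom[OF b i] and hj = biproduct.prj_hom[OF b j]
    note X' = mod_hom_closed[OF tensor_map_id_hom[OF mi c(1) assms(2) hi] X]
    have "tensor_map_id R (F j) N (prj (n + 1) j) (tensor_map_id R (obj C (n + 1)) N (diff C n)
        (tensor_map_id R (obj C n) N (inc n i) X)) =
      tensor_map_id R (F j) N (\<lambda>x. prj (n + 1) j (diff C n x)) (tensor_map_id R (obj C n) N (inc n i) X)"
      by (rule tensor_map_id_comp[OF c(1) c(1) mj assms(2) c(2) hj mod_hom_comp[OF c(2) hj] refl X'])
    also have "\<dots> = tensor_map_id R (F j) N (d i j) X"
      by (rule tensor_map_id_comp[OF mi c(1) mj assms(2) hi mod_hom_comp[OF c(2) hj] assms(3)[OF i j] d[OF i j] X])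
    finally show ?thesis .
  qed
  ultimately show ?thesis
    unfolding matrix_complex_def using tensor_biproduct[OF b assms(2)]
    by (intro conjI exI[of _ "\<lambda>n i. tensor_map_id R (obj C n) N (inc n i)"]
        exI[of _ "\<lambda>n i. tensor_map_id R (F i) N (prj n i)"] allI)
      (simp_all add: tensor_complex_def)
qed

text \<open>The matrix of \<open>D\<close> is block triangular with respect to \<open>I = s ` J \<union> t ` K\<close>, so its diagonal
  blocks are a subcomplex and the quotient by it.\<close>

lemma short_exact_block_triangular:
  fixes R :: "('r, 'k) ring_scheme"
    and C :: "('r, 'c) cochain" and D :: "('r, 'd) cochain" and E :: "('r, 'e) cochain"
    and FC :: "'j \<Rightarrow> ('r, 'fc) module" and FD :: "'i \<Rightarrow> ('r, 'fd) module" and FE :: "'l \<Rightarrow> ('r, 'fe) module"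
  assumes C: "matrix_complex R C J FC dC"
    and D: "matrix_complex R D I FD dD"
    and E: "matrix_complex R E K FE dE"
    and inj: "\<And>n. inj_on s (J n)" "\<And>n. inj_on t (K n)"
    and I: "\<And>n. I n = s ` J n \<union> t ` K n" "\<And>n. s ` J n \<inter> t ` K n = {}"
    and \<alpha>: "\<And>n j. j \<in> J n \<Longrightarrow> \<alpha> j \<in> mod_hom R (FD (s j)) (FC j)"
    and \<alpha>_bij: "\<And>n j. j \<in> J n \<Longrightarrow> bij_betw (\<alpha> j) (carrier (FD (s j))) (carrier (FC j))"
    and \<beta>: "\<And>n k. k \<in> K n \<Longrightarrow> \<beta> k \<in> mod_hom R (FD (t k)) (FE k)"
    and \<beta>_bij: "\<And>n k. k \<in> K n \<Longrightarrow> bij_betw (\<beta> k) (carrier (FD (t k))) (carrier (FE k))"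
    and zero: "\<And>n j k x. j \<in> J n \<Longrightarrow> k \<in> K (n + 1) \<Longrightarrow> x \<in> carrier (FD (s j)) \<Longrightarrow>
      dD (s j) (t k) x = \<zero>\<^bsub>FD (t k)\<^esub>"
    and \<alpha>_comm: "\<And>n j j' x. j \<in> J n \<Longrightarrow> j' \<in> J (n + 1) \<Longrightarrow> x \<in> carrier (FD (s j)) \<Longrightarrow>
      \<alpha> j' (dD (s j) (s j') x) = dC j j' (\<alpha> j x)"
    and \<beta>_comm: "\<And>n k k' x. k \<in> K n \<Longrightarrow> k' \<in> K (n + 1) \<Longrightarrow> x \<in> carrier (FD (t k)) \<Longrightarrow>
      \<beta> k' (dD (t k) (t k') x) = dE k k' (\<beta> k x)"
  shows "\<exists>f g. short_exact R C D E f g"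
proof -
  obtain iC pC where bC: "\<And>n. biproduct R (obj C n) (J n) FC (iC n) (pC n)"
    and dC: "\<And>n i j x. i \<in> J n \<Longrightarrow> j \<in> J (n + 1) \<Longrightarrow> x \<in> carrier (FC i) \<Longrightarrow>
      pC (n + 1) j (diff C n (iC n i x)) = dC i j x"
    using C unfolding matrix_complex_def by blast
  obtain iD pD where bD: "\<And>n. biproduct R (obj D n) (I n) FD (iD n) (pD n)"
    and dD: "\<And>n i j x. i \<in> I n \<Longrightarrow> j \<in> I (n + 1) \<Longrightarrow> x \<in> carrier (FD i) \<Longrightarrow>
      pD (n + 1) j (diff D n (iD n i x)) = dD i j x"
    using D unfolding matrix_complex_def by blast
  obtain iE pE where bE: "\<And>n. biproduct R (obj E n) (K n) FE (iE n) (pE n)"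
    and dE: "\<And>n i j x. i \<in> K n \<Longrightarrow> j \<in> K (n + 1) \<Longrightarrow> x \<in> carrier (FE i) \<Longrightarrow>
      pE (n + 1) j (diff E n (iE n i x)) = dE i j x"
    using E unfolding matrix_complex_def by blast
  have cc: "cochain_complex R C" "cochain_complex R D" "cochain_complex R E"
    using C D E by (auto simp: matrix_complex_def)
  then have dh: "diff C n \<in> mod_hom R (obj C n) (obj C (n + 1))"
    "diff D n \<in> mod_hom R (obj D n) (obj D (n + 1))"
    "diff E n \<in> mod_hom R (obj E n) (obj E (n + 1))" for n
    by (auto simp: cochain_complex_def)
  interpret C: biproduct R "obj C n" "J n" FC "iC n" "pC n" for n by (rule bC)
  interpret D: biproduct R "obj D n" "I n" FD "iD n" "pD n" for n by (rule bD)
  interpret E: biproduct R "obj E n" "K n" FE "iE n" "pE n" for n by (rule bE)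
  note fC = C.summand_module and fD = D.summand_module and fE = E.summand_module
  have sI: "s j \<in> I n" if "j \<in> J n" for j n
    using that I(1) by auto
  have tI: "t k \<in> I n" if "k \<in> K n" for k n
    using that I(1) by auto
  have ts: "t k \<noteq> s j" if "j \<in> J n" "k \<in> K n" for j k n
    using that I(2)[of n] by force
  have t_notin: "t k \<notin> s ` J n" if "k \<in> K n" for k n
    using that I(2)[of n] by auto
  define \<alpha>' where "\<alpha>' j = inv_into (carrier (FD (s j))) (\<alpha> j)" for j
  have \<alpha>': "\<alpha>' j \<in> mod_hom R (FC j) (FD (s j))" if "j \<in> J n" for j n
    unfolding \<alpha>'_def by (rule mod_hom_inv_into[OF fD[OF sI[OF that]] \<alpha>[OF that] \<alpha>_bij[OF that]])
  have \<alpha>\<alpha>': "\<alpha> j (\<alpha>' j x) = x" if "j \<in> J n" "x \<in> carrier (FC j)" for j n x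
    using \<alpha>_bij[OF that(1)] that(2) by (auto simp: \<alpha>'_def bij_betw_def f_inv_into_f)
  have \<alpha>'\<alpha>: "\<alpha>' j (\<alpha> j x) = x" if "j \<in> J n" "x \<in> carrier (FD (s j))" for j n x
    using \<alpha>_bij[OF that(1)] that(2) by (auto simp: \<alpha>'_def bij_betw_def)
  \<comment> \<open>\<open>f\<close> places the summands of \<open>C\<close> into the block of
    \<open>s\<close> through the inverses of \<open>\<alpha>\<close>, and \<open>g\<close> reads off
    the block of \<open>t\<close> through \<open>\<beta>\<close>.\<close>
  define f where "f n x = (\<Oplus>\<^bsub>obj D n\<^esub>j\<in>J n. iD n (s j) (\<alpha>' j (pC n j x)))" for n x
  define g where "g n y = (\<Oplus>\<^bsub>obj E n\<^esub>k\<in>K n. iE n k (\<beta> k (pD n (t k) y)))" for n y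
  have z: "\<alpha>' j (pC n j x) \<in> carrier (FD (s j))" if "j \<in> J n" "x \<in> carrier (obj C n)" for n j x
    by (intro mod_hom_closed[OF \<alpha>'[OF that(1)]] mod_hom_closed[OF C.prj_hom[OF that(1)]] that(2))
  have w: "\<beta> k (pD n (t k) y) \<in> carrier (FE k)" if "k \<in> K n" "y \<in> carrier (obj D n)" for n k y
    by (intro mod_hom_closed[OF \<beta>[OF that(1)]] mod_hom_closed[OF D.prj_hom[OF tI[OF that(1)]]] that(2))
  have fh: "f n \<in> mod_hom R (obj C n) (obj D n)" for n
    unfolding f_def
    by (rule mod_hom_finsum_map[OF D.module_axioms C.finite_index])
      (rule mod_hom_comp[OF mod_hom_comp[OF C.prj_hom \<alpha>'] D.inc_hom[OF sI]])
  have gh: "g n \<in> mod_hom R (obj D n) (obj E n)" for n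
    unfolding g_def
    by (rule mod_hom_finsum_map[OF E.module_axioms E.finite_index])
      (rule mod_hom_comp[OF mod_hom_comp[OF D.prj_hom[OF tI] \<beta>] E.inc_hom])
  have ss: "s ` J n \<subseteq> I n" for n
    using I(1) by auto
  have psf: "pD n (s j) (f n x) = \<alpha>' j (pC n j x)" if "j \<in> J n" "x \<in> carrier (obj C n)" for n j x
    unfolding f_def
    by (rule D.prj_sum_in[OF C.finite_index inj(1) ss z[OF _ that(2)] that(1)])
  have ptf: "pD n (t k) (f n x) = \<zero>\<^bsub>FD (t k)\<^esub>" if "k \<in> K n" "x \<in> carrier (obj C n)" for n k x
    unfolding f_def
    by (rule D.prj_sum_out[OF C.finite_index inj(1) ss z[OF _ that(2)] tI[OF that(1)] t_notin[OF that(1)]])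
  have pg: "pE n k (g n y) = \<beta> k (pD n (t k) y)" if "k \<in> K n" "y \<in> carrier (obj D n)" for n k y
    unfolding g_def by (rule E.prj_sum_self[OF w[OF _ that(2)] that(1)])
  have eqD: "x = y" if "x \<in> carrier (obj D n)" "y \<in> carrier (obj D n)"
    "\<And>j. j \<in> J n \<Longrightarrow> pD n (s j) x = pD n (s j) y" "\<And>k. k \<in> K n \<Longrightarrow> pD n (t k) x = pD n (t k) y" for x y n
    by (rule D.eqI[OF that(1,2)]) (use that(3,4) I(1) in auto)
  have f_inc: "f n (iC n j x) = iD n (s j) (\<alpha>' j x)" if j: "j \<in> J n" and x: "x \<in> carrier (FC j)" for n j x
  proof (rule eqD)
    note ix = mod_hom_closed[OF C.inc_hom[OF j] x]
    note ax = mod_hom_closed[OF \<alpha>'[OF j] x]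
    show "f n (iC n j x) \<in> carrier (obj D n)"
      by (rule mod_hom_closed[OF fh ix])
    show "iD n (s j) (\<alpha>' j x) \<in> carrier (obj D n)"
      by (rule mod_hom_closed[OF D.inc_hom[OF sI[OF j]] ax])
    show "pD n (s j') (f n (iC n j x)) = pD n (s j') (iD n (s j) (\<alpha>' j x))" if j': "j' \<in> J n" for j'
      using inj_onD[OF inj(1) _ j j'] mod_hom_zero[OF \<alpha>'[OF j'] fC[OF j'] fD[OF sI[OF j']]]
      by (auto simp: psf[OF j' ix] C.prj_inc[OF j j' x] D.prj_inc[OF sI[OF j] sI[OF j'] ax])
    show "pD n (t k) (f n (iC n j x)) = pD n (t k) (iD n (s j) (\<alpha>' j x))" if k: "k \<in> K n" for k
      using ts[OF j k] by (auto simp: ptf[OF k ix] D.prj_inc[OF sI[OF j] tI[OF k] ax])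
  qed
  have g_inc_s: "g n (iD n (s j) x) = \<zero>\<^bsub>obj E n\<^esub>" if j: "j \<in> J n" and x: "x \<in> carrier (FD (s j))" for n j x
  proof (rule E.eqI)
    note ix = mod_hom_closed[OF D.inc_hom[OF sI[OF j]] x]
    show "g n (iD n (s j) x) \<in> carrier (obj E n)"
      by (rule mod_hom_closed[OF gh ix])
    show "\<zero>\<^bsub>obj E n\<^esub> \<in> carrier (obj E n)"
      by simp
    show "pE n k (g n (iD n (s j) x)) = pE n k \<zero>\<^bsub>obj E n\<^esub>" if k: "k \<in> K n" for k
      using ts[OF j k] mod_hom_zero[OF \<beta>[OF k] fD[OF tI[OF k]] fE[OF k]]
        mod_hom_zero[OF E.prj_hom[OF k] E.module_axioms fE[OF k]]
      by (auto simp: pg[OF k ix] D.prj_inc[OF sI[OF j] tI[OF k] x])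
  qed
  have g_inc_t: "g n (iD n (t k) x) = iE n k (\<beta> k x)" if k: "k \<in> K n" and x: "x \<in> carrier (FD (t k))" for n k x
  proof (rule E.eqI)
    note ix = mod_hom_closed[OF D.inc_hom[OF tI[OF k]] x]
    note bx = mod_hom_closed[OF \<beta>[OF k] x]
    show "g n (iD n (t k) x) \<in> carrier (obj E n)"
      by (rule mod_hom_closed[OF gh ix])
    show "iE n k (\<beta> k x) \<in> carrier (obj E n)"
      by (rule mod_hom_closed[OF E.inc_hom[OF k] bx])
    show "pE n k' (g n (iD n (t k) x)) = pE n k' (iE n k (\<beta> k x))" if k': "k' \<in> K n" for k'
      using inj_onD[OF inj(2) _ k k'] mod_hom_zero[OF \<beta>[OF k'] fD[OF tI[OF k']] fE[OF k']]
      by (auto simp: pg[OF k' ix] D.prj_inc[OF tI[OF k] tI[OF k'] x] E.prj_inc[OF k k' bx])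
  qed
  have fc: "f (n + 1) (diff C n x) = diff D n (f n x)" if x: "x \<in> carrier (obj C n)" for n x
  proof (rule C.hom_ext[OF D.module_axioms mod_hom_comp[OF dh(1) fh] mod_hom_comp[OF fh dh(2)] _ x])
    fix j y assume j: "j \<in> J n" and y: "y \<in> carrier (FC j)"
    note ax = mod_hom_closed[OF \<alpha>'[OF j] y]
    note iy = mod_hom_closed[OF dh(1) mod_hom_closed[OF C.inc_hom[OF j] y]]
    note iax = mod_hom_closed[OF dh(2) mod_hom_closed[OF D.inc_hom[OF sI[OF j]] ax]]
    show "f (n + 1) (diff C n (iC n j y)) = diff D n (f n (iC n j y))"
      unfolding f_inc[OF j y]
    proof (rule eqD[OF mod_hom_closed[OF fh iy] iax])
      fix j' assume j': "j' \<in> J (n + 1)"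
      have dDx: "dD (s j) (s j') (\<alpha>' j y) \<in> carrier (FD (s j'))"
        using mod_hom_closed[OF D.prj_hom[OF sI[OF j']] iax] dD[OF sI[OF j] sI[OF j'] ax] by simp
      have "\<alpha>' j' (dC j j' y) = \<alpha>' j' (\<alpha> j' (dD (s j) (s j') (\<alpha>' j y)))"
        using \<alpha>_comm[OF j j' ax] \<alpha>\<alpha>'[OF j y] by simp
      also have "\<dots> = dD (s j) (s j') (\<alpha>' j y)"
        by (rule \<alpha>'\<alpha>[OF j' dDx])
      finally show "pD (n + 1) (s j') (f (n + 1) (diff C n (iC n j y))) =
          pD (n + 1) (s j') (diff D n (iD n (s j) (\<alpha>' j y)))"
        unfolding psf[OF j' iy] dC[OF j j' y] dD[OF sI[OF j] sI[OF j'] ax] .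
    next
      \<comment> \<open>The vanishing block \<open>zero\<close> enters here: the differential of
        \<open>D\<close> does not lead out of the image of \<open>f\<close>.\<close>
      fix k assume k: "k \<in> K (n + 1)"
      show "pD (n + 1) (t k) (f (n + 1) (diff C n (iC n j y))) =
          pD (n + 1) (t k) (diff D n (iD n (s j) (\<alpha>' j y)))"
        unfolding ptf[OF k iy] dD[OF sI[OF j] tI[OF k] ax] zero[OF j k ax] ..
    qed
  qed
  have gc: "g (n + 1) (diff D n x) = diff E n (g n x)" if x: "x \<in> carrier (obj D n)" for n x
  proof (rule D.hom_ext[OF E.module_axioms mod_hom_comp[OF dh(2) gh] mod_hom_comp[OF gh dh(3)] _ x])
    fix i y assume i: "i \<in> I n" and y: "y \<in> carrier (FD i)"
    note iy = mod_hom_closed[OF dh(2) mod_hom_closed[OF D.inc_hom[OF i] y]]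
    note giy = mod_hom_closed[OF dh(3) mod_hom_closed[OF gh mod_hom_closed[OF D.inc_hom[OF i] y]]]
    show "g (n + 1) (diff D n (iD n i y)) = diff E n (g n (iD n i y))"
    proof (rule E.eqI[OF mod_hom_closed[OF gh iy] giy])
      fix k assume k: "k \<in> K (n + 1)"
      \<comment> \<open>On the block of \<open>s\<close> both sides vanish, the left one by
        \<open>zero\<close>; on the block of \<open>t\<close> the claim is
        \<open>\<beta>_comm\<close>.\<close>
      from i consider j where "j \<in> J n" "i = s j" | k' where "k' \<in> K n" "i = t k'"
        using I(1) by auto
      then show "pE (n + 1) k (g (n + 1) (diff D n (iD n i y))) = pE (n + 1) k (diff E n (g n (iD n i y)))"
      proof cases
        case 1
        note y' = y[unfolded 1(2)]
        show ?thesis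
          unfolding pg[OF k iy] unfolding 1(2) dD[OF sI[OF 1(1)] tI[OF k] y'] zero[OF 1(1) k y']
            g_inc_s[OF 1(1) y'] mod_hom_zero[OF dh(3) E.module_axioms E.module_axioms] mod_hom_zero[OF \<beta>[OF k] fD[OF tI[OF k]] fE[OF k]]
            mod_hom_zero[OF E.prj_hom[OF k] E.module_axioms fE[OF k]] ..
      next
        case 2
        note y' = y[unfolded 2(2)]
        show ?thesis
          unfolding pg[OF k iy] unfolding 2(2) dD[OF tI[OF 2(1)] tI[OF k] y'] g_inc_t[OF 2(1) y']
            dE[OF 2(1) k mod_hom_closed[OF \<beta>[OF 2(1)] y']] by (rule \<beta>_comm[OF 2(1) k y'])
      qed
    qed
  qed
  have f_inj: "inj_on (f n) (carrier (obj C n))" for n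
  proof (rule inj_onI)
    fix x y assume x: "x \<in> carrier (obj C n)" and y: "y \<in> carrier (obj C n)" and eq: "f n x = f n y"
    show "x = y"
    proof (rule C.eqI[OF x y])
      fix j assume j: "j \<in> J n"
      note px = mod_hom_closed[OF C.prj_hom[OF j]]
      have "\<alpha> j (\<alpha>' j (pC n j x)) = \<alpha> j (\<alpha>' j (pC n j y))"
        using psf[OF j x] psf[OF j y] eq by simp
      then show "pC n j x = pC n j y"
        unfolding \<alpha>\<alpha>'[OF j px[OF x]] \<alpha>\<alpha>'[OF j px[OF y]] .
    qed
  qed
  have g_surj: "\<exists>y\<in>carrier (obj D n). g n y = e" if e: "e \<in> carrier (obj E n)" for n e
  proof -
    \<comment> \<open>Components of a preimage on the block of \<open>t\<close>; on the block of
      \<open>s\<close> the preimage is zero.\<close>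
    define u where "u k = inv_into (carrier (FD (t k))) (\<beta> k) (pE n k e)" for k
    have u: "u k \<in> carrier (FD (t k))" "\<beta> k (u k) = pE n k e" if k: "k \<in> K n" for k
    proof -
      have "pE n k e \<in> \<beta> k ` carrier (FD (t k))"
        using mod_hom_closed[OF E.prj_hom[OF k] e] \<beta>_bij[OF k] by (simp add: bij_betw_def)
      then show "u k \<in> carrier (FD (t k))" "\<beta> k (u k) = pE n k e"
        unfolding u_def by (rule inv_into_into, rule f_inv_into_f)
    qed
    let ?y = "\<Oplus>\<^bsub>obj D n\<^esub>k\<in>K n. iD n (t k) (u k)"
    have y: "?y \<in> carrier (obj D n)"
      using mod_hom_closed[OF D.inc_hom[OF tI] u(1)] by (intro D.finsum_closed) auto
    have ts': "t ` K n \<subseteq> I n"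
      using I(1) by auto
    have "g n ?y = e"
    proof (rule E.eqI[OF mod_hom_closed[OF gh y] e])
      fix k assume k: "k \<in> K n"
      have "pD n (t k) ?y = u k"
        by (rule D.prj_sum_in[OF E.finite_index inj(2) ts' u(1) k])
      then show "pE n k (g n ?y) = pE n k e"
        by (simp add: pg[OF k y] u(2)[OF k])
    qed
    with y show ?thesis by blast
  qed
  have ker: "f n ` carrier (obj C n) = {x \<in> carrier (obj D n). g n x = \<zero>\<^bsub>obj E n\<^esub>}" for n
  proof (intro equalityI subsetI)
    fix y assume "y \<in> f n ` carrier (obj C n)"
    then obtain x where x: "x \<in> carrier (obj C n)" "y = f n x"
      by auto
    have y: "y \<in> carrier (obj D n)"
      using mod_hom_closed[OF fh x(1)] x(2) by simp
    have "g n y = \<zero>\<^bsub>obj E n\<^esub>"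
    proof (rule E.eqI[OF mod_hom_closed[OF gh y] E.zero_closed])
      fix k assume k: "k \<in> K n"
      show "pE n k (g n y) = pE n k \<zero>\<^bsub>obj E n\<^esub>"
        unfolding pg[OF k y] unfolding x(2) ptf[OF k x(1)] mod_hom_zero[OF \<beta>[OF k] fD[OF tI[OF k]] fE[OF k]]
          mod_hom_zero[OF E.prj_hom[OF k] E.module_axioms fE[OF k]] ..
    qed
    with y show "y \<in> {x \<in> carrier (obj D n). g n x = \<zero>\<^bsub>obj E n\<^esub>}"
      by simp
  next
    fix y assume "y \<in> {x \<in> carrier (obj D n). g n x = \<zero>\<^bsub>obj E n\<^esub>}"
    then have y: "y \<in> carrier (obj D n)" "g n y = \<zero>\<^bsub>obj E n\<^esub>"
      by auto
    \<comment> \<open>Injectivity of each \<open>\<beta> k\<close> shows that the kernel of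
      \<open>g\<close> consists of elements supported on the block of \<open>s\<close>.\<close>
    have yt: "pD n (t k) y = \<zero>\<^bsub>FD (t k)\<^esub>" if k: "k \<in> K n" for k
    proof -
      interpret F: module R "FD (t k)" by (rule fD[OF tI[OF k]])
      have "\<beta> k (pD n (t k) y) = \<beta> k \<zero>\<^bsub>FD (t k)\<^esub>"
        using pg[OF k y(1)] y(2) mod_hom_zero[OF \<beta>[OF k] fD[OF tI[OF k]] fE[OF k]]
          mod_hom_zero[OF E.prj_hom[OF k] E.module_axioms fE[OF k]] by simp
      then show ?thesis
        using \<beta>_bij[OF k] mod_hom_closed[OF D.prj_hom[OF tI[OF k]] y(1)]
        by (auto simp: bij_betw_def dest: inj_onD)
    qed
    \<comment> \<open>The components of \<open>y\<close> on the block of \<open>s\<close>, carried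
      back by \<open>\<alpha>\<close>, form the preimage under \<open>f\<close>.\<close>
    define x where "x = (\<Oplus>\<^bsub>obj C n\<^esub>j\<in>J n. iC n j (\<alpha> j (pD n (s j) y)))"
    have u: "\<alpha> j (pD n (s j) y) \<in> carrier (FC j)" if j: "j \<in> J n" for j
      by (rule mod_hom_closed[OF \<alpha>[OF j] mod_hom_closed[OF D.prj_hom[OF sI[OF j]] y(1)]])
    have x: "x \<in> carrier (obj C n)"
      unfolding x_def using mod_hom_closed[OF C.inc_hom u] by (intro C.finsum_closed) auto
    have px: "pC n j x = \<alpha> j (pD n (s j) y)" if "j \<in> J n" for j
      unfolding x_def by (rule C.prj_sum_self[OF u that])
    have "y = f n x"
    proof (rule eqD[OF y(1) mod_hom_closed[OF fh x]])
      show "pD n (s j) y = pD n (s j) (f n x)" if j: "j \<in> J n" for j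
        unfolding psf[OF j x] px[OF j]
        by (rule \<alpha>'\<alpha>[OF j mod_hom_closed[OF D.prj_hom[OF sI[OF j]] y(1)], symmetric])
      show "pD n (t k) y = pD n (t k) (f n x)" if k: "k \<in> K n" for k
        unfolding ptf[OF k x] by (rule yt[OF k])
    qed
    with x show "y \<in> f n ` carrier (obj C n)" by blast
  qed
  have im: "g n ` carrier (obj D n) = carrier (obj E n)" for n
    using g_surj mod_hom_closed[OF gh] by blast
  have "short_exact R C D E f g"
    unfolding short_exact_def cochain_map_def
    by (intro conjI allI ballI cc fh gh fc gc f_inj ker im; assumption)
  then show ?thesis by blast
qed

section \<open>Tensor powers indexed by distinct lists\<close>

text \<open>The factors of a tensor power are indexed by the entries of a distinct list \<open>cs\<close>; a tuple is then
  \<open>map f cs\<close> for a total function \<open>f\<close>, and updates of list positions become function updates.\<close>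

definition multilinear ::
  "('r, 'k) ring_scheme \<Rightarrow> ('r, 'a, 'm) module_scheme \<Rightarrow> 'i set \<Rightarrow> ('r, 'c, 'l) module_scheme \<Rightarrow>
    (('i \<Rightarrow> 'a) \<Rightarrow> 'c) \<Rightarrow> bool"
  where "multilinear R A S P \<Phi> \<longleftrightarrow>
    (\<forall>f. range f \<subseteq> carrier A \<longrightarrow>
      \<Phi> f \<in> carrier P \<and> (\<forall>c\<in>S. (\<lambda>x. \<Phi> (f(c := x))) \<in> mod_hom R A P))"

lemma map_list_update:
  assumes "distinct cs" "i < length cs"
  shows "(map f cs)[i := x] = map (f(cs ! i := x)) cs"
  using assms by (intro nth_equalityI) (auto simp: nth_list_update nth_eq_iff_index_eq)

text \<open>\<open>f\<close> is total with all values in the carrier, so a default value must fill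
  the arguments outside \<open>cs\<close>; this is where a nonempty carrier enters.\<close>

lemma tuple_eq_map:
  assumes "xs \<in> tuples A (length cs)" "distinct cs" "carrier A \<noteq> {}"
  obtains f where "range f \<subseteq> carrier A" "map f cs = xs"
proof -
  have "length xs = length cs"
    using assms by (simp add: tuples_def)
  then have "set xs \<subseteq> carrier A \<longrightarrow> distinct cs \<longrightarrow> (\<exists>f. range f \<subseteq> carrier A \<and> map f cs = xs)"
  proof (induction rule: list_induct2)
    case Nil
    obtain a where "a \<in> carrier A"
      using assms(3) by auto
    then show ?case
      by (auto intro: exI[of _ "\<lambda>_. a"])
  next
    case (Cons x xs c cs)
    show ?case
    proof (intro impI)
      assume *: "set (x # xs) \<subseteq> carrier A" "distinct (c # cs)"
      then obtain f where "range f \<subseteq> carrier A" "map f cs = xs"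
        using Cons.IH by auto
      with * show "\<exists>f. range f \<subseteq> carrier A \<and> map f (c # cs) = x # xs"
        by (intro exI[of _ "f(c := x)"]) auto
    qed
  qed
  then show ?thesis
    using assms that by (auto simp: tuples_def)
qed

definition power_relators ::
  "('r, 'k) ring_scheme \<Rightarrow> ('r, 'a, 'm) module_scheme \<Rightarrow> nat \<Rightarrow> ('a list \<Rightarrow> 'r) set"
  where "power_relators R A n =
    (let F = free_module R (tuples A n) in
       {gen R (xs[i := x \<oplus>\<^bsub>A\<^esub> y]) \<ominus>\<^bsub>F\<^esub> (gen R (xs[i := x]) \<oplus>\<^bsub>F\<^esub> gen R (xs[i := y])) | xs i x y.
            xs \<in> tuples A n \<and> i < n \<and> x \<in> carrier A \<and> y \<in> carrier A} \<union>
        {gen R (xs[i := r \<odot>\<^bsub>A\<^esub> x]) \<ominus>\<^bsub>F\<^esub> (r \<odot>\<^bsub>F\<^esub> gen R (xs[i := x])) | xs i r x.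
            xs \<in> tuples A n \<and> i < n \<and> r \<in> carrier R \<and> x \<in> carrier A})"

lemma tensor_power_eq_presented:
  "tensor_power R A n = presented R (tuples A n) (power_relators R A n)"
  by (simp add: tensor_power_def presented_def power_rel_def power_relators_def Let_def)

lemma pure_power_eq_pgen:
  "pure_power R A xs = pgen R (tuples A (length xs)) (power_relators R A (length xs)) xs"
  by (simp add: pure_power_def pgen_def power_rel_def power_relators_def Let_def)

context module
begin

abbreviation power :: "'i list \<Rightarrow> ('a, ('c list \<Rightarrow> 'a) set) module"
  where "power cs \<equiv> tensor_power R M (length cs)"

abbreviation pure :: "'i list \<Rightarrow> ('i \<Rightarrow> 'c) \<Rightarrow> ('c list \<Rightarrow> 'a) set"
  where "pure cs f \<equiv> pure_power R M (map f cs)"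

lemma tuples_update: "xs \<in> tuples M n \<Longrightarrow> x \<in> carrier M \<Longrightarrow> xs[i := x] \<in> tuples M n"
  using set_update_subset_insert[of xs i x] by (auto simp: tuples_def)

lemma map_in_tuples: "range f \<subseteq> carrier M \<Longrightarrow> map f cs \<in> tuples M (length cs)"
  by (auto simp: tuples_def)

lemma power_presentation: "presentation R (tuples M n) (power_relators R M n)"
proof -
  interpret F: module R "free_module R (tuples M n)"
    by (rule free_module_module) (rule R.cring_axioms)
  have "gen R (xs[i := x]) \<in> carrier (free_module R (tuples M n))"
    if "xs \<in> tuples M n" "x \<in> carrier M" for xs i x
    using that by (intro gen_closed R.cring_axioms tuples_update)
  then show ?thesis
    by (intro presentation.intro presentation_axioms.intro R.cring_axioms)
      (auto simp: power_relators_def Let_def intro!: F.minus_closed F.a_closed F.smult_closed)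
qed

lemma tensor_power_module: "module R (tensor_power R M n)"
  unfolding tensor_power_eq_presented by (rule presentation.presented_module[OF power_presentation])

lemma pure_power_closed:
  assumes "range f \<subseteq> carrier M"
  shows "pure cs f \<in> carrier (power cs)"
  unfolding tensor_power_eq_presented pure_power_eq_pgen length_map
  by (rule presentation.pgen_closed[OF power_presentation map_in_tuples[OF assms]])

text \<open>As \<open>cs\<close> is distinct, updating \<open>f\<close> at the entry
  \<open>cs ! i\<close> changes the tuple at position \<open>i\<close> only, which is the situation
  of the relators.\<close>

lemma pure_power_multilinear:
  fixes cs :: "'i list"
  assumes "distinct cs"
  shows "multilinear R M (set cs) (power cs) (\<lambda>f. pure cs f)"
  unfolding multilinear_def
proof (intro allI impI conjI ballI)
  fix f :: "'i \<Rightarrow> 'c" and c assume f: "range f \<subseteq> carrier M"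
  show "pure cs f \<in> carrier (power cs)"
    by (rule pure_power_closed[OF f])
  assume "c \<in> set cs"
  then obtain i where i: "i < length cs" "cs ! i = c"
    by (auto simp: in_set_conv_nth)
  let ?n = "length cs" and ?xs = "map f cs"
  let ?F = "free_module R (tuples M ?n)"
  let ?q = "\<lambda>x. submodule_span R ?F (power_relators R M ?n) +>\<^bsub>?F\<^esub> x"
  interpret F: module R ?F
    by (rule free_module_module) (rule R.cring_axioms)
  interpret T: presentation R "tuples M ?n" "power_relators R M ?n"
    by (rule power_presentation)
  have xs: "?xs \<in> tuples M ?n"
    by (rule map_in_tuples[OF f])
  have p: "pure cs (f(c := x)) = ?q (gen R (?xs[i := x]))" for x
    using map_list_update[OF assms i(1), of f x] i(2) by (simp add: pure_power_eq_pgen pgen_def)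
  have g: "gen R (?xs[i := x]) \<in> carrier ?F" if "x \<in> carrier M" for x
    using that by (intro gen_closed R.cring_axioms tuples_update xs)
  note qh = T.coset_hom[folded tensor_power_eq_presented]
  show "(\<lambda>x. pure cs (f(c := x))) \<in> mod_hom R M (tensor_power R M ?n)"
    unfolding p
  proof (rule mod_homI)
    fix x assume x: "x \<in> carrier M"
    show "?q (gen R (?xs[i := x])) \<in> carrier (tensor_power R M ?n)"
      by (rule mod_hom_closed[OF qh g[OF x]])
    fix y assume y: "y \<in> carrier M"
    have "?q (gen R (?xs[i := x \<oplus>\<^bsub>M\<^esub> y])) = ?q (gen R (?xs[i := x]) \<oplus>\<^bsub>?F\<^esub> gen R (?xs[i := y]))"
    proof (rule T.coset_relation)
      show "gen R (?xs[i := x \<oplus>\<^bsub>M\<^esub> y]) \<ominus>\<^bsub>?F\<^esub> (gen R (?xs[i := x]) \<oplus>\<^bsub>?F\<^esub> gen R (?xs[i := y]))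
          \<in> power_relators R M ?n"
        unfolding power_relators_def Let_def using x y xs i(1) by blast
    qed (use x y in \<open>auto intro!: g F.a_closed\<close>)
    then show "?q (gen R (?xs[i := x \<oplus>\<^bsub>M\<^esub> y])) =
        ?q (gen R (?xs[i := x])) \<oplus>\<^bsub>tensor_power R M ?n\<^esub> ?q (gen R (?xs[i := y]))"
      using mod_hom_add[OF qh g[OF x] g[OF y]] by simp
  next
    fix r x assume r: "r \<in> carrier R" and x: "x \<in> carrier M"
    have "?q (gen R (?xs[i := r \<odot>\<^bsub>M\<^esub> x])) = ?q (r \<odot>\<^bsub>?F\<^esub> gen R (?xs[i := x]))"
    proof (rule T.coset_relation)
      show "gen R (?xs[i := r \<odot>\<^bsub>M\<^esub> x]) \<ominus>\<^bsub>?F\<^esub> (r \<odot>\<^bsub>?F\<^esub> gen R (?xs[i := x])) \<in> power_relators R M ?n"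
        unfolding power_relators_def Let_def using x r xs i(1) by blast
    qed (use x r in \<open>auto intro!: g F.smult_closed\<close>)
    then show "?q (gen R (?xs[i := r \<odot>\<^bsub>M\<^esub> x])) =
        r \<odot>\<^bsub>tensor_power R M ?n\<^esub> ?q (gen R (?xs[i := x]))"
      using mod_hom_smult[OF qh r g[OF x]] by simp
  qed
qed

lemma carrier_nonempty: "carrier M \<noteq> {}"
  using M.zero_closed by auto

text \<open>The map \<open>\<phi>\<close> takes lists, as in the definition of
  \<open>multipath_mu\<close>, while multilinearity is tested on functions over the list
  \<open>cs\<close>, where merging of components is easy to express.\<close>

lemma tensor_power_hom:
  fixes cs :: "'i list"
  assumes P: "module R P" and cs: "distinct cs"
    and \<phi>: "multilinear R M (set cs) P (\<lambda>f. \<phi> (map f cs))"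
  shows "(\<lambda>X. the_elem (lin_ext R P \<phi> ` X)) \<in> mod_hom R (power cs) P"
    and "range f \<subseteq> carrier M \<Longrightarrow> the_elem (lin_ext R P \<phi> ` pure cs f) = \<phi> (map f cs)"
proof -
  let ?n = "length cs"
  let ?F = "free_module R (tuples M ?n)"
  interpret F: module R ?F
    by (rule free_module_module) (rule R.cring_axioms)
  interpret T: presentation R "tuples M ?n" "power_relators R M ?n"
    by (rule power_presentation)
  interpret P: module R P by fact
  have cl: "\<phi> \<in> tuples M ?n \<rightarrow> carrier P"
  proof
    fix xs assume "xs \<in> tuples M ?n"
    then obtain f where "range f \<subseteq> carrier M" "map f cs = xs"
      by (rule tuple_eq_map[OF _ cs carrier_nonempty])
    then show "\<phi> xs \<in> carrier P"
      using \<phi> by (auto simp: multilinear_def)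
  qed
  have hom: "(\<lambda>x. \<phi> (xs[i := x])) \<in> mod_hom R M P" if xs: "xs \<in> tuples M ?n" and i: "i < ?n" for xs i
  proof -
    obtain f where "range f \<subseteq> carrier M" "map f cs = xs"
      by (rule tuple_eq_map[OF xs cs carrier_nonempty])
    then show ?thesis
      using \<phi> i by (auto simp: multilinear_def map_list_update[OF cs i])
  qed
  note l = P.lin_ext_hom[OF cl]
  have lg: "lin_ext R P \<phi> (gen R (xs[i := x])) = \<phi> (xs[i := x])" if "xs \<in> tuples M ?n" "x \<in> carrier M" for xs i x
    using that cl tuples_update by (intro P.lin_ext_gen) auto
  have g: "gen R (xs[i := x]) \<in> carrier ?F" if "xs \<in> tuples M ?n" "x \<in> carrier M" for xs i x
    using that by (intro gen_closed R.cring_axioms tuples_update)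
  have z: "z \<ominus>\<^bsub>P\<^esub> z = \<zero>\<^bsub>P\<^esub>" if "z \<in> carrier P" for z
    using that by (simp add: a_minus_def P.r_neg)
  note lm = mod_hom_minus[OF l F.module_axioms P] mod_hom_add[OF l] mod_hom_smult[OF l]
  have van: "lin_ext R P \<phi> s = \<zero>\<^bsub>P\<^esub>" if "s \<in> power_relators R M ?n" for s
    using that unfolding power_relators_def Let_def
  proof (elim UnE CollectE exE conjE)
    fix xs i x y
    assume "s = gen R (xs[i := x \<oplus>\<^bsub>M\<^esub> y]) \<ominus>\<^bsub>?F\<^esub> (gen R (xs[i := x]) \<oplus>\<^bsub>?F\<^esub> gen R (xs[i := y]))"
      and xs: "xs \<in> tuples M ?n" "i < ?n" and xy: "x \<in> carrier M" "y \<in> carrier M"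
    then show ?thesis
      using mod_hom_add[OF hom[OF xs] xy] mod_hom_closed[OF hom[OF xs]]
      by (simp add: lm g lg z)
  next
    fix xs i r x
    assume "s = gen R (xs[i := r \<odot>\<^bsub>M\<^esub> x]) \<ominus>\<^bsub>?F\<^esub> (r \<odot>\<^bsub>?F\<^esub> gen R (xs[i := x]))"
      and xs: "xs \<in> tuples M ?n" "i < ?n" and rx: "r \<in> carrier R" "x \<in> carrier M"
    then show ?thesis
      using mod_hom_smult[OF hom[OF xs] rx] mod_hom_closed[OF hom[OF xs]]
      by (simp add: lm g lg z)
  qed
  show "(\<lambda>X. the_elem (lin_ext R P \<phi> ` X)) \<in> mod_hom R (tensor_power R M ?n) P"
    unfolding tensor_power_eq_presented by (rule T.presented_hom[OF P cl van])
  show "the_elem (lin_ext R P \<phi> ` pure cs f) = \<phi> (map f cs)" if "range f \<subseteq> carrier M"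
    unfolding pure_power_eq_pgen length_map
    by (rule T.presented_hom_pgen[OF P cl van map_in_tuples[OF that]])
qed

text \<open>The version for maps that are given on functions. A tuple determines \<open>f\<close> on
  \<open>cs\<close> only, so \<open>\<Phi>\<close> has to depend on no other values; this is
  \<open>local\<close>.\<close>

lemma tensor_power_hom_exists:
  fixes cs :: "'i list"
  assumes P: "module R P" and cs: "distinct cs" and \<Phi>: "multilinear R M (set cs) P \<Phi>"
    and local: "\<And>f g. (\<And>c. c \<in> set cs \<Longrightarrow> f c = g c) \<Longrightarrow> \<Phi> f = \<Phi> g"
  obtains h where "h \<in> mod_hom R (power cs) P"
    "\<And>f. range f \<subseteq> carrier M \<Longrightarrow> h (pure cs f) = \<Phi> f"
proof -
  \<comment> \<open>Any \<open>f\<close> representing the tuple will do, by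
    \<open>local\<close>.\<close>
  define \<phi> where "\<phi> xs = \<Phi> (SOME f. map f cs = xs)" for xs
  have "map (SOME g. map g cs = map f cs) cs = map f cs" for f
    by (rule someI[of "\<lambda>g. map g cs = map f cs" f]) simp
  then have \<phi>: "\<phi> (map f cs) = \<Phi> f" for f
    unfolding \<phi>_def by (rule local[OF map_eq_conv[THEN iffD1, rule_format]])
  with \<Phi> have ml: "multilinear R M (set cs) P (\<lambda>f. \<phi> (map f cs))"
    by simp
  show ?thesis
    using that[OF tensor_power_hom(1)[OF P cs ml]] tensor_power_hom(2)[OF P cs ml] \<phi> by simp
qed

lemma tensor_power_hom_ext:
  assumes "module R P" "distinct cs"
    and "h \<in> mod_hom R (power cs) P" "k \<in> mod_hom R (power cs) P"
    and "\<And>f. range f \<subseteq> carrier M \<Longrightarrow> h (pure cs f) = k (pure cs f)"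
    and "X \<in> carrier (power cs)"
  shows "h X = k X"
proof (rule presentation.presented_hom_ext[OF power_presentation assms(1) assms(3,4)[unfolded tensor_power_eq_presented]
      _ assms(6)[unfolded tensor_power_eq_presented]])
  fix xs assume "xs \<in> tuples M (length cs)"
  then obtain f where "range f \<subseteq> carrier M" "map f cs = xs"
    by (rule tuple_eq_map[OF _ assms(2) carrier_nonempty])
  then show "h (pgen R (tuples M (length cs)) (power_relators R M (length cs)) xs) =
      k (pgen R (tuples M (length cs)) (power_relators R M (length cs)) xs)"
    using assms(5) by (auto simp: pure_power_eq_pgen)
qed

section \<open>Isomorphisms and multilinear maps between tensor powers\<close>

lemma reindex_hom:
  fixes cs :: "'i list" and ds :: "'j list"
  assumes cs: "distinct cs" and ds: "distinct ds" and \<theta>: "bij_betw \<theta> (set ds) (set cs)"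
  obtains h where "h \<in> mod_hom R (power cs) (power ds)"
    "\<And>f. range f \<subseteq> carrier M \<Longrightarrow> h (pure cs f) = pure ds (\<lambda>c. f (\<theta> c))"
proof -
  note ml = pure_power_multilinear[OF ds, unfolded multilinear_def, rule_format]
  have "multilinear R M (set cs) (power ds) (\<lambda>f. pure ds (\<lambda>c. f (\<theta> c)))"
    unfolding multilinear_def
  proof (intro allI impI conjI ballI)
    fix f :: "'i \<Rightarrow> 'c" and c assume f: "range f \<subseteq> carrier M"
    then have f\<theta>: "range (\<lambda>c. f (\<theta> c)) \<subseteq> carrier M"
      by auto
    then show "pure ds (\<lambda>c. f (\<theta> c)) \<in> carrier (power ds)"
      by (rule pure_power_closed)
    assume "c \<in> set cs"
    then obtain d where d: "d \<in> set ds" "\<theta> d = c"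
      using bij_betw_imp_surj_on[OF \<theta>] by (metis imageE)
    \<comment> \<open>As \<open>\<theta>\<close> is injective on \<open>ds\<close>, an update of
      \<open>f\<close> at \<open>\<theta> d\<close> changes the composite with
      \<open>\<theta>\<close> at \<open>d\<close> only.\<close>
    have e: "map (\<lambda>d'. (f(c := x)) (\<theta> d')) ds = map ((\<lambda>c. f (\<theta> c))(d := x)) ds" for x
      using \<theta> d by (auto simp: bij_betw_def dest: inj_onD)
    show "(\<lambda>x. pure ds (\<lambda>d'. (f(c := x)) (\<theta> d'))) \<in> mod_hom R M (power ds)"
      unfolding e by (rule conjunct2[OF ml[OF f\<theta>], rule_format, OF d(1)])
  qed
  then obtain h where "h \<in> mod_hom R (power cs) (power ds)"
    "\<And>f. range f \<subseteq> carrier M \<Longrightarrow> h (pure cs f) = pure ds (\<lambda>c. f (\<theta> c))"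
  proof (rule tensor_power_hom_exists[OF tensor_power_module cs])
    fix f g :: "'i \<Rightarrow> 'c" assume "\<And>c. c \<in> set cs \<Longrightarrow> f c = g c"
    then have e: "map (\<lambda>c. f (\<theta> c)) ds = map (\<lambda>c. g (\<theta> c)) ds"
      using \<theta> by (auto simp: bij_betw_def)
    show "pure ds (\<lambda>c. f (\<theta> c)) = pure ds (\<lambda>c. g (\<theta> c))"
      unfolding e ..
  qed (use that in auto)
  then show ?thesis
    using that by blast
qed

text \<open>The inverse is the reindexing along the inverse bijection. This covers both a change of
  the order of the factors and a relabelling of the components that index them.\<close>

lemma reindex_iso:
  fixes cs :: "'i list" and ds :: "'j list"
  assumes cs: "distinct cs" and ds: "distinct ds" and \<theta>: "bij_betw \<theta> (set ds) (set cs)"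
  obtains h where "h \<in> mod_hom R (power cs) (power ds)"
    "bij_betw h (carrier (power cs)) (carrier (power ds))"
    "\<And>f. range f \<subseteq> carrier M \<Longrightarrow> h (pure cs f) = pure ds (\<lambda>c. f (\<theta> c))"
proof -
  let ?\<eta> = "inv_into (set ds) \<theta>"
  obtain h where h: "h \<in> mod_hom R (power cs) (power ds)"
    "\<And>f. range f \<subseteq> carrier M \<Longrightarrow> h (pure cs f) = pure ds (\<lambda>c. f (\<theta> c))"
    by (rule reindex_hom[OF assms]) blast
  obtain k where k: "k \<in> mod_hom R (power ds) (power cs)"
    "\<And>f. range f \<subseteq> carrier M \<Longrightarrow> k (pure ds f) = pure cs (\<lambda>c. f (?\<eta> c))"
    by (rule reindex_hom[OF ds cs bij_betw_inv_into[OF \<theta>]]) blast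
  have rc: "range (\<lambda>c. f (\<theta> c)) \<subseteq> carrier M" if "range f \<subseteq> carrier M" for f :: "'i \<Rightarrow> 'c"
    using that by auto
  have rc': "range (\<lambda>c. f (?\<eta> c)) \<subseteq> carrier M" if "range f \<subseteq> carrier M" for f :: "'j \<Rightarrow> 'c"
    using that by auto
  have kh: "k (h X) = X" if X: "X \<in> carrier (power cs)" for X
  proof (rule tensor_power_hom_ext[OF tensor_power_module cs mod_hom_comp[OF h(1) k(1)] mod_hom_id _ X])
    fix f :: "'i \<Rightarrow> 'c" assume f: "range f \<subseteq> carrier M"
    have e: "map (\<lambda>c. f (\<theta> (?\<eta> c))) cs = map f cs"
      using bij_betw_inv_into_right[OF \<theta>] by auto
    show "k (h (pure cs f)) = pure cs f"
      unfolding h(2)[OF f] k(2)[OF rc[OF f]] e ..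
  qed
  have hk: "h (k X) = X" if X: "X \<in> carrier (power ds)" for X
  proof (rule tensor_power_hom_ext[OF tensor_power_module ds mod_hom_comp[OF k(1) h(1)] mod_hom_id _ X])
    fix f :: "'j \<Rightarrow> 'c" assume f: "range f \<subseteq> carrier M"
    have e: "map (\<lambda>c. f (?\<eta> (\<theta> c))) ds = map f ds"
      using bij_betw_inv_into_left[OF \<theta>] by auto
    show "h (k (pure ds f)) = pure ds f"
      unfolding k(2)[OF f] h(2)[OF rc'[OF f]] e ..
  qed
  show ?thesis
    using mod_hom_closed[OF h(1)] mod_hom_closed[OF k(1)] kh hk
    by (intro that[OF h(1) _ h(2)] bij_betw_byWitness[where f' = k]) auto
qed

text \<open>The additional factor \<open>z\<close> may stand anywhere in \<open>ds\<close>; indexing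
  by entries makes its position irrelevant. The inverse is the bilinear map that sends a tensor over
  \<open>cs\<close> and an element \<open>a\<close> to the tensor over \<open>ds\<close> with
  \<open>a\<close> inserted at \<open>z\<close>.\<close>

lemma adjoin_factor_iso:
  fixes cs ds :: "'i list"
  assumes cs: "distinct cs" and ds: "distinct ds" and set: "set ds = insert z (set cs)" and z: "z \<notin> set cs"
  obtains h where "h \<in> mod_hom R (power ds) (tensor R (power cs) M)"
    "bij_betw h (carrier (power ds)) (carrier (tensor R (power cs) M))"
    "\<And>f. range f \<subseteq> carrier M \<Longrightarrow> h (pure ds f) =
      pure_tensor R (power cs) M (pure cs f) (f z)"
proof -
  let ?C = "power cs" and ?D = "power ds"
  interpret CM: two_modules R ?C M
    by (intro two_modules.intro tensor_power_module module_axioms)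
  note mlc = pure_power_multilinear[OF cs, unfolded multilinear_def, rule_format]
  note mld = pure_power_multilinear[OF ds, unfolded multilinear_def, rule_format]
  have zmap: "map (f(z := x)) cs = map f cs" for f :: "'i \<Rightarrow> 'c" and x
    using z by auto
  have upd: "range (f(z := x)) \<subseteq> carrier M" if "range f \<subseteq> carrier M" "x \<in> carrier M" for f :: "'i \<Rightarrow> 'c" and x
    using that by auto
  have "multilinear R M (set ds) (tensor R ?C M) (\<lambda>f. pure_tensor R ?C M (pure cs f) (f z))"
    unfolding multilinear_def
  proof (intro allI impI conjI ballI)
    fix f :: "'i \<Rightarrow> 'c" and c assume f: "range f \<subseteq> carrier M"
    then have fz: "f z \<in> carrier M"
      by auto
    note pf = pure_power_closed[OF f, of cs]
    show "pure_tensor R ?C M (pure cs f) (f z) \<in> carrier (tensor R ?C M)"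
      by (rule CM.pure_tensor_closed[OF pf fz])
    assume c: "c \<in> set ds"
    show "(\<lambda>x. pure_tensor R ?C M (pure cs (f(c := x))) ((f(c := x)) z)) \<in> mod_hom R M (tensor R ?C M)"
    proof (cases "c = z")
      case True
      show ?thesis
        unfolding True zmap using CM.pure_tensor_hom_right[OF pf] by simp
    next
      case False
      then have "c \<in> set cs"
        using c set by auto
      then show ?thesis
        using False mod_hom_comp[OF conjunct2[OF mlc[OF f], rule_format] CM.pure_tensor_hom_left[OF fz]] by simp
    qed
  qed
  then obtain h where h: "h \<in> mod_hom R ?D (tensor R ?C M)"
    "\<And>f. range f \<subseteq> carrier M \<Longrightarrow> h (pure ds f) =
      pure_tensor R ?C M (pure cs f) (f z)"
  proof (rule tensor_power_hom_exists[OF CM.tensor_module ds])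
    fix f g :: "'i \<Rightarrow> 'c" assume "\<And>c. c \<in> set ds \<Longrightarrow> f c = g c"
    then have e: "map f cs = map g cs" "f z = g z"
      using set by auto
    show "pure_tensor R ?C M (pure cs f) (f z) =
        pure_tensor R ?C M (pure_power R M (map g cs)) (g z)"
      unfolding e ..
  qed (use that in auto)
  \<comment> \<open>For fixed \<open>a\<close>, insertion of \<open>a\<close> at \<open>z\<close> is
    multilinear over \<open>cs\<close>, hence a homomorphism; its dependence on \<open>a\<close> is
    treated afterwards.\<close>
  have "\<exists>\<kappa>. \<kappa> \<in> mod_hom R ?C ?D \<and> (\<forall>f. range f \<subseteq> carrier M \<longrightarrow>
      \<kappa> (pure cs f) = pure ds (f(z := a)))" if a: "a \<in> carrier M" for a
  proof -
    have "multilinear R M (set cs) ?D (\<lambda>f. pure ds (f(z := a)))"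
      unfolding multilinear_def
    proof (intro allI impI conjI ballI)
      fix f :: "'i \<Rightarrow> 'c" and c assume f: "range f \<subseteq> carrier M"
      show "pure ds (f(z := a)) \<in> carrier ?D"
        by (rule pure_power_closed[OF upd[OF f a]])
      assume "c \<in> set cs"
      then have c: "c \<in> set ds" "c \<noteq> z"
        using set z by auto
      show "(\<lambda>x. pure ds (f(c := x, z := a))) \<in> mod_hom R M ?D"
        unfolding fun_upd_twist[OF c(2)] by (rule conjunct2[OF mld[OF upd[OF f a]], rule_format, OF c(1)])
    qed
    then show ?thesis
    proof (rule tensor_power_hom_exists[OF tensor_power_module cs])
      fix f g :: "'i \<Rightarrow> 'c" assume "\<And>c. c \<in> set cs \<Longrightarrow> f c = g c"
      then have e: "map (f(z := a)) ds = map (g(z := a)) ds"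
        using set by auto
      show "pure ds (f(z := a)) = pure ds (g(z := a))"
        unfolding e ..
    qed blast
  qed
  then obtain \<kappa> where \<kappa>: "\<And>a. a \<in> carrier M \<Longrightarrow> \<kappa> a \<in> mod_hom R ?C ?D"
    "\<And>a f. a \<in> carrier M \<Longrightarrow> range f \<subseteq> carrier M \<Longrightarrow>
      \<kappa> a (pure cs f) = pure ds (f(z := a))"
    by metis
  \<comment> \<open>Linearity in \<open>a\<close> is an identity between homomorphisms, so it can be
    tested on pure tensors, where it is linearity in the factor \<open>z\<close>.\<close>
  have "bilinear R ?C M ?D (\<lambda>X a. \<kappa> a X)"
    unfolding bilinear_def
  proof (intro conjI ballI)
    fix X assume X: "X \<in> carrier ?C"
    have zd: "z \<in> set ds"
      using set by simp
    show "(\<lambda>a. \<kappa> a X) \<in> mod_hom R M ?D"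
    proof (rule mod_homI)
      fix a assume a: "a \<in> carrier M"
      show "\<kappa> a X \<in> carrier ?D"
        by (rule mod_hom_closed[OF \<kappa>(1)[OF a] X])
      fix b assume b: "b \<in> carrier M"
      show "\<kappa> (a \<oplus>\<^bsub>M\<^esub> b) X = \<kappa> a X \<oplus>\<^bsub>?D\<^esub> \<kappa> b X"
      proof (rule tensor_power_hom_ext[OF tensor_power_module cs \<kappa>(1)[OF M.a_closed[OF a b]]
            mod_hom_add_map[OF tensor_power_module \<kappa>(1)[OF a] \<kappa>(1)[OF b]] _ X])
        fix f :: "'i \<Rightarrow> 'c" assume f: "range f \<subseteq> carrier M"
        show "\<kappa> (a \<oplus>\<^bsub>M\<^esub> b) (pure cs f) =
            \<kappa> a (pure cs f) \<oplus>\<^bsub>?D\<^esub> \<kappa> b (pure cs f)"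
          unfolding \<kappa>(2)[OF M.a_closed[OF a b] f] \<kappa>(2)[OF a f] \<kappa>(2)[OF b f]
          by (rule mod_hom_add[OF conjunct2[OF mld[OF f], rule_format, OF zd] a b])
      qed
    next
      fix r a assume r: "r \<in> carrier R" and a: "a \<in> carrier M"
      show "\<kappa> (r \<odot>\<^bsub>M\<^esub> a) X = r \<odot>\<^bsub>?D\<^esub> \<kappa> a X"
      proof (rule tensor_power_hom_ext[OF tensor_power_module cs \<kappa>(1)[OF smult_closed[OF r a]]
            mod_hom_smult_map[OF tensor_power_module \<kappa>(1)[OF a] r] _ X])
        fix f :: "'i \<Rightarrow> 'c" assume f: "range f \<subseteq> carrier M"
        show "\<kappa> (r \<odot>\<^bsub>M\<^esub> a) (pure cs f) = r \<odot>\<^bsub>?D\<^esub> \<kappa> a (pure cs f)"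
          unfolding \<kappa>(2)[OF smult_closed[OF r a] f] \<kappa>(2)[OF a f]
          by (rule mod_hom_smult[OF conjunct2[OF mld[OF f], rule_format, OF zd] r a])
      qed
    qed
  qed (rule \<kappa>(1))
  note k = CM.tensor_hom[OF tensor_power_module this]
  define k where "k X = the_elem (lin_ext R ?D (\<lambda>(X, a). \<kappa> a X) ` X)" for X
  note k = k[folded k_def]
  have kh: "k (h X) = X" if X: "X \<in> carrier ?D" for X
  proof (rule tensor_power_hom_ext[OF tensor_power_module ds mod_hom_comp[OF h(1) k(1)] mod_hom_id _ X])
    fix f :: "'i \<Rightarrow> 'c" assume f: "range f \<subseteq> carrier M"
    then have fz: "f z \<in> carrier M"
      by auto
    show "k (h (pure ds f)) = pure ds f"
      unfolding h(2)[OF f] k(2)[OF pure_power_closed[OF f] fz] \<kappa>(2)[OF fz f] fun_upd_triv ..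
  qed
  have h\<kappa>: "h (\<kappa> a X) = pure_tensor R ?C M X a" if X: "X \<in> carrier ?C" and a: "a \<in> carrier M" for X a
  proof (rule tensor_power_hom_ext[OF CM.tensor_module cs mod_hom_comp[OF \<kappa>(1)[OF a] h(1)]
        CM.pure_tensor_hom_left[OF a] _ X])
    fix f :: "'i \<Rightarrow> 'c" assume f: "range f \<subseteq> carrier M"
    show "h (\<kappa> a (pure cs f)) = pure_tensor R ?C M (pure cs f) a"
      unfolding \<kappa>(2)[OF a f] h(2)[OF upd[OF f a]] zmap fun_upd_same ..
  qed
  have hk: "h (k X) = X" if X: "X \<in> carrier (tensor R ?C M)" for X
    by (rule CM.tensor_hom_ext[OF CM.tensor_module mod_hom_comp[OF k(1) h(1)] mod_hom_id _ X])
      (simp add: k(2) h\<kappa>)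
  show ?thesis
    using mod_hom_closed[OF h(1)] mod_hom_closed[OF k(1)] kh hk
    by (intro that[OF h(1) _ h(2)] bij_betw_byWitness[where f' = k]) auto
qed

end

text \<open>The two factors \<open>s\<close> and \<open>t\<close> feed the one factor
  \<open>m\<close>, so linearity in each is that of right and of left multiplication in
  \<open>A\<close>. They are separate cases because \<open>A\<close> need not be
  commutative.\<close>

lemma merge_multilinear:
  fixes A :: "('r, 'b, 'm) module_scheme" and ds :: "'i list"
  assumes "assoc_algebra R A" and ds: "distinct ds"
    and st: "s \<in> S" "t \<in> S" "s \<noteq> t" "m \<notin> S" and set: "set ds = insert m (S - {s, t})"
  shows "multilinear R A S (tensor_power R A (length ds))
    (\<lambda>f. pure_power R A (map (\<lambda>c. if c = m then f s \<otimes>\<^bsub>A\<^esub> f t else f c) ds))"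
  unfolding multilinear_def
proof (intro allI impI conjI ballI)
  interpret A: assoc_algebra R A by fact
  note mld = A.pure_power_multilinear[OF ds, unfolded multilinear_def, rule_format]
  let ?D = "tensor_power R A (length ds)"
  fix f :: "'i \<Rightarrow> 'b" and c assume f: "range f \<subseteq> carrier A"
  then have fc: "f c \<in> carrier A" for c
    by auto
  let ?g = "\<lambda>f c. if c = m then f s \<otimes>\<^bsub>A\<^esub> f t else f c"
  have g: "range (?g f) \<subseteq> carrier A"
    using fc by auto
  show "pure_power R A (map (?g f) ds) \<in> carrier ?D"
    by (rule A.pure_power_closed[OF g])
  assume c: "c \<in> S"
  have mm: "m \<in> set ds"
    using set by simp
  consider "c = s" | "c = t" | "c \<noteq> s" "c \<noteq> t" by blast
  then show "(\<lambda>x. pure_power R A (map (?g (f(c := x))) ds)) \<in> mod_hom R A ?D"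
  proof cases
    case 1
    have e: "map (?g (f(c := x))) ds = map (f(m := x \<otimes>\<^bsub>A\<^esub> f t)) ds" for x
      using 1 st set by auto
    have h: "(\<lambda>x. x \<otimes>\<^bsub>A\<^esub> f t) \<in> mod_hom R A A"
      using fc by (intro mod_homI) (auto simp: A.l_distr A.smult_mult_left)
    show ?thesis
      unfolding e by (rule mod_hom_comp[OF h conjunct2[OF mld[OF f], rule_format, OF mm]])
  next
    case 2
    have e: "map (?g (f(c := x))) ds = map (f(m := f s \<otimes>\<^bsub>A\<^esub> x)) ds" for x
      using 2 st set by auto
    have h: "(\<lambda>x. f s \<otimes>\<^bsub>A\<^esub> x) \<in> mod_hom R A A"
      using fc by (intro mod_homI) (auto simp: A.r_distr A.smult_mult_right)
    show ?thesis
      unfolding e by (rule mod_hom_comp[OF h conjunct2[OF mld[OF f], rule_format, OF mm]])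
  next
    case 3
    \<comment> \<open>As \<open>m \<notin> S\<close>, the update at \<open>c\<close> cannot
      overwrite the merged factor.\<close>
    have e: "map (?g (f(c := x))) ds = map ((?g f)(c := x)) ds" for x
      using 3 c st set by auto
    have "c \<in> set ds"
      using 3 c set by auto
    then show ?thesis
      unfolding e by (rule conjunct2[OF mld[OF g], rule_format])
  qed
qed

section \<open>Weak components and multipaths\<close>

text \<open>Components are described by the arcs alone: a vertex outside \<open>Field E\<close>
  forms a class of its own, so the same expression serves digraphs with different vertex
  sets.\<close>

definition weak_class :: "('v \<times> 'v) set \<Rightarrow> 'v \<Rightarrow> 'v set"
  where "weak_class E x = {y. (x, y) \<in> (E \<union> E\<inverse>)\<^sup>*}"

lemma weak_class_refl: "x \<in> weak_class E x"
  by (simp add: weak_class_def)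

lemma weak_class_sym: "y \<in> weak_class E x \<longleftrightarrow> x \<in> weak_class E y"
proof -
  have "sym ((E \<union> E\<inverse>)\<^sup>*)"
    by (intro sym_rtrancl) (auto simp: sym_def)
  then show ?thesis
    by (auto simp: weak_class_def dest: symD)
qed

lemma weak_class_trans: "y \<in> weak_class E x \<Longrightarrow> z \<in> weak_class E y \<Longrightarrow> z \<in> weak_class E x"
  by (auto simp: weak_class_def)

lemma weak_class_eq_iff: "weak_class E x = weak_class E y \<longleftrightarrow> y \<in> weak_class E x"
  using weak_class_refl weak_class_sym weak_class_trans by (metis subsetI subset_antisym)

lemma weak_class_disjoint: "weak_class E x \<noteq> weak_class E y \<Longrightarrow> weak_class E x \<inter> weak_class E y = {}"
  by (metis disjoint_iff weak_class_eq_iff)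

lemma weak_class_step: "(y, z) \<in> E \<Longrightarrow> y \<in> weak_class E x \<longleftrightarrow> z \<in> weak_class E x"
  unfolding weak_class_def mem_Collect_eq
  by (blast intro: rtrancl_into_rtrancl)

lemma weak_class_mono: "E \<subseteq> F \<Longrightarrow> weak_class E x \<subseteq> weak_class F x"
  unfolding weak_class_def using rtrancl_mono[of "E \<union> E\<inverse>" "F \<union> F\<inverse>"] by blast

lemma weak_class_closed:
  assumes "x \<in> S" "\<And>y z. (y, z) \<in> E \<Longrightarrow> y \<in> S \<longleftrightarrow> z \<in> S"
  shows "weak_class E x \<subseteq> S"
proof
  fix y assume "y \<in> weak_class E x"
  then have "(x, y) \<in> (E \<union> E\<inverse>)\<^sup>*"
    by (simp add: weak_class_def)
  then show "y \<in> S"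
    by induction (use assms in auto)
qed

lemma weak_class_insert:
  "weak_class (insert (s, t) E) x =
    (if x \<in> weak_class E s \<union> weak_class E t then weak_class E s \<union> weak_class E t else weak_class E x)"
proof (cases "x \<in> weak_class E s \<union> weak_class E t")
  case True
  let ?E = "insert (s, t) E"
  have st: "t \<in> weak_class ?E s"
    using weak_class_step[of s t ?E s] weak_class_refl by fast
  have sub: "weak_class E s \<subseteq> weak_class ?E s" "weak_class E t \<subseteq> weak_class ?E s"
    using weak_class_mono[of E ?E] st weak_class_eq_iff[of ?E s t] by blast+
  then have "weak_class ?E x = weak_class ?E s"
    using True weak_class_eq_iff[of ?E s x] by auto
  \<comment> \<open>The union of the two classes is closed under the arcs of \<open>E\<close> and
    under the new arc in both directions.\<close>
  moreover have "weak_class ?E s \<subseteq> weak_class E s \<union> weak_class E t"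
    by (rule weak_class_closed) (auto simp: weak_class_refl weak_class_step)
  ultimately show ?thesis
    using sub True by auto
next
  case False
  then have "s \<notin> weak_class E x" "t \<notin> weak_class E x"
    by (auto simp: weak_class_sym)
  then have "weak_class (insert (s, t) E) x \<subseteq> weak_class E x"
    by (intro weak_class_closed) (auto simp: weak_class_refl weak_class_step)
  then show ?thesis
    using False weak_class_mono[of E "insert (s, t) E" x] by auto
qed

lemma weak_class_not_Field: "x \<notin> Field E \<Longrightarrow> weak_class E x = {x}"
  using weak_class_closed[of x "{x}" E] weak_class_refl[of x E] by (auto simp: Field_def)

definition path_like :: "('v \<times> 'v) set \<Rightarrow> bool"
  where "path_like E \<longleftrightarrow> single_valued E \<and> single_valued (E\<inverse>) \<and> acyclic E"

lemma path_like_subset: "path_like F \<Longrightarrow> E \<subseteq> F \<Longrightarrow> path_like E"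
  unfolding path_like_def
  by (meson acyclic_subset converse_mono single_valued_subset)

lemma path_like_insert:
  assumes "path_like E" "s \<notin> Domain E" "t \<notin> Range E" "(t, s) \<notin> E\<^sup>*"
  shows "path_like (insert (s, t) E)"
  using assms by (auto simp: path_like_def single_valued_def)

lemma path_like_new_arc:
  assumes "path_like (insert (s, t) E)" "(s, t) \<notin> E"
  shows "s \<notin> Domain E" "t \<notin> Range E"
  using assms unfolding path_like_def single_valued_def by blast+

text \<open>If every vertex has at most one outgoing arc, the forward paths of two connected
  vertices meet. Along a zigzag from \<open>x\<close>, a forward step follows the only path towards
  the meeting point, or moves the meeting point if that has been reached; a backward step prolongs
  the path at its start.\<close>

lemma weak_class_meet:
  assumes "single_valued E" "y \<in> weak_class E x"
  shows "\<exists>z. (x, z) \<in> E\<^sup>* \<and> (y, z) \<in> E\<^sup>*"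
proof -
  from assms(2) have "(x, y) \<in> (E \<union> E\<inverse>)\<^sup>*"
    by (simp add: weak_class_def)
  then show ?thesis
  proof induction
    case base
    then show ?case by auto
  next
    case (step y y')
    then obtain z where z: "(x, z) \<in> E\<^sup>*" "(y, z) \<in> E\<^sup>*"
      by auto
    from step(2) consider "(y, y') \<in> E" | "(y', y) \<in> E"
      by auto
    then show ?case
    proof cases
      case 1
      show ?thesis
      proof (cases "y = z")
        case True
        then have "(x, y') \<in> E\<^sup>*"
          using z(1) 1 by auto
        then show ?thesis by auto
      next
        case False
        then obtain y'' where "(y, y'') \<in> E" "(y'', z) \<in> E\<^sup>*"
          using z(2) by (metis converse_rtranclE)
        then show ?thesis
          using single_valuedD[OF assms(1) 1] z(1) by blast
      qed
    next
      case 2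
      then show ?thesis
        using z by (meson converse_rtrancl_into_rtrancl)
    qed
  qed
qed

text \<open>The forward path of a sink is trivial, so the meeting point equals both sinks.\<close>

lemma weak_class_unique_sink:
  assumes "single_valued E" "s' \<in> weak_class E s" "s \<notin> Domain E" "s' \<notin> Domain E"
  shows "s = s'"
  using weak_class_meet[OF assms(1,2)] assms(3,4) by (metis DomainI converse_rtranclE)

lemma weak_class_converse: "weak_class (E\<inverse>) x = weak_class E x"
  by (simp add: weak_class_def Un_commute)

lemma weak_class_unique_source:
  assumes "single_valued (E\<inverse>)" "t' \<in> weak_class E t" "t \<notin> Range E" "t' \<notin> Range E"
  shows "t = t'"
  using weak_class_unique_sink[of "E\<inverse>" t' t] assms by (simp add: weak_class_converse)

text \<open>If \<open>s\<close> and \<open>t\<close> were connected, their forward paths would meet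
  in the sink \<open>s\<close>; then \<open>t\<close> leads to \<open>s\<close> and the new arc
  closes a cycle. This guarantees that \<open>\<mu>\<close> always multiplies the entries of two
  different components.\<close>

lemma path_like_new_arc_merges:
  assumes "path_like (insert (s, t) E)" "(s, t) \<notin> E"
  shows "weak_class E s \<noteq> weak_class E t"
proof
  assume "weak_class E s = weak_class E t"
  then have t: "t \<in> weak_class E s"
    by (simp add: weak_class_eq_iff)
  have "path_like E"
    using assms(1) by (rule path_like_subset) auto
  then obtain z where z: "(s, z) \<in> E\<^sup>*" "(t, z) \<in> E\<^sup>*"
    using weak_class_meet[OF _ t] by (auto simp: path_like_def)
  then have "(t, s) \<in> E\<^sup>*"
    using path_like_new_arc(1)[OF assms] by (metis DomainI converse_rtranclE)
  then show False
    using assms(1) by (auto simp: path_like_def)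
qed

subsection \<open>Path-like relations and paths\<close>

lemma vwalk_arcs_subset: "set (vwalk_arcs vs) \<subseteq> set vs \<times> set vs"
  by (induction vs rule: vwalk_arcs.induct) auto

lemma path_like_vwalk_arcs:
  assumes "distinct vs"
  shows "path_like (set (vwalk_arcs vs))"
  using assms
proof (induction vs rule: vwalk_arcs.induct)
  case (3 x y xs)
  let ?E = "set (vwalk_arcs (y # xs))"
  have sub: "?E \<subseteq> set (y # xs) \<times> set (y # xs)"
    by (rule vwalk_arcs_subset)
  with 3 have x: "x \<notin> Domain ?E" "x \<notin> Range ?E" "x \<noteq> y"
    by auto
  then have "(y, x) \<notin> ?E\<^sup>*"
    by (metis RangeI rtranclE)
  moreover have "y \<notin> Range ?E"
  proof (cases xs)
    case (Cons z zs)
    then show ?thesis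
      using 3 vwalk_arcs_subset[of "z # zs"] by auto
  qed simp
  ultimately have "path_like (insert (x, y) ?E)"
    using 3 x by (intro path_like_insert) auto
  then show ?case by simp
qed (auto simp: path_like_def acyclic_def)

lemma vwalk_arcs_Domain: "v \<in> set vs \<Longrightarrow> v \<noteq> last vs \<Longrightarrow> v \<in> Domain (set (vwalk_arcs vs))"
  by (induction vs rule: vwalk_arcs.induct) auto

lemma vwalk_arcs_Range: "v \<in> set vs \<Longrightarrow> v \<noteq> hd vs \<Longrightarrow> v \<in> Range (set (vwalk_arcs vs))"
  by (induction vs rule: vwalk_arcs.induct) auto

definition traverses :: "('v \<times> 'v) set \<Rightarrow> 'v set \<Rightarrow> 'v list \<Rightarrow> bool"
  where "traverses E c vs \<longleftrightarrow>
    vs \<noteq> [] \<and> distinct vs \<and> set vs = c \<and> set (vwalk_arcs vs) = E \<inter> c \<times> c"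

text \<open>Induction on the arcs: the new arc starts at the sink that ends one path and leads to
  the source that begins another, so the two vertex lists are concatenated.\<close>

lemma path_like_traversable:
  assumes "finite E" "path_like E"
  shows "\<exists>vs. traverses E (weak_class E x) vs"
  using assms
proof (induction E arbitrary: x rule: finite_induct)
  case empty
  then show ?case
    by (intro exI[of _ "[x]"]) (simp add: traverses_def weak_class_not_Field)
next
  case (insert e E)
  obtain s t where e: "e = (s, t)"
    by (cases e)
  let ?E = "insert (s, t) E"
  have pl: "path_like ?E" and st: "(s, t) \<notin> E"
    using insert e by auto
  have "path_like E"
    using pl by (rule path_like_subset) auto
  note IH = insert.IH[OF this]
  show ?case
  proof (cases "x \<in> weak_class E s \<union> weak_class E t")
    case True
    obtain vs ws where vs: "traverses E (weak_class E s) vs" and ws: "traverses E (weak_class E t) ws"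
      using IH by blast
    have ne: "vs \<noteq> []" "ws \<noteq> []"
      using vs ws by (auto simp: traverses_def)
    \<comment> \<open>Every vertex of the list except the last has an outgoing arc in
      \<open>E\<close>, and \<open>s\<close> has none; dually for \<open>t\<close> and the first
      vertex of \<open>ws\<close>.\<close>
    have "last vs = s"
      using vwalk_arcs_Domain[of s vs] vs path_like_new_arc(1)[OF pl st] weak_class_refl[of s E]
      by (auto simp: traverses_def)
    moreover have "hd ws = t"
      using vwalk_arcs_Range[of t ws] ws path_like_new_arc(2)[OF pl st] weak_class_refl[of t E]
      by (auto simp: traverses_def)
    ultimately have "set (vwalk_arcs (vs @ ws)) =
        insert (s, t) (E \<inter> weak_class E s \<times> weak_class E s \<union> E \<inter> weak_class E t \<times> weak_class E t)"
      using vs ws by (auto simp: vwalk_arcs_append[OF ne] traverses_def)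
    also have "\<dots> = ?E \<inter> (weak_class E s \<union> weak_class E t) \<times> (weak_class E s \<union> weak_class E t)"
      by (auto simp: weak_class_refl weak_class_step)
    finally have "traverses ?E (weak_class E s \<union> weak_class E t) (vs @ ws)"
      using vs ws weak_class_disjoint[OF path_like_new_arc_merges[OF pl st]]
      by (auto simp: traverses_def)
    then show ?thesis
      using True by (auto simp: e weak_class_insert)
  next
    case False
    then have "s \<notin> weak_class E x"
      by (auto simp: weak_class_sym)
    then have "?E \<inter> weak_class E x \<times> weak_class E x = E \<inter> weak_class E x \<times> weak_class E x"
      by auto
    then show ?thesis
      using IH[of x] False by (auto simp: e weak_class_insert traverses_def)
  qed
qed

text \<open>Arcs that share an endpoint lie in the same class, and so does a whole cycle. Hence each
  of the three conditions can be tested inside one class, where the arcs are those of a path without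
  repeated vertices.\<close>

lemma traversable_path_like:
  assumes "\<And>x. x \<in> Domain E \<Longrightarrow> \<exists>vs. traverses E (weak_class E x) vs"
  shows "path_like E"
proof -
  have pl: "path_like (E \<inter> weak_class E x \<times> weak_class E x)" if x: "x \<in> Domain E" for x
  proof -
    obtain vs where "traverses E (weak_class E x) vs"
      using assms[OF x] by blast
    then show ?thesis
      using path_like_vwalk_arcs[of vs] by (simp add: traverses_def)
  qed
  have arc: "y \<in> weak_class E x" if "(x, y) \<in> E" for x y
    using weak_class_step[OF that, of x] weak_class_refl[of x E] by simp
  have "single_valued E"
  proof (rule single_valuedI)
    fix x y z assume a: "(x, y) \<in> E" "(x, z) \<in> E"
    then show "y = z"
      using pl[of x] arc[of x] weak_class_refl[of x E]
      by (fastforce simp: path_like_def single_valued_def)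
  qed
  moreover have "single_valued (E\<inverse>)"
  proof (rule single_valuedI)
    fix x y z assume a: "(x, y) \<in> E\<inverse>" "(x, z) \<in> E\<inverse>"
    then have "y \<in> weak_class E y" "x \<in> weak_class E y" "z \<in> weak_class E y"
      using arc[of y x] weak_class_step[of z x E y] weak_class_refl[of y E] by auto
    moreover have "single_valued ((E \<inter> weak_class E y \<times> weak_class E y)\<inverse>)"
      using pl[of y] a by (auto simp: path_like_def)
    ultimately show "y = z"
      using a by (auto simp: single_valued_def)
  qed
  moreover have "acyclic E"
    unfolding acyclic_def
  proof (intro allI notI)
    fix x assume xx: "(x, x) \<in> E\<^sup>+"
    have "(x, y) \<in> (E \<inter> weak_class E x \<times> weak_class E x)\<^sup>+ \<and> y \<in> weak_class E x" if "(x, y) \<in> E\<^sup>+" for y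
      using that
    proof induction
      case (base y)
      then show ?case
        using arc[of x y] weak_class_refl[of x E] by auto
    next
      case (step y z)
      then have "z \<in> weak_class E x"
        using weak_class_step[of y z E x] by simp
      with step show ?case
        by (auto intro: trancl_into_trancl)
    qed
    moreover have "x \<in> Domain E"
      using xx by (meson Domain.DomainI tranclD)
    ultimately show False
      using xx pl[of x] by (auto simp: path_like_def acyclic_def)
  qed
  ultimately show ?thesis
    by (simp add: path_like_def)
qed

text \<open>In a symmetric relation mutual reachability is reachability. The paths of the digraph
  are confined to its vertices, which is automatic here because all arcs have their endpoints
  there.\<close>

lemma component_of_eq:
  assumes "parcs H \<subseteq> pverts H \<times> pverts H" "x \<in> pverts H"
  shows "component_of H x = weak_class (parcs H) x"
proof -
  let ?S = "with_proj (mk_symmetric (with_proj H))"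
  have ends: "arcs_ends ?S = parcs H \<union> (parcs H)\<inverse>"
    by (auto simp: parcs_mk_symmetric)
  have r: "pre_digraph.scc_of ?S x = {y. (x, y) \<in> rtrancl_on (pverts H) (parcs H \<union> (parcs H)\<inverse>) \<and>
      (y, x) \<in> rtrancl_on (pverts H) (parcs H \<union> (parcs H)\<inverse>)}"
    unfolding pre_digraph.scc_of_def reachable_def ends by simp
  have on: "(y, z) \<in> rtrancl_on (pverts H) (parcs H \<union> (parcs H)\<inverse>) \<longleftrightarrow> z \<in> weak_class (parcs H) y"
    if "y \<in> pverts H" for y z
  proof
    assume "(y, z) \<in> rtrancl_on (pverts H) (parcs H \<union> (parcs H)\<inverse>)"
    then show "z \<in> weak_class (parcs H) y"
      unfolding weak_class_def by (auto intro: rtrancl_on_rtranclI)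
  next
    assume "z \<in> weak_class (parcs H) y"
    then have "(y, z) \<in> (parcs H \<union> (parcs H)\<inverse>)\<^sup>*"
      by (simp add: weak_class_def)
    then show "(y, z) \<in> rtrancl_on (pverts H) (parcs H \<union> (parcs H)\<inverse>)"
    proof induction
      case (step z z')
      from step(2) have "z' \<in> pverts H"
        using assms(1) by blast
      then show ?case
        by (rule rtrancl_on_into_rtrancl_on[OF step(3,2)])
    qed (use that in simp)
  qed
  have sub: "weak_class (parcs H) x \<subseteq> pverts H"
    by (rule weak_class_closed) (use assms in auto)
  show ?thesis
    unfolding component_of_def r
  proof (intro equalityI subsetI CollectI conjI)
    fix y assume y: "y \<in> weak_class (parcs H) x"
    show "(x, y) \<in> rtrancl_on (pverts H) (parcs H \<union> (parcs H)\<inverse>)"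
      unfolding on[OF assms(2)] by (rule y)
    have yV: "y \<in> pverts H"
      using y sub by blast
    show "(y, x) \<in> rtrancl_on (pverts H) (parcs H \<union> (parcs H)\<inverse>)"
      unfolding on[OF yV] by (rule weak_class_sym[THEN iffD1, OF y])
  qed (use on[OF assms(2)] in blast)
qed

lemma components_eq:
  assumes "parcs H \<subseteq> pverts H \<times> pverts H"
  shows "components H = weak_class (parcs H) ` pverts H"
  unfolding components_def using component_of_eq[OF assms] by auto

text \<open>An arc walk and its list of vertices determine each other, by \<open>vwalk_arcs\<close>
  and \<open>pawalk_verts\<close>; the list form is easier to concatenate.\<close>

lemma path_component_iff:
  assumes "parcs H \<subseteq> pverts H \<times> pverts H" "c \<subseteq> pverts H"
  shows "path_component H c \<longleftrightarrow> (\<exists>vs. traverses (parcs H) c vs)"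
proof
  have arcs: "arcs (with_proj H \<restriction> c) = parcs H \<inter> c \<times> c"
    by (auto simp: induce_subgraph_def)
  have verts: "verts (with_proj H \<restriction> c) = c"
    by (simp add: induce_subgraph_def)
  have 1: "vwalk_arcs (pawalk_verts x p) = p" "pawalk_verts x p \<noteq> []" if "pcas x p y" for x p and y :: 'a
    using that
  proof (induction p arbitrary: x)
    case (Cons e p)
    {
      case 1
      then have "vwalk_arcs (pawalk_verts (snd e) p) = p"
        using Cons by simp
      moreover have "pawalk_verts (snd e) p = snd e # tl (pawalk_verts (snd e) p)"
        using 1 by (cases p) auto
      ultimately show ?case
        by (metis pawalk_verts.simps(2) prod.collapse vwalk_arcs.simps(3))
    next
      case 2
      then show ?case by simp
    }
  qed auto
  have 2: "pcas (hd vs) (vwalk_arcs vs) (last vs) \<and> pawalk_verts (hd vs) (vwalk_arcs vs) = vs"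
    if "vs \<noteq> []" for vs :: "'a list"
    using that by (induction vs rule: vwalk_arcs.induct) auto
  {
    assume "path_component H c"
    then obtain x p y where p: "pre_digraph.apath (with_proj H) x p y"
      "set (pawalk_verts x p) = c" "set p = parcs H \<inter> c \<times> c"
      unfolding path_component_def arcs verts awalk_verts_with_proj_eq by blast
    then have "pcas x p y" "distinct (pawalk_verts x p)"
      by (auto simp: pre_digraph.apath_def pre_digraph.awalk_def cas_with_proj_eq awalk_verts_with_proj_eq)
    then have "traverses (parcs H) c (pawalk_verts x p)"
      using p 1 by (auto simp: traverses_def)
    then show "\<exists>vs. traverses (parcs H) c vs" by blast
  next
    assume "\<exists>vs. traverses (parcs H) c vs"
    then obtain vs where vs: "traverses (parcs H) c vs" by blast
    then have "hd vs \<in> c"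
      using hd_in_set[of vs] unfolding traverses_def by blast
    then have "pre_digraph.apath (with_proj H) (hd vs) (vwalk_arcs vs) (last vs)"
      using vs 2[of vs] assms(2)
      by (auto simp: pre_digraph.apath_def pre_digraph.awalk_def cas_with_proj_eq
          awalk_verts_with_proj_eq traverses_def)
    then show "path_component H c"
      unfolding path_component_def arcs verts awalk_verts_with_proj_eq
      using vs 2[of vs] by (intro exI[of _ "hd vs"] exI[of _ "vwalk_arcs vs"] exI[of _ "last vs"])
        (simp add: traverses_def)
  }
qed

lemma mem_multipaths_iff:
  assumes "pair_digraph G"
  shows "H \<in> multipaths G \<longleftrightarrow> pverts H = pverts G \<and> parcs H \<subseteq> parcs G \<and> path_like (parcs H)"
proof -
  interpret G: pair_digraph G by fact
  have wfG: "parcs G \<subseteq> pverts G \<times> pverts G"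
    using G.arc_fst_in_verts G.arc_snd_in_verts by force
  have sp: "spanning (with_proj H) (with_proj G) \<longleftrightarrow> pverts H = pverts G \<and> parcs H \<subseteq> parcs G"
  proof
    assume *: "pverts H = pverts G \<and> parcs H \<subseteq> parcs G"
    then have "wf_digraph (with_proj H)"
      using wfG by (auto simp: wf_digraph_def)
    moreover have "wf_digraph (with_proj G)" ..
    ultimately show "spanning (with_proj H) (with_proj G)"
      using * by (auto simp: spanning_def subgraph_def compatible_def)
  qed (auto simp: spanning_def subgraph_def)
  show ?thesis
  proof (cases "pverts H = pverts G \<and> parcs H \<subseteq> parcs G")
    case True
    then have wf: "parcs H \<subseteq> pverts H \<times> pverts H" and fin: "finite (parcs H)"
      using wfG finite_subset[OF _ G.pair_finite_arcs] by auto
    have cl: "weak_class (parcs H) x \<subseteq> pverts H" if "x \<in> pverts H" for x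
      by (rule weak_class_closed) (use that wf in auto)
    have "(\<forall>c\<in>components H. path_component H c) \<longleftrightarrow>
        (\<forall>x\<in>pverts H. \<exists>vs. traverses (parcs H) (weak_class (parcs H) x) vs)"
      unfolding components_eq[OF wf] using path_component_iff[OF wf cl] by auto
    also have "\<dots> \<longleftrightarrow> path_like (parcs H)"
    proof
      assume *: "\<forall>x\<in>pverts H. \<exists>vs. traverses (parcs H) (weak_class (parcs H) x) vs"
      show "path_like (parcs H)"
        by (rule traversable_path_like) (use * wf in auto)
    qed (use path_like_traversable[OF fin] in blast)
    finally show ?thesis
      using True by (simp add: multipaths_def sp)
  qed (auto simp: multipaths_def sp)
qed

section \<open>Ordered lists of components\<close>

lemma finite_total_has_minimum:
  assumes "finite S" "S \<noteq> {}" "\<And>a b. a \<in> S \<Longrightarrow> b \<in> S \<Longrightarrow> P a b \<or> P b a"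
    and "\<And>a b c. a \<in> S \<Longrightarrow> b \<in> S \<Longrightarrow> c \<in> S \<Longrightarrow> P a b \<Longrightarrow> P b c \<Longrightarrow> P a c"
  shows "\<exists>m\<in>S. \<forall>a\<in>S. P m a"
proof -
  have "finite T \<Longrightarrow> T \<noteq> {} \<Longrightarrow> T \<subseteq> S \<Longrightarrow> \<exists>m\<in>T. \<forall>a\<in>T. P m a" for T
  proof (induction T rule: finite_ne_induct)
    case (singleton x)
    then show ?case using assms(3) by blast
  next
    case (insert x T)
    then obtain m where m: "m \<in> T" "\<forall>a\<in>T. P m a"
      by auto
    then have "P m x \<or> P x m" "P x x"
      using assms(3)[of m x] assms(3)[of x x] insert by auto
    then show ?case
      using m assms(4)[of x m] insert by (metis insert_iff subset_iff)
  qed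
  then show ?thesis
    using assms(1,2) by blast
qed

text \<open>This gives the \<open>THE\<close> in \<open>component_list\<close> its meaning.
  \<open>P\<close> is an order on \<open>S\<close> only, since components are compared through their
  minimal vertices.\<close>

lemma ex1_sorted_wrt_list:
  assumes "finite S" "\<And>a b. a \<in> S \<Longrightarrow> b \<in> S \<Longrightarrow> P a b \<or> P b a"
    and "\<And>a b c. a \<in> S \<Longrightarrow> b \<in> S \<Longrightarrow> c \<in> S \<Longrightarrow> P a b \<Longrightarrow> P b c \<Longrightarrow> P a c"
    and "\<And>a b. a \<in> S \<Longrightarrow> b \<in> S \<Longrightarrow> P a b \<Longrightarrow> P b a \<Longrightarrow> a = b"
  shows "\<exists>!xs. distinct xs \<and> set xs = S \<and> sorted_wrt P xs"
  using assms
proof (induction "card S" arbitrary: S)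
  case 0
  have "S = {}"
    using "0.hyps" "0.prems"(1) by simp
  then show ?case by (intro ex1I[of _ "[]"]) auto
next
  case (Suc n)
  have "S \<noteq> {}"
    using Suc.hyps(2) by auto
  from finite_total_has_minimum[OF Suc.prems(1) this Suc.prems(2,3)]
  obtain m where m: "m \<in> S" "\<forall>a\<in>S. P m a" by (rule bexE)
  have "n = card (S - {m})"
    using Suc.hyps(2) Suc.prems(1) m(1) by simp
  then have IH: "\<exists>!xs. distinct xs \<and> set xs = S - {m} \<and> sorted_wrt P xs"
  proof (rule Suc.hyps(1))
    show "finite (S - {m})"
      using Suc.prems(1) by simp
  qed (use Suc.prems(2-4) in blast)+
  then obtain ys where ys: "distinct ys" "set ys = S - {m}" "sorted_wrt P ys"
    by blast
  show ?case
  proof (rule ex1I[of _ "m # ys"])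
    show "distinct (m # ys) \<and> set (m # ys) = S \<and> sorted_wrt P (m # ys)"
      using ys m by auto
  next
    fix xs assume xs: "distinct xs \<and> set xs = S \<and> sorted_wrt P xs"
    with m(1) obtain z zs where z: "xs = z # zs"
      by (cases xs) auto
    \<comment> \<open>The head of a sorted list lies below all other entries and the minimum lies
      below the head, so antisymmetry identifies them.\<close>
    have "z = m"
    proof (rule ccontr)
      assume "z \<noteq> m"
      then have "m \<in> set zs" "z \<in> S"
        using xs z m(1) by auto
      then show False
        using xs z m Suc.prems(4)[of m z] \<open>z \<noteq> m\<close> by auto
    qed
    then have "distinct zs \<and> set zs = S - {m} \<and> sorted_wrt P zs"
      using xs z by auto
    then show "xs = m # ys"
      using IH ys z \<open>z = m\<close> by auto
  qed
qed

text \<open>Distinctness and the set of entries are what is needed to index the tensor factors by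
  the components themselves.\<close>

lemma component_list:
  assumes "finite (pverts H)" "parcs H \<subseteq> pverts H \<times> pverts H" "linear_order_on (pverts H) rV"
  shows "distinct (component_list rV H)" "set (component_list rV H) = components H"
proof -
  have tot: "(x, y) \<in> rV \<or> (y, x) \<in> rV" if "x \<in> pverts H" "y \<in> pverts H" for x y
    using assms(3) that
    by (cases "x = y") (auto simp: linear_order_on_def partial_order_on_def preorder_on_def
        total_on_def dest: refl_onD)
  have tr: "trans rV" and as: "antisym rV"
    using assms(3) by (auto simp: linear_order_on_def partial_order_on_def preorder_on_def)
  have cl: "weak_class (parcs H) x \<subseteq> pverts H" if "x \<in> pverts H" for x
    by (rule weak_class_closed) (use that assms(2) in auto)
  have mv: "min_vertex rV c \<in> c" if "c \<in> components H" for c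
  proof -
    from that obtain x where c: "x \<in> pverts H" "c = weak_class (parcs H) x"
      by (auto simp: components_eq[OF assms(2)])
    have fin: "finite c" "c \<subseteq> pverts H" "c \<noteq> {}"
      using cl[OF c(1)] assms(1) finite_subset c weak_class_refl[of x "parcs H"] by auto
    have "\<exists>m\<in>c. \<forall>y\<in>c. (m, y) \<in> rV"
      by (rule finite_total_has_minimum[OF fin(1,3)]) (use fin(2) tot transD[OF tr] in blast)+
    then obtain m where m: "m \<in> c \<and> (\<forall>y\<in>c. (m, y) \<in> rV)"
      by blast
    moreover have "m' = m" if "m' \<in> c \<and> (\<forall>y\<in>c. (m', y) \<in> rV)" for m'
      using m that antisymD[OF as] by blast
    ultimately show ?thesis
      using theI[of "\<lambda>x. x \<in> c \<and> (\<forall>y\<in>c. (x, y) \<in> rV)" m] unfolding min_vertex_def by blast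
  qed
  \<comment> \<open>Components are disjoint, so a common minimal vertex forces equality; this makes
    the comparison of components antisymmetric.\<close>
  have inj: "c = d" if "c \<in> components H" "d \<in> components H" "min_vertex rV c = min_vertex rV d" for c d
  proof -
    from that obtain x y where "c = weak_class (parcs H) x" "d = weak_class (parcs H) y"
      by (auto simp: components_eq[OF assms(2)])
    then show ?thesis
      using weak_class_disjoint[of "parcs H" x y] mv[OF that(1)] mv[OF that(2)] that(3) by auto
  qed
  have mvV: "min_vertex rV c \<in> pverts H" if "c \<in> components H" for c
    using mv[OF that] that cl by (auto simp: components_eq[OF assms(2)])
  have "\<exists>!cs. distinct cs \<and> set cs = components H \<and>
       sorted_wrt (\<lambda>c d. (min_vertex rV c, min_vertex rV d) \<in> rV) cs"
  proof (rule ex1_sorted_wrt_list)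
    show "finite (components H)"
      using assms(1) by (simp add: components_def)
    show "c = d" if "c \<in> components H" "d \<in> components H"
      "(min_vertex rV c, min_vertex rV d) \<in> rV" "(min_vertex rV d, min_vertex rV c) \<in> rV" for c d
      using inj[OF that(1,2)] antisymD[OF as that(3,4)] by simp
  qed (use tot mvV transD[OF tr] in blast)+
  from theI'[OF this] show "distinct (component_list rV H)" "set (component_list rV H) = components H"
    unfolding component_list_def by auto
qed

lemma entry_map:
  assumes "distinct (component_list rV H)" "c \<in> set (component_list rV H)"
  shows "entry rV H (map f (component_list rV H)) c = f c"
proof -
  let ?cs = "component_list rV H"
  obtain i where i: "i < length ?cs" "?cs ! i = c"
    using assms(2) by (auto simp: in_set_conv_nth)
  have "(THE i. i < length ?cs \<and> ?cs ! i = c) = i"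
    using i assms(1) by (intro the_equality) (auto simp: nth_eq_iff_index_eq)
  then show ?thesis
    using i by (simp add: entry_def)
qed

section \<open>The multipath complex\<close>

text \<open>\<open>merge_entries\<close> as an operation on functions. Here \<open>c\<close> is a
  class after \<open>e\<close> has been added, and \<open>fst e \<in> c\<close> singles out the
  merged one.\<close>

definition merge_fun ::
  "('r, 'a, 'm) module_scheme \<Rightarrow> ('v \<times> 'v) set \<Rightarrow> 'v \<times> 'v \<Rightarrow> ('v set \<Rightarrow> 'a) \<Rightarrow> 'v set \<Rightarrow> 'a"
  where "merge_fun A E e f c =
    (if fst e \<in> c then f (weak_class E (fst e)) \<otimes>\<^bsub>A\<^esub> f (weak_class E (snd e)) else f c)"

text \<open>The path that the first arc leads to is the one that the second arc leaves, so three
  paths are concatenated. The factors are multiplied in the order of the paths, only bracketed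
  differently, and associativity suffices for a noncommutative \<open>A\<close>.\<close>

lemma merge_fun_merge_fun_chain:
  assumes "monoid A" "range f \<subseteq> carrier A"
    and c: "c = weak_class (insert (s, t) (insert (s', t') E)) x"
    and t: "weak_class E t = weak_class E s'"
    and ne: "weak_class E s \<noteq> weak_class E t" "weak_class E s \<noteq> weak_class E t'" "weak_class E t \<noteq> weak_class E t'"
  shows "merge_fun A (insert (s, t) E) (s', t') (merge_fun A E (s, t) f) c =
    merge_fun A (insert (s', t') E) (s, t) (merge_fun A E (s', t') f) c"
proof -
  let ?F = "insert (s, t) (insert (s', t') E)"
  interpret monoid A by fact
  have fc: "f d \<in> carrier A" for d
    using assms(2) by auto
  have mem: "s' \<in> weak_class E t" "t \<in> weak_class E s'" "s \<notin> weak_class E t'" "t' \<notin> weak_class E s"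
    "s \<notin> weak_class E t" "s \<notin> weak_class E s'" "s' \<notin> weak_class E s" "t' \<notin> weak_class E t"
    using t ne weak_class_eq_iff by metis+
  have "weak_class E s' \<subseteq> weak_class ?F s'"
    by (rule weak_class_mono) auto
  then have "t \<in> weak_class ?F s'"
    using mem(2) by auto
  moreover have "t \<in> weak_class ?F s"
    using weak_class_step[of s t ?F s] weak_class_refl[of s ?F] by simp
  ultimately have ss: "s \<in> c \<longleftrightarrow> s' \<in> c"
    unfolding c by (meson weak_class_sym weak_class_trans)
  show ?thesis
    using mem fc ss ne t by (simp add: merge_fun_def weak_class_insert weak_class_refl m_assoc)
qed

text \<open>Two arcs that can both be added start at different sinks and end at different sources,
  hence they either form a chain in one of the two orders or concern disjoint parts.\<close>

lemma merge_fun_commute: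
  assumes "monoid A" "range f \<subseteq> carrier A"
    and pl: "path_like (insert e (insert e' E))" and new: "e \<notin> E" "e' \<notin> E" "e \<noteq> e'"
    and c: "c = weak_class (insert e (insert e' E)) x"
  shows "merge_fun A (insert e E) e' (merge_fun A E e f) c = merge_fun A (insert e' E) e (merge_fun A E e' f) c"
proof -
  obtain s t s' t' where e: "e = (s, t)" and e': "e' = (s', t')"
    by (cases e, cases e')
  let ?F = "insert (s, t) (insert (s', t') E)" and ?W = "weak_class E"
  have pl: "path_like ?F" and new: "(s, t) \<notin> E" "(s', t') \<notin> E" "(s, t) \<noteq> (s', t')"
    using pl new by (auto simp: e e')
  have plE: "path_like E" "path_like (insert (s, t) E)" "path_like (insert (s', t') E)"
    using pl by (auto elim: path_like_subset)
  have pl': "path_like (insert (s', t') (insert (s, t) E))"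
    using pl by (simp add: insert_commute)
  have "s \<noteq> s'" "t \<noteq> t'"
    using pl new by (auto simp: path_like_def single_valued_def)
  have ne: "?W s \<noteq> ?W t" "?W s' \<noteq> ?W t'"
    using path_like_new_arc_merges[OF plE(2) new(1)] path_like_new_arc_merges[OF plE(3) new(2)] by auto
  \<comment> \<open>Two different sinks cannot lie on the same path, and neither can two different
    sources.\<close>
  have ss: "?W s \<noteq> ?W s'"
    using weak_class_unique_sink[of E s' s] path_like_new_arc(1)[OF plE(2) new(1)]
      path_like_new_arc(1)[OF plE(3) new(2)] plE(1) \<open>s \<noteq> s'\<close>
    by (auto simp: weak_class_eq_iff path_like_def)
  have tt: "?W t \<noteq> ?W t'"
    using weak_class_unique_source[of E t' t] path_like_new_arc(2)[OF plE(2) new(1)]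
      path_like_new_arc(2)[OF plE(3) new(2)] plE(1) \<open>t \<noteq> t'\<close>
    by (auto simp: weak_class_eq_iff path_like_def)
  \<comment> \<open>Forming a chain in both orders at once would close a cycle.\<close>
  have cyc: "\<not> (?W t = ?W s' \<and> ?W s = ?W t')"
  proof
    assume "?W t = ?W s' \<and> ?W s = ?W t'"
    then have "s' \<in> ?W t" "t' \<in> ?W s"
      by (auto simp: weak_class_eq_iff[symmetric])
    moreover have "(s', t') \<notin> insert (s, t) E"
      using new by auto
    ultimately show False
      using path_like_new_arc_merges[OF pl'] by (simp add: weak_class_insert)
  qed
  consider "?W t = ?W s'" | "?W s = ?W t'" | "?W t \<noteq> ?W s'" "?W s \<noteq> ?W t'"
    by blast
  then show ?thesis
  proof cases
    case 1
    then show ?thesis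
      unfolding e e' using c cyc ne tt
      by (intro merge_fun_merge_fun_chain[OF assms(1,2)]) (auto simp: e e')
  next
    case 2
    have c': "c = weak_class (insert (s', t') (insert (s, t) E)) x"
      using c by (simp add: e e' insert_commute)
    show ?thesis
      unfolding e e' using 2 cyc ne tt ss
      by (intro merge_fun_merge_fun_chain[OF assms(1,2) c', symmetric]) auto
  next
    case 3
    \<comment> \<open>In the remaining case the two merged classes stay separate, so at most one of
      the two products affects \<open>c\<close>.\<close>
    have mem: "s' \<notin> ?W s" "t' \<notin> ?W s" "s' \<notin> ?W t" "t' \<notin> ?W t" "s \<notin> ?W s'" "s \<notin> ?W t'"
      "t \<notin> ?W s'" "t \<notin> ?W t'"
      using 3 ss tt weak_class_eq_iff by metis+
    have "weak_class ?F s = ?W s \<union> ?W t"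
      using mem weak_class_refl[of s E] by (simp add: weak_class_insert)
    then have "s' \<notin> weak_class ?F s"
      using mem by auto
    then have "\<not> (s \<in> c \<and> s' \<in> c)"
      unfolding c e e' by (meson weak_class_sym weak_class_trans)
    then show ?thesis
      using mem by (auto simp: e e' merge_fun_def weak_class_insert)
  qed
qed

lemma weak_class_image_insert:
  assumes "s \<in> V"
  shows "weak_class (insert (s, t) E) ` V =
    insert (weak_class E s \<union> weak_class E t) (weak_class E ` V - {weak_class E s, weak_class E t})"
proof -
  have cl: "x \<notin> weak_class E s \<union> weak_class E t \<longleftrightarrow> weak_class E x \<notin> {weak_class E s, weak_class E t}" for x
    by (metis UnCI UnE insertE insertI1 insertI2 singletonD weak_class_eq_iff)
  show ?thesis
  proof (intro equalityI subsetI)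
    fix c assume "c \<in> weak_class (insert (s, t) E) ` V"
    then show "c \<in> insert (weak_class E s \<union> weak_class E t) (weak_class E ` V - {weak_class E s, weak_class E t})"
      using cl by (auto simp: weak_class_insert split: if_splits)
  next
    fix c assume "c \<in> insert (weak_class E s \<union> weak_class E t) (weak_class E ` V - {weak_class E s, weak_class E t})"
    then consider "c = weak_class E s \<union> weak_class E t"
      | x where "x \<in> V" "c = weak_class E x" "weak_class E x \<notin> {weak_class E s, weak_class E t}"
      by auto
    then show "c \<in> weak_class (insert (s, t) E) ` V"
    proof cases
      case 1
      then have "c = weak_class (insert (s, t) E) s"
        by (simp add: weak_class_insert weak_class_refl)
      then show ?thesis using assms by blast
    next
      case 2
      then have "c = weak_class (insert (s, t) E) x"
        using cl[of x] by (simp add: weak_class_insert)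
      then show ?thesis using 2(1) by blast
    qed
  qed
qed

section \<open>Signs and orders of arcs\<close>

definition below :: "'e rel \<Rightarrow> 'e set \<Rightarrow> 'e \<Rightarrow> nat"
  where "below r E e = card {f \<in> E. (f, e) \<in> r}"

lemma below_insert:
  assumes "finite E" "e \<notin> E"
  shows "below r (insert e E) e' = below r E e' + (if (e, e') \<in> r then 1 else 0)"
proof -
  have "{f \<in> insert e E. (f, e') \<in> r} = (if (e, e') \<in> r then insert e {f \<in> E. (f, e') \<in> r} else {f \<in> E. (f, e') \<in> r})"
    by auto
  then show ?thesis
    using assms by (simp add: below_def)
qed

lemma below_Un:
  assumes "finite E" "finite X" "E \<inter> X = {}"
  shows "below r (E \<union> X) e = below r E e + below r X e"
proof -
  have "{f \<in> E \<union> X. (f, e) \<in> r} = {f \<in> E. (f, e) \<in> r} \<union> {f \<in> X. (f, e) \<in> r}"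
    by auto
  then show ?thesis
    unfolding below_def using assms by (simp add: card_Un_disjoint disjoint_iff)
qed

lemma linear_order_on_mem_iff:
  assumes "linear_order_on S r" "a \<in> S" "b \<in> S" "a \<noteq> b"
  shows "(a, b) \<in> r \<longleftrightarrow> (b, a) \<notin> r"
  using assms unfolding linear_order_on_def partial_order_on_def total_on_def antisym_def by blast

text \<open>The sign relating two arc orders is the parity of the number of inversions between them, corrected
  by the number of pairs in which a permanently present arc from \<open>X\<close> comes first.\<close>

lemma sign_change_exists:
  fixes r r' :: "'e rel"
  assumes r: "linear_order_on S r" and r': "linear_order_on S' r'" and "S' \<subseteq> S" and "finite X" "S' \<inter> X = {}"
  obtains \<zeta> :: "'e set \<Rightarrow> nat" where
    "\<And>E e. finite E \<Longrightarrow> E \<subseteq> S' \<Longrightarrow> e \<in> S' \<Longrightarrow> e \<notin> E \<Longrightarrow>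
      even (\<zeta> (insert e E) + \<zeta> E + (below r' E e + below r (E \<union> X) e))"
proof -
  \<comment> \<open>Pairs of arcs that the two orders arrange differently; the sum in
    \<open>\<zeta>\<close> then adds, for each arc of \<open>E\<close>, the permanent arcs before
    it.\<close>
  define invs where "invs E = card {(a, b). a \<in> E \<and> b \<in> E \<and> a \<noteq> b \<and> (a, b) \<in> r \<and> (b, a) \<in> r'}" for E
  define \<zeta> where "\<zeta> E = invs E + (\<Sum>b\<in>E. below r X b)" for E
  have "even (\<zeta> (insert e E) + \<zeta> E + (below r' E e + below r (E \<union> X) e))"
    if E: "finite E" "E \<subseteq> S'" "e \<in> S'" "e \<notin> E" for E e
  proof -
    let ?P = "{a \<in> E. (a, e) \<in> r}" and ?Q = "{a \<in> E. (a, e) \<in> r'}"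
    let ?I = "\<lambda>E. {(a, b). a \<in> E \<and> b \<in> E \<and> a \<noteq> b \<and> (a, b) \<in> r \<and> (b, a) \<in> r'}"
    have fI: "finite (?I E)"
      by (rule finite_subset[of _ "E \<times> E"]) (use E(1) in auto)
    have o: "(e, a) \<in> r \<longleftrightarrow> (a, e) \<notin> r" "(e, a) \<in> r' \<longleftrightarrow> (a, e) \<notin> r'" if "a \<in> E" for a
      using linear_order_on_mem_iff[OF r, of e a] linear_order_on_mem_iff[OF r', of e a] that E assms(3) by auto
    \<comment> \<open>The new inversions come from the arcs that precede \<open>e\<close> in exactly
      one of the two orders, i.e. from the symmetric difference of \<open>?P\<close> and
      \<open>?Q\<close>, whose size has the parity of \<open>card ?P + card ?Q\<close>.\<close>
    have "?I (insert e E) = ?I E \<union> ((\<lambda>a. (a, e)) ` (?P - ?Q) \<union> (\<lambda>b. (e, b)) ` (?Q - ?P))"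
      using E(4) by (auto simp: o)
    moreover have "card \<dots> = card (?I E) + (card ((\<lambda>a. (a, e)) ` (?P - ?Q)) + card ((\<lambda>b. (e, b)) ` (?Q - ?P)))"
      using E(1,4) fI by (subst card_Un_disjoint card_Un_disjoint; (subst card_Un_disjoint)?) auto
    moreover have "card ((\<lambda>a. (a, e)) ` (?P - ?Q)) = card (?P - ?Q)" "card ((\<lambda>b. (e, b)) ` (?Q - ?P)) = card (?Q - ?P)"
      by (auto intro!: card_image inj_onI)
    ultimately have invs: "invs (insert e E) = invs E + (card (?P - ?Q) + card (?Q - ?P))"
      unfolding invs_def by simp
    have "card ?P = card (?P - ?Q) + card (?P \<inter> ?Q)" "card ?Q = card (?Q - ?P) + card (?P \<inter> ?Q)"
      using E(1) card_Int_Diff[of ?P ?Q] card_Int_Diff[of ?Q ?P] by (simp_all add: Int_commute)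
    moreover have "below r (E \<union> X) e = card ?P + below r X e"
      using below_Un[of E X r e] E assms(4,5) by (auto simp: below_def)
    moreover have "below r' E e = card ?Q"
      by (simp add: below_def)
    moreover have "\<zeta> (insert e E) = \<zeta> E + (card (?P - ?Q) + card (?Q - ?P)) + below r X e"
      using E by (simp add: \<zeta>_def invs)
    \<comment> \<open>Writing the sum as an explicit double proves that it is even.\<close>
    ultimately have "\<zeta> (insert e E) + \<zeta> E + (below r' E e + below r (E \<union> X) e) =
        2 * (\<zeta> E + card (?P - ?Q) + card (?Q - ?P) + card (?P \<inter> ?Q) + below r X e)"
      by simp
    then show ?thesis
      by (simp only: dvd_triv_left)
  qed
  then show ?thesis
    by (rule that)
qed

abbreviation sign :: "('r, 'k) ring_scheme \<Rightarrow> nat \<Rightarrow> 'r"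
  where "sign R k \<equiv> (\<ominus>\<^bsub>R\<^esub> \<one>\<^bsub>R\<^esub>) [^]\<^bsub>R\<^esub> k"

lemma (in module) sign_smult:
  assumes "x \<in> carrier M"
  shows sign_smult_even: "even k \<Longrightarrow> sign R k \<odot>\<^bsub>M\<^esub> x = x"
    and sign_smult_odd: "odd k \<Longrightarrow> sign R k \<odot>\<^bsub>M\<^esub> x = \<ominus>\<^bsub>M\<^esub> x"
    and sign_smult_smult: "sign R k \<odot>\<^bsub>M\<^esub> (sign R l \<odot>\<^bsub>M\<^esub> x) = sign R (k + l) \<odot>\<^bsub>M\<^esub> x"
proof -
  have p: "sign R k = (if even k then \<one> else \<ominus> \<one>)" for k
    by (induction k) (auto simp: R.l_minus)
  show "even k \<Longrightarrow> sign R k \<odot>\<^bsub>M\<^esub> x = x" "odd k \<Longrightarrow> sign R k \<odot>\<^bsub>M\<^esub> x = \<ominus>\<^bsub>M\<^esub> x"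
    using assms by (auto simp: p smult_l_minus)
  show "sign R k \<odot>\<^bsub>M\<^esub> (sign R l \<odot>\<^bsub>M\<^esub> x) = sign R (k + l) \<odot>\<^bsub>M\<^esub> x"
    using assms by (simp add: R.nat_pow_mult[symmetric] smult_assoc1)
qed

lemma (in cring) sign_closed: "sign R k \<in> carrier R"
  by simp

text \<open>One digraph with its two orders; \<open>G\<close>, \<open>G'\<close> and
  \<open>G''\<close> become three instances with independent orders. Multipaths are handled through
  their arc sets, the vertex set being fixed.\<close>

locale multipath_context =
  fixes R :: "('r, 'k) ring_scheme" and A :: "('r, 'a, 'm) module_scheme"
    and G :: "'v pair_pre_digraph" and rV :: "'v rel" and rE :: "('v \<times> 'v) rel"
  assumes algebra: "assoc_algebra R A" and digraph: "pair_digraph G"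
    and rV: "linear_order_on (pverts G) rV" and rE: "linear_order_on (parcs G) rE"
begin

sublocale A: assoc_algebra R A by (rule algebra)
sublocale G: pair_digraph G by (rule digraph)

abbreviation span :: "('v \<times> 'v) set \<Rightarrow> 'v pair_pre_digraph"
  where "span E \<equiv> \<lparr> pverts = pverts G, parcs = E \<rparr>"

abbreviation comp_list :: "('v \<times> 'v) set \<Rightarrow> 'v set list"
  where "comp_list E \<equiv> component_list rV (span E)"

abbreviation F :: "'v pair_pre_digraph \<Rightarrow> ('r, ('a list \<Rightarrow> 'r) set) module"
  where "F \<equiv> multipath_module R A rV"

abbreviation pure :: "('v \<times> 'v) set \<Rightarrow> ('v set \<Rightarrow> 'a) \<Rightarrow> ('a list \<Rightarrow> 'r) set"
  where "pure E f \<equiv> pure_power R A (map f (comp_list E))"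

abbreviation mu :: "('v \<times> 'v) set \<Rightarrow> ('v \<times> 'v) set \<Rightarrow> ('a list \<Rightarrow> 'r) set \<Rightarrow> ('a list \<Rightarrow> 'r) set"
  where "mu E E' \<equiv> multipath_mu R A rV (span E) (span E')"

definition admissible :: "('v \<times> 'v) set \<Rightarrow> bool"
  where "admissible E \<longleftrightarrow> E \<subseteq> parcs G \<and> path_like E"

lemma multipaths_eq: "multipaths G = span ` Collect admissible"
proof (intro equalityI subsetI)
  fix H assume "H \<in> multipaths G"
  then show "H \<in> span ` Collect admissible"
    unfolding mem_multipaths_iff[OF digraph] by (cases H) (auto simp: admissible_def)
qed (auto simp: mem_multipaths_iff[OF digraph] admissible_def)

lemma multipaths_of_size_eq:
  "multipaths_of_size G n = span ` {E. admissible E \<and> int (card E) = n}"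
  by (auto simp: multipaths_of_size_def multipaths_eq)

lemma arcs_subset: "parcs G \<subseteq> pverts G \<times> pverts G"
  using G.in_arcsD1 G.in_arcsD2 by auto

lemma admissible_finite: "admissible E \<Longrightarrow> finite E"
  using finite_subset[OF _ G.pair_finite_arcs] by (auto simp: admissible_def)

lemma admissible_subset: "admissible E \<Longrightarrow> D \<subseteq> E \<Longrightarrow> admissible D"
  using path_like_subset by (auto simp: admissible_def)

lemma admissible_wf: "admissible E \<Longrightarrow> parcs (span E) \<subseteq> pverts (span E) \<times> pverts (span E)"
  using arcs_subset by (auto simp: admissible_def)

lemma comp_list:
  assumes "admissible E"
  shows comp_list_distinct: "distinct (comp_list E)"
    and set_comp_list: "set (comp_list E) = weak_class E ` pverts G"
proof -
  have "finite (pverts (span E))" "linear_order_on (pverts (span E)) rV"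
    using G.pair_finite_verts rV by auto
  then show "distinct (comp_list E)" "set (comp_list E) = weak_class E ` pverts G"
    using component_list[of "span E" rV] components_eq[of "span E"] admissible_wf[OF assms] by auto
qed

lemma F_span: "F (span E) = tensor_power R A (length (comp_list E))"
  by (simp add: multipath_module_def)

lemma F_module: "module R (F H)"
  unfolding multipath_module_def by (rule A.tensor_power_module)

lemma pure_closed: "range f \<subseteq> carrier A \<Longrightarrow> pure E f \<in> carrier (F (span E))"
  unfolding F_span by (rule A.pure_power_closed)

lemma pure_cong:
  assumes "admissible E" "\<And>x. x \<in> pverts G \<Longrightarrow> f (weak_class E x) = g (weak_class E x)"
  shows "pure E f = pure E g"
proof -
  have "map f (comp_list E) = map g (comp_list E)"
    using assms(2) set_comp_list[OF assms(1)] by auto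
  then show ?thesis by argo
qed

lemma F_hom_ext:
  assumes "admissible E" "module R P" "h \<in> mod_hom R (F (span E)) P" "k \<in> mod_hom R (F (span E)) P"
    and "\<And>f. range f \<subseteq> carrier A \<Longrightarrow> h (pure E f) = k (pure E f)" "X \<in> carrier (F (span E))"
  shows "h X = k X"
  using A.tensor_power_hom_ext[OF assms(2) comp_list_distinct[OF assms(1)] assms(3,4)[unfolded F_span] assms(5)
      assms(6)[unfolded F_span]] .

lemma merge_fun_closed:
  assumes "range f \<subseteq> carrier A"
  shows "range (merge_fun A E e f) \<subseteq> carrier A"
proof -
  have "f c \<in> carrier A" for c
    using assms by auto
  then show ?thesis
    by (auto simp: merge_fun_def)
qed

lemma new_arc_span: "e \<notin> E \<Longrightarrow> new_arc (span E) (span (insert e E)) = e"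
  by (simp add: new_arc_def insert_Diff_if)

lemma merge_entries_map:
  assumes "admissible (insert e E)" "e \<notin> E"
  shows "merge_entries A rV (span E) (span (insert e E)) (map f (comp_list E)) =
    map (merge_fun A E e f) (comp_list (insert e E))"
proof -
  obtain s t where e: "e = (s, t)" by (cases e)
  have adm: "admissible E"
    using assms(1) by (rule admissible_subset) auto
  have V: "s \<in> pverts G" "t \<in> pverts G"
    using assms(1) arcs_subset by (auto simp: admissible_def e)
  have ent: "entry rV (span E) (map f (comp_list E)) (weak_class E x) = f (weak_class E x)" if "x \<in> pverts G" for x
    using that set_comp_list[OF adm] by (intro entry_map comp_list_distinct[OF adm]) auto
  have co: "component_of (span E) x = weak_class E x" if "x \<in> pverts G" for x
    using component_of_eq[of "span E" x] admissible_wf[OF adm] that by simp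
  \<comment> \<open>A class that does not contain \<open>s\<close> after the insertion was already a
    class of \<open>E\<close>, so it has an entry in the old tuple.\<close>
  have "entry rV (span E) (map f (comp_list E)) c = f c"
    if "c \<in> set (comp_list (insert e E))" "s \<notin> c" for c
  proof -
    have "c \<in> weak_class E ` pverts G"
      using that weak_class_refl[of s E]
      unfolding set_comp_list[OF assms(1)] unfolding e weak_class_image_insert[OF V(1)] by auto
    then show ?thesis
      using ent by auto
  qed
  then show ?thesis
    using V unfolding merge_entries_def new_arc_span[OF assms(2)] Let_def
    by (auto simp: merge_fun_def e co ent)
qed

text \<open>The passage from the definition of \<open>\<mu>\<close> by \<open>the_elem\<close> to
  its values on pure tensors; it rests on the multilinearity of merging.\<close>

lemma mu:
  assumes "admissible (insert e E)" "e \<notin> E"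
  shows mu_hom: "mu E (insert e E) \<in> mod_hom R (F (span E)) (F (span (insert e E)))"
    and mu_pure: "range f \<subseteq> carrier A \<Longrightarrow>
      mu E (insert e E) (pure E f) = pure (insert e E) (merge_fun A E e f)"
proof -
  obtain s t where e: "e = (s, t)" by (cases e)
  let ?E = "insert e E"
  let ?\<phi> = "\<lambda>xs. pure_power R A (merge_entries A rV (span E) (span ?E) xs)"
  have adm: "admissible E"
    using assms(1) by (rule admissible_subset) auto
  have V: "s \<in> pverts G" "t \<in> pverts G"
    using assms(1) arcs_subset by (auto simp: admissible_def e)
  let ?m = "weak_class E s \<union> weak_class E t"
  have ne: "weak_class E s \<noteq> weak_class E t"
    using path_like_new_arc_merges[of s t E] assms by (auto simp: admissible_def e)
  \<comment> \<open>The merged class is new: a class of \<open>E\<close> equal to it would contain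
    both \<open>s\<close> and \<open>t\<close>, which lie in different classes.\<close>
  have m: "?m \<notin> weak_class E ` pverts G"
  proof
    assume "?m \<in> weak_class E ` pverts G"
    then obtain x where x: "weak_class E x = ?m" by auto
    then have "weak_class E x = weak_class E s" "weak_class E x = weak_class E t"
      using weak_class_refl[of s E] weak_class_refl[of t E] unfolding weak_class_eq_iff by auto
    with ne show False by simp
  qed
  have set: "set (comp_list ?E) = insert ?m (set (comp_list E) - {weak_class E s, weak_class E t})"
    unfolding set_comp_list[OF assms(1)] set_comp_list[OF adm] unfolding e weak_class_image_insert[OF V(1)] ..
  \<comment> \<open>Classes are disjoint, so the test \<open>fst e \<in> c\<close> is equality with
    the merged class.\<close>
  have "s \<in> c \<longleftrightarrow> c = ?m" if "c \<in> set (comp_list ?E)" for c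
  proof -
    from that consider "c = ?m" | x where "c = weak_class E x" "weak_class E x \<noteq> weak_class E s"
      unfolding set set_comp_list[OF adm] by auto
    then show ?thesis
    proof cases
      case 2
      then have "s \<notin> c"
        by (simp add: weak_class_eq_iff)
      then show ?thesis
        using weak_class_refl[of s E] by auto
    qed (use weak_class_refl[of s E] in auto)
  qed
  then have mf: "map (merge_fun A E e f) (comp_list ?E) =
      map (\<lambda>c. if c = ?m then f (weak_class E s) \<otimes>\<^bsub>A\<^esub> f (weak_class E t) else f c) (comp_list ?E)" for f
    by (auto simp: merge_fun_def e)
  have "multilinear R A (set (comp_list E)) (tensor_power R A (length (comp_list ?E)))
      (\<lambda>f. ?\<phi> (map f (comp_list E)))"
    unfolding merge_entries_map[OF assms] mf
    by (rule merge_multilinear[OF algebra comp_list_distinct[OF assms(1)] _ _ ne _ set])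
      (use V m in \<open>auto simp: set_comp_list[OF adm]\<close>)
  note hom = A.tensor_power_hom[OF A.tensor_power_module comp_list_distinct[OF adm] this]
  have mu: "mu E ?E =
      (\<lambda>X. the_elem (lin_ext R (tensor_power R A (length (comp_list ?E))) ?\<phi> ` X))"
    by (simp add: fun_eq_iff multipath_mu_def multipath_module_def)
  show "mu E ?E \<in> mod_hom R (F (span E)) (F (span ?E))"
    unfolding mu F_span by (rule hom(1))
  show "mu E ?E (pure E f) = pure ?E (merge_fun A E e f)" if "range f \<subseteq> carrier A"
    unfolding mu hom(2)[OF that] merge_entries_map[OF assms] ..
qed

text \<open>Both composites are homomorphisms, so pure tensors suffice, and there the claim is
  \<open>merge_fun_commute\<close>. The square commutes without signs; they come in
  separately.\<close>

lemma mu_mu: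
  assumes adm: "admissible (insert e (insert e' E))" and new: "e \<notin> E" "e' \<notin> E" "e \<noteq> e'"
    and X: "X \<in> carrier (F (span E))"
  shows "mu (insert e E) (insert e (insert e' E))
      (mu E (insert e E) X) =
    mu (insert e' E) (insert e (insert e' E))
      (mu E (insert e' E) X)"
proof -
  have adm1: "admissible (insert e E)" and adm2: "admissible (insert e' E)" and adm0: "admissible E"
    using admissible_subset[OF adm] by auto
  have new': "e' \<notin> insert e E" "e \<notin> insert e' E"
    using new by auto
  note c = insert_commute[of e e' E]
  note mu1 = mu[OF adm1 new(1)] and mu2 = mu[OF adm2 new(2)]
  note mu1' = mu[OF adm[unfolded c] new'(1), folded c] and mu2' = mu[OF adm new'(2)]
  show ?thesis
  proof (rule F_hom_ext[OF adm0 F_module mod_hom_comp[OF mu1(1) mu1'(1)] mod_hom_comp[OF mu2(1) mu2'(1)] _ X])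
    fix f :: "'v set \<Rightarrow> 'a" assume f: "range f \<subseteq> carrier A"
    have "pure (insert e (insert e' E)) (merge_fun A (insert e E) e' (merge_fun A E e f)) =
        pure (insert e (insert e' E)) (merge_fun A (insert e' E) e (merge_fun A E e' f))"
      by (rule pure_cong[OF adm], rule merge_fun_commute[OF A.monoid_axioms f _ new refl])
        (use adm in \<open>simp add: admissible_def\<close>)
    then show "mu (insert e E) (insert e (insert e' E))
        (mu E (insert e E) (pure E f)) =
      mu (insert e' E) (insert e (insert e' E))
        (mu E (insert e' E) (pure E f))"
      unfolding mu1(2)[OF f] mu2(2)[OF f] mu1'(2)[OF merge_fun_closed[OF f]] mu2'(2)[OF merge_fun_closed[OF f]] .
  qed
qed

lemma precedes_span: "precedes (span E) (span E') \<longleftrightarrow> (\<exists>e. e \<notin> E \<and> E' = insert e E)"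
  by (auto simp: precedes_def)

lemma arc_sign_span: "e \<notin> E \<Longrightarrow> arc_sign rE (span E) (span (insert e E)) = below rE E e"
  by (simp add: arc_sign_def below_def new_arc_span)

text \<open>The signed entries of the differential, extended by zero to all pairs of multipaths, so
  that sums may range over a whole degree.\<close>

definition entry_map ::
  "'v pair_pre_digraph \<Rightarrow> 'v pair_pre_digraph \<Rightarrow> ('a list \<Rightarrow> 'r) set \<Rightarrow> ('a list \<Rightarrow> 'r) set"
  where "entry_map H H' x = (if precedes H H' then sign R (arc_sign rE H H') \<odot>\<^bsub>F H'\<^esub>
      multipath_mu R A rV H H' x else \<zero>\<^bsub>F H'\<^esub>)"

lemma entry_map_hom:
  assumes "H \<in> multipaths G" "H' \<in> multipaths G"
  shows "entry_map H H' \<in> mod_hom R (F H) (F H')"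
proof (cases "precedes H H'")
  case True
  obtain E E' where E: "H = span E" "H' = span E'" "admissible E'"
    using assms by (auto simp: multipaths_eq)
  with True obtain e where e: "e \<notin> E" "E' = insert e E"
    by (auto simp: precedes_span)
  have "entry_map H H' = (\<lambda>x. sign R (arc_sign rE H H') \<odot>\<^bsub>F H'\<^esub> multipath_mu R A rV H H' x)"
    using True by (simp add: fun_eq_iff entry_map_def)
  then show ?thesis
    using mod_hom_smult_map[OF F_module mu_hom[of e E]] E e A.R.sign_closed by simp
next
  case False
  then have "entry_map H H' = (\<lambda>_. \<zero>\<^bsub>F H'\<^esub>)"
    by (simp add: fun_eq_iff entry_map_def)
  then show ?thesis
    using mod_hom_zero_map[OF F_module] by simp
qed

lemma finite_multipaths_of_size: "finite (multipaths_of_size G n)"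
proof -
  have "{E. admissible E \<and> int (card E) = n} \<subseteq> Pow (parcs G)"
    by (auto simp: admissible_def)
  then show ?thesis
    unfolding multipaths_of_size_eq using G.pair_finite_arcs by (meson finite_Pow_iff finite_imageI finite_subset)
qed

text \<open>The composites of matrix entries through the two orders of adding a pair of arcs cancel.\<close>

lemma entry_map_square_zero:
  assumes H: "H \<in> multipaths_of_size G n" and H'': "H'' \<in> multipaths_of_size G (n + 2)" and x: "x \<in> carrier (F H)"
  shows "(\<Oplus>\<^bsub>F H''\<^esub>K\<in>multipaths_of_size G (n + 1). entry_map K H'' (entry_map H K x)) = \<zero>\<^bsub>F H''\<^esub>"
proof -
  let ?I = "multipaths_of_size G (n + 1)"
  let ?t = "\<lambda>K. entry_map K H'' (entry_map H K x)"
  interpret F: module R "F H''" by (rule F_module)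
  have mp: "K \<in> multipaths G" if "K \<in> multipaths_of_size G k" for K k
    using that by (simp add: multipaths_of_size_def)
  have cl: "?t K \<in> carrier (F H'')" if "K \<in> ?I" for K
    using mod_hom_closed[OF entry_map_hom[OF mp[OF that] mp[OF H'']]]
      mod_hom_closed[OF entry_map_hom[OF mp[OF H] mp[OF that]] x] by simp
  have z: "?t K = \<zero>\<^bsub>F H''\<^esub>" if "K \<in> ?I" "\<not> (precedes H K \<and> precedes K H'')" for K
  proof (cases "precedes K H''")
    case True
    then have "entry_map H K x = \<zero>\<^bsub>F K\<^esub>"
      using that(2) by (simp add: entry_map_def)
    then show ?thesis
      using mod_hom_zero[OF entry_map_hom[OF mp[OF that(1)] mp[OF H'']] F_module F_module] by simp
  qed (simp add: entry_map_def)
  show ?thesis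
  proof (cases "\<exists>K\<in>?I. precedes H K \<and> precedes K H''")
    case False
    then have "(\<Oplus>\<^bsub>F H''\<^esub>K\<in>?I. ?t K) = (\<Oplus>\<^bsub>F H''\<^esub>K\<in>?I. \<zero>\<^bsub>F H''\<^esub>)"
      using z by (intro F.finsum_cong') auto
    then show ?thesis by simp
  next
    case True
    then obtain K where K: "K \<in> ?I" "precedes H K" "precedes K H''" by blast
    obtain E EK EH where HK: "H = span E" "K = span EK" "H'' = span EH" "admissible EH" "int (card E) = n"
      using H H'' K(1) by (auto simp: multipaths_of_size_eq)
    obtain e where e: "e \<notin> E" "EK = insert e E"
      using K(2) HK by (auto simp: precedes_span)
    obtain e' where "e' \<notin> EK" "EH = insert e' EK"
      using K(3) HK by (auto simp: precedes_span)
    then have e': "e' \<notin> E" "e \<noteq> e'" and EH: "EH = insert e (insert e' E)"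
      using e by auto
    have adm: "admissible (insert e (insert e' E))" and adm1: "admissible (insert e E)"
      and adm2: "admissible (insert e' E)" and adm0: "admissible E"
      using HK(4) admissible_subset[OF HK(4)] by (auto simp: EH)
    have fin: "finite E"
      using admissible_finite[OF adm0] .
    let ?K1 = "span (insert e E)" and ?K2 = "span (insert e' E)"
    have sub: "{?K1, ?K2} \<subseteq> ?I"
      using adm1 adm2 e e' fin HK(5) by (auto simp: multipaths_of_size_eq)
    \<comment> \<open>An intermediate arc set adds one of the two missing arcs, so there are exactly
      two routes from \<open>H\<close> to \<open>H''\<close>.\<close>
    have only: "K' \<in> {?K1, ?K2}" if K': "K' \<in> ?I" "precedes H K'" "precedes K' H''" for K'
    proof -
      obtain E' where E': "K' = span E'"
        using K'(1) by (auto simp: multipaths_of_size_eq)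
      obtain a where a: "a \<notin> E" "E' = insert a E"
        using K'(2) E' HK by (auto simp: precedes_span)
      obtain b where "insert b E' = insert e (insert e' E)"
        using K'(3) E' HK EH by (auto simp: precedes_span)
      then have "a = e \<or> a = e'"
        using a by blast
      then show ?thesis
        using E' a by auto
    qed
    have ne: "?K1 \<noteq> ?K2"
      using e e' by auto
    have "(\<Oplus>\<^bsub>F H''\<^esub>K\<in>?I. ?t K) = (\<Oplus>\<^bsub>F H''\<^esub>K\<in>{?K1, ?K2}. ?t K)"
      using sub finite_multipaths_of_size cl z only
      by (intro F.add.finprod_mono_neutral_cong_right) auto
    also have "\<dots> = ?t ?K1 \<oplus>\<^bsub>F H''\<^esub> ?t ?K2"
      using ne cl sub by (simp add: F.r_zero)
    also have "\<dots> = \<zero>\<^bsub>F H''\<^esub>"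
    proof -
      let ?m = "multipath_mu R A rV"
      have new': "e' \<notin> insert e E" "e \<notin> insert e' E"
        using e e' by auto
      note c = insert_commute[of e e' E]
      note h1 = mu_hom[OF adm1 e(1)] and h2 = mu_hom[OF adm2 e'(1)]
      note h1' = mu_hom[OF adm[unfolded c] new'(1), folded c] and h2' = mu_hom[OF adm new'(2)]
      have x': "x \<in> carrier (F (span E))"
        using x HK by simp
      define y where "y = ?m ?K1 (span (insert e (insert e' E))) (?m (span E) ?K1 x)"
      have y: "y \<in> carrier (F H'')"
        unfolding y_def HK EH using mod_hom_closed[OF h1' mod_hom_closed[OF h1 x']] .
      have p: "precedes (span E) ?K1" "precedes ?K1 (span (insert e (insert e' E)))"
        "precedes (span E) ?K2" "precedes ?K2 (span (insert e (insert e' E)))"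
        using e e' new' c unfolding precedes_span by blast+
      have s: "arc_sign rE (span E) ?K1 = below rE E e" "arc_sign rE (span E) ?K2 = below rE E e'"
        "arc_sign rE ?K1 (span (insert e (insert e' E))) = below rE (insert e E) e'"
        "arc_sign rE ?K2 (span (insert e (insert e' E))) = below rE (insert e' E) e"
        using arc_sign_span[OF e(1)] arc_sign_span[OF e'(1)] arc_sign_span[OF new'(1)] arc_sign_span[OF new'(2)]
        by (simp_all add: c)
      let ?a = "below rE (insert e E) e' + below rE E e" and ?b = "below rE (insert e' E) e + below rE E e'"
      have t1: "?t ?K1 = sign R ?a \<odot>\<^bsub>F H''\<^esub> y"
        using y mod_hom_smult[OF h1' A.R.sign_closed mod_hom_closed[OF h1 x']]
        by (simp add: entry_map_def HK EH p s y_def F.sign_smult_smult[unfolded HK EH])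
      have t2: "?t ?K2 = sign R ?b \<odot>\<^bsub>F H''\<^esub> y"
        using y mod_hom_smult[OF h2' A.R.sign_closed mod_hom_closed[OF h2 x']] mu_mu[OF adm e(1) e'(1,2) x']
        by (simp add: entry_map_def HK EH p s y_def F.sign_smult_smult[unfolded HK EH])
      \<comment> \<open>Each route counts the arcs of \<open>E\<close> before \<open>e\<close> and
        before \<open>e'\<close>. The arc added first is counted again if it precedes the second
        one, which happens in exactly one of the routes.\<close>
      have "(e, e') \<in> rE \<longleftrightarrow> (e', e) \<notin> rE"
        using adm e'(2) by (intro linear_order_on_mem_iff[OF rE]) (auto simp: admissible_def)
      then have "odd (?a + ?b)"
        by (auto simp: below_insert[OF fin e(1)] below_insert[OF fin e'(1)])
      then consider "even ?a" "odd ?b" | "odd ?a" "even ?b"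
        by (metis even_add)
      then show ?thesis
      proof cases
        case 1
        show ?thesis
          unfolding t1 t2 F.sign_smult_even[OF y 1(1)] F.sign_smult_odd[OF y 1(2)] by (rule F.r_neg[OF y])
      next
        case 2
        show ?thesis
          unfolding t1 t2 F.sign_smult_odd[OF y 2(1)] F.sign_smult_even[OF y 2(2)] by (rule F.l_neg[OF y])
      qed
    qed
    finally show ?thesis .
  qed
qed

lemma multipath_complex_matrix:
  "matrix_complex R (multipath_complex R A G rV rE) (multipaths_of_size G) F entry_map"
proof -
  let ?C = "multipath_complex R A G rV rE"
  let ?I = "multipaths_of_size G"
  let ?inc = "\<lambda>n H x. \<lambda>K\<in>?I n. if K = H then x else \<zero>\<^bsub>F K\<^esub>"
  have obj: "obj ?C n = direct_sum (?I n) F" for n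
    by (simp add: multipath_complex_def)
  have bp: "biproduct R (obj ?C n) (?I n) F (?inc n) (\<lambda>H x. x H)" for n
    unfolding obj by (rule direct_sum_biproduct[OF A.R.cring_axioms finite_multipaths_of_size F_module])
  have mod: "module R (obj ?C n)" for n
    by (rule biproduct.axioms(1)[OF bp])
  have mp: "K \<in> multipaths G" if "K \<in> ?I k" for K k
    using that by (simp add: multipaths_of_size_def)
  have xcl: "x H \<in> carrier (F H)" if "x \<in> carrier (obj ?C n)" "H \<in> ?I n" for x H n
    using mod_hom_closed[OF biproduct.prj_hom[OF bp that(2)] that(1)] .
  have diff: "diff ?C n x H' = (\<Oplus>\<^bsub>F H'\<^esub>H\<in>?I n. entry_map H H' (x H))"
    if x: "x \<in> carrier (obj ?C n)" and H': "H' \<in> ?I (n + 1)" for n x H'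
  proof -
    interpret F: module R "F H'" by (rule F_module)
    have "(\<Oplus>\<^bsub>F H'\<^esub>H\<in>{H \<in> ?I n. precedes H H'}. sign R (arc_sign rE H H') \<odot>\<^bsub>F H'\<^esub>
            multipath_mu R A rV H H' (x H)) = (\<Oplus>\<^bsub>F H'\<^esub>H\<in>?I n. entry_map H H' (x H))"
    \<comment> \<open>Entries between multipaths that are not related by \<open>precedes\<close> are
      zero, so the sum extends to the whole degree.\<close>
    proof (rule F.add.finprod_mono_neutral_cong_left)
      show "(\<lambda>H. entry_map H H' (x H)) \<in> ?I n \<rightarrow> carrier (F H')"
        using mod_hom_closed[OF entry_map_hom[OF mp mp[OF H']]] xcl[OF x] by auto
    qed (auto simp: entry_map_def finite_multipaths_of_size)
    then show ?thesis
      using H' by (simp add: multipath_complex_def)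
  qed
  have diff_hom: "diff ?C n \<in> mod_hom R (obj ?C n) (obj ?C (n + 1))" for n
  proof -
    \<comment> \<open>The differential rewritten with injections and projections, a form that is
      visibly a homomorphism.\<close>
    let ?f = "\<lambda>x. \<Oplus>\<^bsub>obj ?C (n + 1)\<^esub>H'\<in>?I (n + 1). ?inc (n + 1) H' (\<Oplus>\<^bsub>F H'\<^esub>H\<in>?I n. entry_map H H' (x H))"
    have h: "(\<lambda>x. \<Oplus>\<^bsub>F H'\<^esub>H\<in>?I n. entry_map H H' (x H)) \<in> mod_hom R (obj ?C n) (F H')" if "H' \<in> ?I (n + 1)" for H'
      by (rule mod_hom_finsum_map[OF F_module finite_multipaths_of_size])
        (rule mod_hom_comp[OF biproduct.prj_hom[OF bp] entry_map_hom[OF mp mp[OF that]]])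
    have f: "?f \<in> mod_hom R (obj ?C n) (obj ?C (n + 1))"
      by (rule mod_hom_finsum_map[OF mod finite_multipaths_of_size])
        (rule mod_hom_comp[OF h biproduct.inc_hom[OF bp]])
    show ?thesis
    proof (rule mod_hom_cong[OF f mod])
      fix x assume x: "x \<in> carrier (obj ?C n)"
      have e: "?f x H' = diff ?C n x H'" if H': "H' \<in> ?I (n + 1)" for H'
        unfolding diff[OF x H'] by (rule biproduct.prj_sum_self[OF bp mod_hom_closed[OF h x] H'])
      show "diff ?C n x = ?f x"
      proof
        fix H' show "diff ?C n x H' = ?f x H'"
        proof (cases "H' \<in> ?I (n + 1)")
          \<comment> \<open>Outside the index set both functions are
            \<open>undefined\<close>.\<close>
          case False
          have "?f x \<in> carrier (obj ?C (n + 1))"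
            by (rule mod_hom_closed[OF f x])
          then have "?f x H' = undefined"
            using False by (auto simp: obj direct_sum_def PiE_iff extensional_def)
          then show ?thesis
            using False by (simp add: multipath_complex_def)
        qed (simp add: e)
      qed
    qed
  qed
  have entry: "diff ?C n (?inc n H x) H' = entry_map H H' x"
    if H: "H \<in> ?I n" and H': "H' \<in> ?I (n + 1)" and x: "x \<in> carrier (F H)" for n H H' x
  proof -
    interpret F: module R "F H'" by (rule F_module)
    have "diff ?C n (?inc n H x) H' = (\<Oplus>\<^bsub>F H'\<^esub>K\<in>?I n. entry_map K H' (?inc n H x K))"
      by (rule diff[OF mod_hom_closed[OF biproduct.inc_hom[OF bp H] x] H'])
    also have "\<dots> = (\<Oplus>\<^bsub>F H'\<^esub>K\<in>?I n. if H = K then entry_map H H' x else \<zero>\<^bsub>F H'\<^esub>)"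
      using mod_hom_zero[OF entry_map_hom[OF mp mp[OF H']] F_module F_module]
        mod_hom_closed[OF entry_map_hom[OF mp[OF H] mp[OF H']] x]
      by (intro F.finsum_cong') auto
    also have "\<dots> = entry_map H H' x"
      using F.finsum_singleton[OF H finite_multipaths_of_size, of "\<lambda>_. entry_map H H' x"]
        mod_hom_closed[OF entry_map_hom[OF mp[OF H] mp[OF H']] x] by simp
    finally show ?thesis .
  qed
  have sq: "diff ?C (n + 1) (diff ?C n x) = \<zero>\<^bsub>obj ?C (n + 2)\<^esub>" if x: "x \<in> carrier (obj ?C n)" for n x
  proof -
    have n2: "n + 1 + 1 = n + 2" by simp
    note d2 = diff_hom[of "n + 1", unfolded n2]
    show ?thesis
    \<comment> \<open>It suffices to start in a single summand \<open>H\<close> and to look at a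
      single component \<open>H''\<close>, where the square is the sum over all intermediate
      multipaths.\<close>
    proof (rule biproduct.hom_ext[OF bp mod mod_hom_comp[OF diff_hom d2] mod_hom_zero_map[OF mod] _ x])
      fix H y assume H: "H \<in> ?I n" and y: "y \<in> carrier (F H)"
      note iy = mod_hom_closed[OF biproduct.inc_hom[OF bp H] y]
      note diy = mod_hom_closed[OF diff_hom iy]
      show "diff ?C (n + 1) (diff ?C n (?inc n H y)) = \<zero>\<^bsub>obj ?C (n + 2)\<^esub>"
      proof (rule biproduct.eqI[OF bp mod_hom_closed[OF d2 diy]])
        interpret D: module R "obj ?C (n + 2)" by (rule mod)
        show "\<zero>\<^bsub>obj ?C (n + 2)\<^esub> \<in> carrier (obj ?C (n + 2))" by simp
        fix H'' assume H'': "H'' \<in> ?I (n + 2)"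
        interpret F: module R "F H''" by (rule F_module)
        have "diff ?C (n + 1) (diff ?C n (?inc n H y)) H'' =
            (\<Oplus>\<^bsub>F H''\<^esub>K\<in>?I (n + 1). entry_map K H'' (diff ?C n (?inc n H y) K))"
          using diff[OF diy] H'' by (simp only: n2)
        also have "\<dots> = (\<Oplus>\<^bsub>F H''\<^esub>K\<in>?I (n + 1). entry_map K H'' (entry_map H K y))"
          using entry[OF H _ y] mod_hom_closed[OF entry_map_hom[OF mp mp[OF H'']]]
            mod_hom_closed[OF entry_map_hom[OF mp[OF H] mp] y]
          by (intro F.finsum_cong') auto
        also have "\<dots> = \<zero>\<^bsub>F H''\<^esub>"
          by (rule entry_map_square_zero[OF H H'' y])
        finally show "diff ?C (n + 1) (diff ?C n (?inc n H y)) H'' = \<zero>\<^bsub>obj ?C (n + 2)\<^esub> H''"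
          using H'' by (simp add: obj direct_sum_simps)
      qed
    qed
  qed
  show ?thesis
    unfolding matrix_complex_def cochain_complex_def
    by (intro conjI allI mod diff_hom ballI sq exI[of _ ?inc] exI[of _ "\<lambda>_ H x. x H"] bp entry; assumption)
qed

end

section \<open>Adding permanent arcs to the multipaths of a subgraph\<close>

text \<open>Covers the three blocks that occur: multipaths of \<open>G'\<close> with no arc added,
  and multipaths of \<open>G'\<close> or of \<open>G''\<close> with \<open>e1\<close> added.\<close>

locale multipath_extension =
  G: multipath_context R A G rV rE + S: multipath_context R A G' rV' rE'
  for R :: "('r, 'k) ring_scheme" and A :: "('r, 'a, 'm) module_scheme"
    and G :: "'v pair_pre_digraph" and rV rE and G' :: "'v pair_pre_digraph" and rV' rE' +
  fixes X :: "('v \<times> 'v) set"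
  assumes verts_subset: "pverts G' \<subseteq> pverts G" and parcs_subset: "parcs G' \<subseteq> parcs G"
    and finite_new: "finite X" and new_disjoint: "parcs G' \<inter> X = {}"
    and extension_admissible: "S.admissible E \<Longrightarrow> G.admissible (E \<union> X)"
begin

definition ext :: "'v pair_pre_digraph \<Rightarrow> 'v pair_pre_digraph"
  where "ext H = \<lparr> pverts = pverts G, parcs = parcs H \<union> X \<rparr>"

lemma ext_span: "ext (S.span E) = G.span (E \<union> X)"
  by (simp add: ext_def)

lemma inj_on_ext: "inj_on ext (multipaths G')"
proof (rule inj_onI)
  fix H K assume *: "H \<in> multipaths G'" "K \<in> multipaths G'" "ext H = ext K"
  then obtain E D where ED: "H = S.span E" "K = S.span D" "E \<subseteq> parcs G'" "D \<subseteq> parcs G'"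
    by (auto simp: S.multipaths_eq S.admissible_def)
  with * have "E \<union> X = D \<union> X"
    by (simp add: ext_span)
  then have "E = D"
    using ED(3,4) new_disjoint by blast
  then show "H = K"
    using ED by simp
qed

lemma ext_image:
  "ext ` multipaths_of_size G' n = G.span ` {E. \<exists>D. S.admissible D \<and> int (card D) = n \<and> E = D \<union> X}"
  by (force simp: S.multipaths_of_size_eq ext_span)

text \<open>An isomorphism from one diagonal block of the matrix of \<open>G\<close> to a matrix
  \<open>d\<close>. Modules and entries on the other side are arbitrary, so that both
  \<open>S.F\<close> and its tensor product with \<open>A\<close> fit.\<close>

definition intertwiner ::
  "('v pair_pre_digraph \<Rightarrow> ('r, 'n) module) \<Rightarrow> ('v pair_pre_digraph \<Rightarrow> 'v pair_pre_digraph \<Rightarrow> 'n \<Rightarrow> 'n) \<Rightarrow>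
    ('v pair_pre_digraph \<Rightarrow> ('a list \<Rightarrow> 'r) set \<Rightarrow> 'n) \<Rightarrow> bool"
  where "intertwiner N d \<beta> \<longleftrightarrow>
    (\<forall>H\<in>multipaths G'. \<beta> H \<in> mod_hom R (G.F (ext H)) (N H) \<and>
      bij_betw (\<beta> H) (carrier (G.F (ext H))) (carrier (N H)) \<and>
      (\<forall>H'\<in>multipaths G'. \<forall>x\<in>carrier (G.F (ext H)).
        \<beta> H' (G.entry_map (ext H) (ext H') x) = d H H' (\<beta> H x)))"

text \<open>It is enough to find isomorphisms that commute with the maps without signs, and to know
  them on pure tensors, where they are given by \<open>\<Psi>\<close>. The discrepancy of the signs
  is absorbed by a factor depending on the multipath.\<close>

lemma signed_intertwiner:
  assumes N: "\<And>H. H \<in> multipaths G' \<Longrightarrow> module R (N H)"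
    and iso: "\<And>E. S.admissible E \<Longrightarrow> \<exists>h. h \<in> mod_hom R (G.F (G.span (E \<union> X))) (N (S.span E)) \<and>
      bij_betw h (carrier (G.F (G.span (E \<union> X)))) (carrier (N (S.span E))) \<and>
      (\<forall>f. range f \<subseteq> carrier A \<longrightarrow> h (G.pure (E \<union> X) f) = \<Psi> E f)"
    and m: "\<And>E e. S.admissible (insert e E) \<Longrightarrow> e \<notin> E \<Longrightarrow>
      m (S.span E) (S.span (insert e E)) \<in> mod_hom R (N (S.span E)) (N (S.span (insert e E)))"
    and comm: "\<And>E e f. S.admissible (insert e E) \<Longrightarrow> e \<notin> E \<Longrightarrow> range f \<subseteq> carrier A \<Longrightarrow>
      \<Psi> (insert e E) (merge_fun A (E \<union> X) e f) = m (S.span E) (S.span (insert e E)) (\<Psi> E f)"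
    and d: "\<And>H H' y. H \<in> multipaths G' \<Longrightarrow> H' \<in> multipaths G' \<Longrightarrow> y \<in> carrier (N H) \<Longrightarrow>
      d H H' y = (if precedes H H' then sign R (arc_sign rE' H H') \<odot>\<^bsub>N H'\<^esub> m H H' y
        else \<zero>\<^bsub>N H'\<^esub>)"
  obtains \<beta> where "intertwiner N d \<beta>"
proof -
  obtain h' where h': "\<And>E. S.admissible E \<Longrightarrow> h' E \<in> mod_hom R (G.F (G.span (E \<union> X))) (N (S.span E))"
    "\<And>E. S.admissible E \<Longrightarrow> bij_betw (h' E) (carrier (G.F (G.span (E \<union> X)))) (carrier (N (S.span E)))"
    "\<And>E f. S.admissible E \<Longrightarrow> range f \<subseteq> carrier A \<Longrightarrow> h' E (G.pure (E \<union> X) f) = \<Psi> E f"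
    using iso by metis
  define h where "h H = h' (parcs H)" for H :: "'v pair_pre_digraph"
  have h: "h H \<in> mod_hom R (G.F (ext H)) (N H)"
    and h_bij: "bij_betw (h H) (carrier (G.F (ext H))) (carrier (N H))" if "H \<in> multipaths G'" for H
    using that h'(1,2) by (auto simp: S.multipaths_eq h_def ext_span)
  obtain \<zeta> :: "('v \<times> 'v) set \<Rightarrow> nat" where \<zeta>:
    "\<And>E e. finite E \<Longrightarrow> E \<subseteq> parcs G' \<Longrightarrow> e \<in> parcs G' \<Longrightarrow> e \<notin> E \<Longrightarrow>
      even (\<zeta> (insert e E) + \<zeta> E + (below rE' E e + below rE (E \<union> X) e))"
    using sign_change_exists[OF G.rE S.rE parcs_subset finite_new new_disjoint] by blast
  \<comment> \<open>The arc set determines the sign by which the unsigned isomorphism is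
    corrected.\<close>
  define \<beta> where "\<beta> H x = sign R (\<zeta> (parcs H)) \<odot>\<^bsub>N H\<^esub> h H x" for H x
  have "intertwiner N d \<beta>"
    unfolding intertwiner_def
  proof (intro ballI conjI)
    fix H assume H: "H \<in> multipaths G'"
    interpret N: module R "N H" by (rule N[OF H])
    show hom: "\<beta> H \<in> mod_hom R (G.F (ext H)) (N H)"
      unfolding \<beta>_def by (rule mod_hom_smult_map[OF N[OF H] h[OF H] G.A.R.sign_closed])
    \<comment> \<open>Multiplication by a sign is its own inverse.\<close>
    have "bij_betw (\<lambda>y. sign R (\<zeta> (parcs H)) \<odot>\<^bsub>N H\<^esub> y) (carrier (N H)) (carrier (N H))"
      by (rule bij_betw_byWitness[where f' = "\<lambda>y. sign R (\<zeta> (parcs H)) \<odot>\<^bsub>N H\<^esub> y"])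
        (auto simp: N.sign_smult_smult N.sign_smult_even)
    from bij_betw_trans[OF h_bij[OF H] this]
    show "bij_betw (\<beta> H) (carrier (G.F (ext H))) (carrier (N H))"
      by (simp add: \<beta>_def[abs_def] comp_def)
    fix H' x assume H': "H' \<in> multipaths G'" and x: "x \<in> carrier (G.F (ext H))"
    interpret N': module R "N H'" by (rule N[OF H'])
    have \<beta>x: "\<beta> H x \<in> carrier (N H)"
      by (rule mod_hom_closed[OF hom x])
    have hx: "h H x \<in> carrier (N H)"
      by (rule mod_hom_closed[OF h[OF H] x])
    obtain E E' where E: "H = S.span E" "H' = S.span E'" "S.admissible E" "S.admissible E'"
      using H H' by (auto simp: S.multipaths_eq)
    then have pE: "parcs H = E" "parcs H' = E'"
      by simp_all
    show "\<beta> H' (G.entry_map (ext H) (ext H') x) = d H H' (\<beta> H x)"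
    proof (cases "precedes H H'")
      case True
      then obtain e where e: "e \<notin> E" "E' = insert e E"
        using E by (auto simp: S.precedes_span)
      have eX: "e \<notin> E \<union> X"
        using e E(4) new_disjoint by (auto simp: S.admissible_def)
      have extH': "ext H' = G.span (insert e (E \<union> X))" and extH: "ext H = G.span (E \<union> X)"
        using E e by (simp_all add: ext_def)
      have adm: "G.admissible (insert e (E \<union> X))"
        using extension_admissible[OF E(4)] e by simp
      have as: "arc_sign rE' H H' = below rE' E e"
        using S.arc_sign_span[OF e(1)] E e by simp
      let ?\<mu> = "multipath_mu R A rV (ext H) (ext H') x"
      have \<mu>: "?\<mu> \<in> carrier (G.F (ext H'))"
        using mod_hom_closed[OF G.mu_hom[OF adm eX]] x unfolding extH extH' .
      have mhom: "m H H' \<in> mod_hom R (N H) (N H')"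
        using m[of e E] E e by simp
      have mh: "h H' (multipath_mu R A rV (ext H) (ext H') x) = m H H' (h H x)"
      proof -
        have "h' E' (G.mu (E \<union> X) (insert e (E \<union> X)) x) = m H H' (h' E x)"
        proof (rule G.F_hom_ext[OF extension_admissible[OF E(3)] N[OF H']
              mod_hom_comp[OF G.mu_hom[OF adm eX] h'(1)[OF E(4), folded E(2), unfolded e(2) Un_insert_left, folded e(2)]]
              mod_hom_comp[OF h'(1)[OF E(3), folded E(1)] mhom] _ x[unfolded extH]])
          fix f :: "'v set \<Rightarrow> 'a" assume f: "range f \<subseteq> carrier A"
          show "h' E' (G.mu (E \<union> X) (insert e (E \<union> X)) (G.pure (E \<union> X) f)) = m H H' (h' E (G.pure (E \<union> X) f))"
            using comm[of e E f] h'(3)[OF E(4) G.merge_fun_closed[OF f]] h'(3)[OF E(3) f] E e f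
            by (simp add: G.mu_pure[OF adm eX f])
        qed
        then show ?thesis
          unfolding extH extH' h_def pE .
      qed
      have mm: "m H H' (h H x) \<in> carrier (N H')"
        by (rule mod_hom_closed[OF mhom hx])
      have "precedes (ext H) (ext H')"
        unfolding extH extH' G.precedes_span using eX by blast
      moreover have "arc_sign rE (ext H) (ext H') = below rE (E \<union> X) e"
        unfolding extH extH' by (rule G.arc_sign_span[OF eX])
      ultimately have "\<beta> H' (G.entry_map (ext H) (ext H') x) =
          sign R (\<zeta> E' + below rE (E \<union> X) e) \<odot>\<^bsub>N H'\<^esub> m H H' (h H x)"
        using mod_hom_smult[OF h[OF H'] G.A.R.sign_closed \<mu>] mm
        by (simp add: pE G.entry_map_def \<beta>_def mh N'.sign_smult_smult)
      moreover have "d H H' (\<beta> H x) = sign R (below rE' E e + \<zeta> E) \<odot>\<^bsub>N H'\<^esub> m H H' (h H x)"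
        using d[OF H H' \<beta>x] True mod_hom_smult[OF mhom G.A.R.sign_closed hx] mm
        by (simp add: as pE \<beta>_def N'.sign_smult_smult)
      \<comment> \<open>The defining property of \<open>\<zeta>\<close>: the two total exponents
        differ by an even number.\<close>
      moreover have "even (\<zeta> E' + below rE (E \<union> X) e) \<longleftrightarrow> even (below rE' E e + \<zeta> E)"
        using \<zeta>[of E e] S.admissible_finite[OF E(3)] E(4) e by (auto simp: S.admissible_def)
      ultimately show ?thesis
        using N'.sign_smult_even[OF mm] N'.sign_smult_odd[OF mm] by metis
    next
      case False
      \<comment> \<open>Since \<open>X\<close> is disjoint from the arcs of \<open>G'\<close>, an
        arc leading from one extension to another already lies in \<open>G'\<close>.\<close>
      have "\<not> precedes (ext H) (ext H')"
      proof
        assume "precedes (ext H) (ext H')"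
        then obtain e where e: "e \<notin> E \<union> X" "E' \<union> X = insert e (E \<union> X)"
          using E by (auto simp: ext_span G.precedes_span)
        have "E' = insert e E"
          using e E(3,4) new_disjoint unfolding S.admissible_def by blast
        moreover have "e \<notin> E"
          using e(1) by simp
        ultimately have "precedes H H'"
          unfolding E(1,2) S.precedes_span by blast
        then show False
          using False by simp
      qed
      moreover have "\<beta> H' \<zero>\<^bsub>G.F (ext H')\<^esub> = \<zero>\<^bsub>N H'\<^esub>"
        unfolding \<beta>_def mod_hom_zero[OF h[OF H'] G.F_module N[OF H']]
        by (rule N'.smult_r_null[OF G.A.R.sign_closed])
      ultimately show ?thesis
        using d[OF H H' \<beta>x] False by (simp add: G.entry_map_def)
    qed
  qed
  then show ?thesis by (rule that)
qed

lemma subgraph_weak_class: "S.admissible E \<Longrightarrow> x \<in> pverts G' \<Longrightarrow> weak_class E x \<subseteq> pverts G'"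
  by (rule weak_class_closed) (use S.arcs_subset in \<open>auto simp: S.admissible_def\<close>)

text \<open>The permanent arcs and new vertices form one further component \<open>z\<close>,
  disjoint from all arcs that can be added. Its factor is never multiplied with another, which is
  the identity on \<open>A\<close> in the tensor product.\<close>

lemma adjoin_intertwiner:
  assumes comps: "\<And>E. S.admissible E \<Longrightarrow> weak_class (E \<union> X) ` pverts G = insert z (weak_class E ` pverts G')"
    and z: "z \<inter> pverts G' = {}"
    and cls: "\<And>E x. S.admissible E \<Longrightarrow> x \<in> pverts G' \<Longrightarrow> weak_class (E \<union> X) x = weak_class E x"
  obtains \<beta> where "intertwiner (\<lambda>H. tensor R (S.F H) A)
    (\<lambda>H H'. tensor_map_id R (S.F H') A (S.entry_map H H')) \<beta>"
proof -
  let ?N = "\<lambda>H. tensor R (S.F H) A"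
  let ?m = "\<lambda>H H'. tensor_map_id R (S.F H') A (multipath_mu R A rV' H H')"
  let ?\<Psi> = "\<lambda>E f. pure_tensor R (S.F (S.span E)) A (S.pure E f) (f z)"
  note mA = G.A.module_axioms
  show ?thesis
  proof (rule signed_intertwiner[where N = ?N and m = ?m and \<Psi> = ?\<Psi>
        and d = "\<lambda>H H'. tensor_map_id R (S.F H') A (S.entry_map H H')"])
    show "module R (?N H)" for H
      by (intro two_modules.tensor_module two_modules.intro S.F_module mA)
  next
    fix E assume E: "S.admissible E"
    have "z \<notin> set (S.comp_list E)"
      using z weak_class_refl unfolding S.set_comp_list[OF E] by fastforce
    moreover have "set (G.comp_list (E \<union> X)) = insert z (set (S.comp_list E))"
      unfolding S.set_comp_list[OF E] G.set_comp_list[OF extension_admissible[OF E]] by (rule comps[OF E])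
    ultimately show "\<exists>h. h \<in> mod_hom R (G.F (G.span (E \<union> X))) (?N (S.span E)) \<and>
        bij_betw h (carrier (G.F (G.span (E \<union> X)))) (carrier (?N (S.span E))) \<and>
        (\<forall>f. range f \<subseteq> carrier A \<longrightarrow> h (G.pure (E \<union> X) f) = ?\<Psi> E f)"
      unfolding G.F_span S.F_span
      using G.A.adjoin_factor_iso[OF S.comp_list_distinct[OF E] G.comp_list_distinct[OF extension_admissible[OF E]]]
      by metis
  next
    fix E e assume adm: "S.admissible (insert e E)" and e: "e \<notin> E"
    note mS = S.mu_hom[OF adm e]
    show "?m (S.span E) (S.span (insert e E)) \<in> mod_hom R (?N (S.span E)) (?N (S.span (insert e E)))"
      by (rule tensor_map_id_hom[OF S.F_module S.F_module mA mS])
    fix f :: "'v set \<Rightarrow> 'a" assume f: "range f \<subseteq> carrier A"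
    then have fz: "f z \<in> carrier A"
      by auto
    have admE: "S.admissible E"
      using adm by (rule S.admissible_subset) auto
    have V: "fst e \<in> pverts G'" "snd e \<in> pverts G'"
      using adm S.arcs_subset by (auto simp: S.admissible_def)
    have mf: "merge_fun A (E \<union> X) e f = merge_fun A E e f"
      using cls[OF admE V(1)] cls[OF admE V(2)] by (simp add: fun_eq_iff merge_fun_def)
    \<comment> \<open>The source of \<open>e\<close> is a vertex of \<open>G'\<close>, so it is not
      in \<open>z\<close>.\<close>
    have mz: "merge_fun A E e f z = f z"
      using V(1) z by (auto simp: merge_fun_def)
    show "?\<Psi> (insert e E) (merge_fun A (E \<union> X) e f) = ?m (S.span E) (S.span (insert e E)) (?\<Psi> E f)"
      unfolding tensor_map_id_pure[OF S.F_module S.F_module mA mS S.pure_closed[OF f] fz]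
        S.mu_pure[OF adm e f] mf mz ..
  next
    fix H H' y assume H: "H \<in> multipaths G'" and H': "H' \<in> multipaths G'" and y: "y \<in> carrier (?N H)"
    show "tensor_map_id R (S.F H') A (S.entry_map H H') y =
        (if precedes H H' then sign R (arc_sign rE' H H') \<odot>\<^bsub>?N H'\<^esub> ?m H H' y else \<zero>\<^bsub>?N H'\<^esub>)"
    proof (cases "precedes H H'")
      case True
      with H H' have "multipath_mu R A rV' H H' \<in> mod_hom R (S.F H) (S.F H')"
        using S.mu_hom by (auto simp: S.multipaths_eq S.precedes_span)
      then show ?thesis
        using True tensor_map_id_smult[OF S.F_module S.F_module mA S.entry_map_hom[OF H H'] _ G.A.R.sign_closed _ y]
        by (simp add: S.entry_map_def)
    next
      case False
      then show ?thesis
        using tensor_map_id_zero[OF S.F_module S.F_module mA S.entry_map_hom[OF H H'] _ y]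
        by (simp add: S.entry_map_def)
    qed
  qed (rule that)
qed

text \<open>The permanent arcs enlarge existing components without creating any. The map
  \<open>\<theta>\<close> performs the enlargement, and intersection with the old vertices undoes
  it, so that it is injective on classes.\<close>

lemma reindex_intertwiner:
  assumes comps: "\<And>E. S.admissible E \<Longrightarrow> weak_class (E \<union> X) ` pverts G = \<theta> ` weak_class E ` pverts G'"
    and \<theta>: "\<And>c. c \<subseteq> pverts G' \<Longrightarrow> \<theta> c \<inter> pverts G' = c"
    and cls: "\<And>E x. S.admissible E \<Longrightarrow> x \<in> pverts G' \<Longrightarrow> weak_class (E \<union> X) x = \<theta> (weak_class E x)"
  obtains \<beta> where "intertwiner S.F S.entry_map \<beta>"
proof (rule signed_intertwiner[where N = S.F and m = "multipath_mu R A rV'"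
      and \<Psi> = "\<lambda>E f. S.pure E (\<lambda>c. f (\<theta> c))" and d = S.entry_map])
  fix E assume E: "S.admissible E"
  have "inj_on \<theta> (weak_class E ` pverts G')"
    using \<theta> subgraph_weak_class[OF E] by (intro inj_on_inverseI[of _ "\<lambda>c. c \<inter> pverts G'"]) auto
  then have "bij_betw \<theta> (set (S.comp_list E)) (set (G.comp_list (E \<union> X)))"
    unfolding S.set_comp_list[OF E] G.set_comp_list[OF extension_admissible[OF E]] comps[OF E]
    by (simp add: bij_betw_def)
  then show "\<exists>h. h \<in> mod_hom R (G.F (G.span (E \<union> X))) (S.F (S.span E)) \<and>
      bij_betw h (carrier (G.F (G.span (E \<union> X)))) (carrier (S.F (S.span E))) \<and>
      (\<forall>f. range f \<subseteq> carrier A \<longrightarrow> h (G.pure (E \<union> X) f) = S.pure E (\<lambda>c. f (\<theta> c)))"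
    unfolding G.F_span S.F_span
    using G.A.reindex_iso[OF G.comp_list_distinct[OF extension_admissible[OF E]] S.comp_list_distinct[OF E]]
    by metis
next
  fix E e and f :: "'v set \<Rightarrow> 'a"
  assume adm: "S.admissible (insert e E)" and e: "e \<notin> E" and f: "range f \<subseteq> carrier A"
  from f have f\<theta>: "range (\<lambda>c. f (\<theta> c)) \<subseteq> carrier A"
    by auto
  have admE: "S.admissible E"
    using adm by (rule S.admissible_subset) auto
  have V: "fst e \<in> pverts G'" "snd e \<in> pverts G'"
    using adm S.arcs_subset by (auto simp: S.admissible_def)
  \<comment> \<open>The enlargement adds no vertex of \<open>G'\<close>, so the merged class is
    recognised by \<open>fst e\<close> before and after it.\<close>
  have mem: "fst e \<in> \<theta> c \<longleftrightarrow> fst e \<in> c" if "c \<subseteq> pverts G'" for c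
    using \<theta>[OF that] V(1) by blast
  show "S.pure (insert e E) (\<lambda>c. merge_fun A (E \<union> X) e f (\<theta> c)) =
      S.mu E (insert e E) (S.pure E (\<lambda>c. f (\<theta> c)))"
    unfolding S.mu_pure[OF adm e f\<theta>]
    using mem[OF subgraph_weak_class[OF adm]] cls[OF admE V(1)] cls[OF admE V(2)]
    by (intro S.pure_cong[OF adm]) (simp add: merge_fun_def)
qed (use that in \<open>auto simp: S.F_module S.mu_hom S.entry_map_def\<close>)

end

text \<open>The block of \<open>G1\<close> is the subcomplex and that of \<open>G2\<close> the
  quotient. The former is shifted by one degree because the permanent arc \<open>e\<close> counts in
  the size of a multipath of \<open>G\<close>.\<close>

lemma short_exact_multipath_complex:
  fixes R :: "('r, 'k) ring_scheme" and A :: "('r, 'a, 'm) module_scheme"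
    and G G1 G2 :: "'v pair_pre_digraph"
    and C :: "('r, 'c) cochain" and D :: "('r, 'd) cochain"
    and NC :: "'v pair_pre_digraph \<Rightarrow> ('r, 'n) module" and ND :: "'v pair_pre_digraph \<Rightarrow> ('r, 'o) module"
  assumes ext1: "multipath_extension R A G rV rE G1 rV1 rE1 {e}"
    and ext2: "multipath_extension R A G rV rE G2 rV2 rE2 {}"
    and C: "matrix_complex R C (\<lambda>n. multipaths_of_size G1 (n - 1)) NC dC"
    and D: "matrix_complex R D (multipaths_of_size G2) ND dD"
    and \<alpha>: "multipath_extension.intertwiner R A G rV rE G1 {e} NC dC \<alpha>"
    and \<beta>: "multipath_extension.intertwiner R A G rV rE G2 {} ND dD \<beta>"
    and e: "e \<notin> parcs G2"
    and split: "\<And>E. E \<subseteq> parcs G \<Longrightarrow> path_like E \<Longrightarrow>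
      E \<subseteq> parcs G2 \<or> e \<in> E \<and> E - {e} \<subseteq> parcs G1"
  shows "\<exists>f g. short_exact R C (multipath_complex R A G rV rE) D f g"
proof -
  interpret X1: multipath_extension R A G rV rE G1 rV1 rE1 "{e}" by (rule ext1)
  interpret X2: multipath_extension R A G rV rE G2 rV2 rE2 "{}" by (rule ext2)
  have mp: "H \<in> multipaths K" if "H \<in> multipaths_of_size K n" for H n and K :: "'v pair_pre_digraph"
    using that by (simp add: multipaths_of_size_def)
  note \<alpha>' = \<alpha>[unfolded X1.intertwiner_def, rule_format] and \<beta>' = \<beta>[unfolded X2.intertwiner_def, rule_format]
  \<comment> \<open>The index sets in terms of arcs: removing \<open>e\<close> from a multipath that
    contains it leaves a path-like set with one arc less, which by \<open>split\<close> lies in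
    \<open>G1\<close>.\<close>
  have I: "{E. X1.G.admissible E \<and> int (card E) = n} =
      {E. \<exists>D. X1.S.admissible D \<and> int (card D) = n - 1 \<and> E = D \<union> {e}} \<union>
      {E. \<exists>D. X2.S.admissible D \<and> int (card D) = n \<and> E = D \<union> {}}" for n
  proof (intro equalityI subsetI)
    fix E assume "E \<in> {E. X1.G.admissible E \<and> int (card E) = n}"
    then have E: "X1.G.admissible E" "int (card E) = n" by auto
    note fin = X1.G.admissible_finite[OF E(1)]
    from split[of E] E(1) consider "E \<subseteq> parcs G2" | "e \<in> E" "E - {e} \<subseteq> parcs G1"
      by (auto simp: X1.G.admissible_def)
    then show "E \<in> {E. \<exists>D. X1.S.admissible D \<and> int (card D) = n - 1 \<and> E = D \<union> {e}} \<union>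
      {E. \<exists>D. X2.S.admissible D \<and> int (card D) = n \<and> E = D \<union> {}}"
    proof cases
      case 1
      then show ?thesis
        using E by (auto simp: X1.G.admissible_def X2.S.admissible_def)
    next
      case 2
      have "path_like (E - {e})"
        using E(1) path_like_subset[of E "E - {e}"] by (auto simp: X1.G.admissible_def)
      moreover have "int (card (E - {e})) = n - 1"
        using 2(1) E(2) card_Suc_Diff1[OF fin 2(1)] by simp
      moreover have "E = E - {e} \<union> {e}"
        using 2(1) by auto
      ultimately show ?thesis
        using 2(2) unfolding X1.S.admissible_def by blast
    qed
  next
    fix E assume "E \<in> {E. \<exists>D. X1.S.admissible D \<and> int (card D) = n - 1 \<and> E = D \<union> {e}} \<union>
      {E. \<exists>D. X2.S.admissible D \<and> int (card D) = n \<and> E = D \<union> {}}"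
    then consider D where "X1.S.admissible D" "int (card D) = n - 1" "E = D \<union> {e}"
      | "X2.S.admissible E" "int (card E) = n"
      by auto
    then show "E \<in> {E. X1.G.admissible E \<and> int (card E) = n}"
    proof cases
      case 1
      then have "e \<notin> D"
        using X1.new_disjoint by (auto simp: X1.S.admissible_def)
      then show ?thesis
        using 1 X1.extension_admissible[OF 1(1)] X1.S.admissible_finite[OF 1(1)] by simp
    next
      case 2
      then show ?thesis
        using X2.extension_admissible[OF 2(1)] by simp
    qed
  qed
  show ?thesis
  proof (rule short_exact_block_triangular[OF C X1.G.multipath_complex_matrix D])
    show "inj_on X1.ext (multipaths_of_size G1 (n - 1))" for n
      by (rule inj_on_subset[OF X1.inj_on_ext]) (auto intro: mp)
    show "inj_on X2.ext (multipaths_of_size G2 n)" for n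
      by (rule inj_on_subset[OF X2.inj_on_ext]) (auto intro: mp)
    show "multipaths_of_size G n = X1.ext ` multipaths_of_size G1 (n - 1) \<union> X2.ext ` multipaths_of_size G2 n" for n
      unfolding X1.G.multipaths_of_size_eq X1.ext_image X2.ext_image I by (rule image_Un)
    show "X1.ext ` multipaths_of_size G1 (n - 1) \<inter> X2.ext ` multipaths_of_size G2 n = {}" for n
      unfolding X1.ext_image X2.ext_image using e by (auto simp: X2.S.admissible_def)
    show "X1.G.entry_map (X1.ext j) (X2.ext k) x = \<zero>\<^bsub>X1.G.F (X2.ext k)\<^esub>"
      if "j \<in> multipaths_of_size G1 (n - 1)" "k \<in> multipaths_of_size G2 (n + 1)" for n j k x
    proof -
      \<comment> \<open>Adding an arc cannot remove \<open>e\<close>, so no entry leads from the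
        first block to the second.\<close>
      have "e \<notin> parcs (X2.ext k)"
        using mp[OF that(2)] e by (auto simp: X2.ext_def X2.S.multipaths_eq X2.S.admissible_def)
      then have "\<not> precedes (X1.ext j) (X2.ext k)"
        by (auto simp: precedes_def X1.ext_def)
      then show ?thesis
        by (simp add: X1.G.entry_map_def)
    qed
    show "\<alpha> j \<in> mod_hom R (X1.G.F (X1.ext j)) (NC j)"
      "bij_betw (\<alpha> j) (carrier (X1.G.F (X1.ext j))) (carrier (NC j))"
      if "j \<in> multipaths_of_size G1 (n - 1)" for n j
      using \<alpha>'[OF mp[OF that]] by auto
    show "\<beta> k \<in> mod_hom R (X1.G.F (X2.ext k)) (ND k)"
      "bij_betw (\<beta> k) (carrier (X1.G.F (X2.ext k))) (carrier (ND k))"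
      if "k \<in> multipaths_of_size G2 n" for n k
      using \<beta>'[OF mp[OF that]] by auto
    show "\<alpha> j' (X1.G.entry_map (X1.ext j) (X1.ext j') x) = dC j j' (\<alpha> j x)"
      if "j \<in> multipaths_of_size G1 (n - 1)" "j' \<in> multipaths_of_size G1 (n + 1 - 1)"
        "x \<in> carrier (X1.G.F (X1.ext j))" for n j j' x
      using \<alpha>'[OF mp[OF that(1)]] mp[OF that(2)] that(3) by blast
    show "\<beta> k' (X1.G.entry_map (X2.ext k) (X2.ext k') x) = dD k k' (\<beta> k x)"
      if "k \<in> multipaths_of_size G2 n" "k' \<in> multipaths_of_size G2 (n + 1)"
        "x \<in> carrier (X1.G.F (X2.ext k))" for n k k' x
      using \<beta>'[OF mp[OF that(1)]] mp[OF that(2)] that(3) by blast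
  qed
qed

section \<open>The exact sequences at a vertex of valence one\<close>

lemma pair_digraph_subgraph:
  assumes "pair_digraph G" "V \<subseteq> pverts G" "E \<subseteq> parcs G" "E \<subseteq> V \<times> V"
  shows "pair_digraph \<lparr> pverts = V, parcs = E \<rparr>"
proof -
  interpret G: pair_digraph G by fact
  show ?thesis
    using assms(2-4) finite_subset[OF assms(2) G.pair_finite_verts]
      finite_subset[OF assms(3) G.pair_finite_arcs] G.pair_no_loops
    by unfold_locales auto
qed

theorem theorem5p12:
  fixes R :: "('r, 'k) ring_scheme"
    and A :: "('r, 'a, 'm) module_scheme"
    and G G' G'' :: "'v pair_pre_digraph"
    and v u w :: 'v
    and e1 e2 :: "'v \<times> 'v"
    and rV rV' rV'' :: "'v rel"
    and rE rE' rE'' :: "('v \<times> 'v) rel"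
  assumes "principal_domain R"
    and "assoc_algebra R A"
    and "pair_digraph G"
    and "v \<in> pverts G" and "u \<in> pverts G"
    and "valence G v = 1" and "incident_arcs G v = {e1}" and "joins e1 v u"
    and "valence G u = 2" and "incident_arcs G u = {e1, e2}" and "joins e2 u w" and "w \<noteq> u"
    and "G' = \<lparr> pverts = pverts G - {v}, parcs = parcs G - {e1} \<rparr>"
    and "G'' = \<lparr> pverts = pverts G' - {u}, parcs = parcs G' - {e2} \<rparr>"
    and "linear_order_on (pverts G) rV" and "linear_order_on (parcs G) rE"
    and "linear_order_on (pverts G') rV'" and "linear_order_on (parcs G') rE'"
    and "linear_order_on (pverts G'') rV''" and "linear_order_on (parcs G'') rE''"
  shows "(snd e1 = u \<and> fst e2 = u \<or> fst e1 = u \<and> snd e2 = u \<longrightarrow>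
           (\<exists>f g. short_exact R
              (shift (multipath_complex R A G' rV' rE'))
              (multipath_complex R A G rV rE)
              (tensor_complex R (multipath_complex R A G' rV' rE') A) f g)) \<and>
         (\<not> (snd e1 = u \<and> fst e2 = u \<or> fst e1 = u \<and> snd e2 = u) \<longrightarrow>
           (\<exists>f g. short_exact R
              (tensor_complex R (shift (multipath_complex R A G'' rV'' rE'')) A)
              (multipath_complex R A G rV rE)
              (tensor_complex R (multipath_complex R A G' rV' rE') A) f g))"
proof -
  interpret G: pair_digraph G by fact
  note G' = \<open>G' = _\<close> and G'' = \<open>G'' = _\<close>
  have inc: "incident_arcs G x = {a \<in> parcs G. fst a = x \<or> snd a = x}" for x
    by (auto simp: incident_arcs_def in_arcs_def out_arcs_def)
  have e1: "e1 \<in> parcs G" and e2: "e2 \<in> parcs G"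
    using assms(10) unfolding inc by blast+
  have at_v: "a = e1" if "a \<in> parcs G" "fst a = v \<or> snd a = v" for a
    using that assms(7) unfolding inc by blast
  have at_u: "a = e1 \<or> a = e2" if "a \<in> parcs G" "fst a = u \<or> snd a = u" for a
    using that assms(10) unfolding inc by blast
  have vu: "v \<noteq> u"
    using G.pair_no_loops[OF e1] assms(8) by (auto simp: joins_def)
  \<comment> \<open>Without loops the incoming and outgoing arcs at \<open>u\<close> are disjoint,
    so valence 2 forces two incident arcs; \<open>incident_arcs\<close> alone would allow
    \<open>e1\<close> and \<open>e2\<close> to coincide.\<close>
  have ne: "e1 \<noteq> e2"
  proof
    assume "e1 = e2"
    let ?in = "in_arcs (with_proj G) u" and ?out = "out_arcs (with_proj G) u"
    have "?in \<union> ?out = {e1}"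
      using assms(10) \<open>e1 = e2\<close> by (simp add: incident_arcs_def)
    moreover have "?in \<inter> ?out = {}"
      using G.pair_no_loops by (auto simp: in_arcs_def out_arcs_def)
    ultimately have "card ?in + card ?out = 1"
      by (metis card_Un_disjoint card_1_singleton_iff finite.simps finite_Un One_nat_def)
    then show False
      using assms(9) by (simp add: valence_def in_degree_def out_degree_def)
  qed
  have e1_cases: "e1 = (v, u) \<or> e1 = (u, v)" and e2_cases: "e2 = (u, w) \<or> e2 = (w, u)"
    using assms(8,11) by (auto simp: joins_def)
  have arcsG: "parcs G \<subseteq> pverts G \<times> pverts G"
    using G.in_arcsD1 G.in_arcsD2 by auto
  have avoid_v: "v \<notin> Field E" if "E \<subseteq> parcs G'" for E
    using that at_v unfolding G' Field_def by fastforce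
  have avoid_u: "u \<notin> Field E" if "E \<subseteq> parcs G''" for E
    using that at_u unfolding G'' G' Field_def by fastforce
  have arcsG': "parcs G' \<subseteq> pverts G' \<times> pverts G'"
    using arcsG avoid_v[of "parcs G'"] unfolding G' Field_def by auto
  have arcsG'': "parcs G'' \<subseteq> pverts G'' \<times> pverts G''"
    using arcsG' avoid_u[of "parcs G''"] unfolding G'' Field_def by auto
  have G'_sub: "pverts G' \<subseteq> pverts G" "parcs G' \<subseteq> parcs G"
    and G''_sub: "pverts G'' \<subseteq> pverts G" "parcs G'' \<subseteq> parcs G" "parcs G'' \<subseteq> parcs G'"
    unfolding G'' G' by auto
  have "pair_digraph G'"
    using pair_digraph_subgraph[OF assms(3) G'_sub arcsG'] unfolding G' by simp
  then interpret K: multipath_context R A G' rV' rE'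
    by (intro multipath_context.intro assms(2,17,18))
  have "pair_digraph G''"
    using pair_digraph_subgraph[OF assms(3) G''_sub(1,2) arcsG''] unfolding G'' by simp
  then interpret L: multipath_context R A G'' rV'' rE''
    by (intro multipath_context.intro assms(2,19,20))
  interpret M: multipath_context R A G rV rE
    by (intro multipath_context.intro assms(2,3,15,16))
  have vertsG: "pverts G = insert v (pverts G')" "pverts G' = insert u (pverts G'')"
    "v \<notin> pverts G'" "u \<notin> pverts G''"
    using assms(4,5) vu unfolding G'' G' by auto
  have "M.admissible E" if "K.admissible E" for E
    using that G'_sub by (auto simp: M.admissible_def K.admissible_def)
  \<comment> \<open>The quotient in both cases: multipaths avoiding \<open>e1\<close>, in which
    \<open>v\<close> is an isolated vertex and contributes the factor \<open>A\<close>.\<close>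
  then interpret Q: multipath_extension R A G rV rE G' rV' rE' "{}"
    by (intro multipath_extension.intro multipath_extension_axioms.intro M.multipath_context_axioms
        K.multipath_context_axioms G'_sub) auto
  have "weak_class (E \<union> {}) ` pverts G = insert {v} (weak_class E ` pverts G')" if "K.admissible E" for E
    using that weak_class_not_Field[OF avoid_v[of E]] by (simp add: K.admissible_def vertsG(1))
  then obtain \<beta> where \<beta>: "Q.intertwiner (\<lambda>H. tensor R (K.F H) A)
      (\<lambda>H H'. tensor_map_id R (K.F H') A (K.entry_map H H')) \<beta>"
    by (rule Q.adjoin_intertwiner) (use vertsG(3) in auto)
  have mp: "H \<in> multipaths P" if "H \<in> multipaths_of_size P n" for H n and P :: "'v pair_pre_digraph"
    using that by (simp add: multipaths_of_size_def)
  have D: "matrix_complex R (tensor_complex R (multipath_complex R A G' rV' rE') A) (multipaths_of_size G')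
      (\<lambda>H. tensor R (K.F H) A) (\<lambda>H H'. tensor_map_id R (K.F H') A (K.entry_map H H'))"
    by (rule matrix_complex_tensor[OF K.multipath_complex_matrix K.A.module_axioms K.entry_map_hom[OF mp mp]])
  have e1_new: "e1 \<notin> parcs G'"
    by (simp add: G')
  \<comment> \<open>The class of \<open>v\<close> in \<open>E\<close> is \<open>{v}\<close>, so
    \<open>e1\<close> adds \<open>v\<close> to the class of \<open>u\<close>. Weak classes ignore
    directions, hence both orientations of \<open>e1\<close> give the same result.\<close>
  have e1_class: "weak_class (E \<union> {e1}) x =
      (if x \<in> insert v (weak_class E u) then insert v (weak_class E u) else weak_class E x)"
    if "E \<subseteq> parcs G'" for E x
  proof -
    have W: "weak_class E v = {v}"
      by (rule weak_class_not_Field[OF avoid_v[OF that]])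
    have "weak_class (insert (v, u) E) x = weak_class (insert (u, v) E) x"
      unfolding weak_class_insert by (simp only: Un_commute)
    moreover have "weak_class (insert (v, u) E) x =
        (if x \<in> insert v (weak_class E u) then insert v (weak_class E u) else weak_class E x)"
      unfolding weak_class_insert W by simp
    ultimately show ?thesis
      using e1_cases by (metis Un_insert_right sup_bot_right)
  qed
  \<comment> \<open>No arc of \<open>E\<close> touches \<open>v\<close>, so \<open>e1\<close> cannot
    close a cycle; only the degree conditions at its endpoints remain.\<close>
  have path_like_e1: "path_like (E \<union> {e1})"
    if "path_like E" "E \<subseteq> parcs G'" "fst e1 \<notin> Domain E" "snd e1 \<notin> Range E" for E
  proof -
    have "(snd e1, fst e1) \<notin> E\<^sup>*"
    proof
      assume "(snd e1, fst e1) \<in> E\<^sup>*"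
      moreover have "v \<notin> Domain E" "v \<notin> Range E"
        using avoid_v[OF that(2)] by (auto simp: Field_def)
      ultimately show False
        using e1_cases vu by (metis Not_Domain_rtrancl RangeI fst_conv rtranclE snd_conv)
    qed
    then show ?thesis
      using path_like_insert[OF that(1,3,4)] by simp
  qed
  show ?thesis
  proof (intro conjI impI)
    assume coherent: "snd e1 = u \<and> fst e2 = u \<or> fst e1 = u \<and> snd e2 = u"
    have "M.admissible (E \<union> {e1})" if E: "K.admissible E" for E
    proof -
      have EG: "E \<subseteq> parcs G'" and pl: "path_like E"
        using E by (auto simp: K.admissible_def)
      have v: "v \<notin> Domain E" "v \<notin> Range E"
        using avoid_v[OF EG] by (auto simp: Field_def)
      have arc: "a = e2" if "a \<in> E" "fst a = u \<or> snd a = u" for a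
        using at_u[OF _ that(2)] that(1) EG unfolding G' by auto
      \<comment> \<open>The only arc of \<open>E\<close> that can touch \<open>u\<close> is
        \<open>e2\<close>, and coherence says that \<open>e1\<close> and \<open>e2\<close> use
        opposite ends at \<open>u\<close>; \<open>w \<noteq> u\<close> excludes that
        \<open>e2\<close> uses both.\<close>
      have "fst e1 \<notin> Domain E \<and> snd e1 \<notin> Range E"
        using coherent e1_cases
      proof (elim disjE conjE)
        assume "e1 = (v, u)" "fst e2 = u"
        then show ?thesis
          using v arc e2_cases assms(12) by fastforce
      next
        assume "e1 = (u, v)" "snd e2 = u"
        then show ?thesis
          using v arc e2_cases assms(12) by fastforce
      qed (use vu in auto)
      then show ?thesis
        using path_like_e1[OF pl EG] EG G'_sub e1 by (auto simp: M.admissible_def)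
    qed
    then interpret P: multipath_extension R A G rV rE G' rV' rE' "{e1}"
      by (intro multipath_extension.intro multipath_extension_axioms.intro M.multipath_context_axioms
          K.multipath_context_axioms G'_sub) (use e1_new in auto)
    \<comment> \<open>Only the class of \<open>u\<close> is prolonged, by the vertex
      \<open>v\<close>.\<close>
    let ?\<theta> = "\<lambda>c. if u \<in> c then insert v c else c"
    have cls: "weak_class (E \<union> {e1}) x = ?\<theta> (weak_class E x)" if "K.admissible E" "x \<in> pverts G'" for E x
    proof -
      have "x \<noteq> v"
        using that(2) vertsG(3) by auto
      then show ?thesis
        using that(1) e1_class[of E x] weak_class_sym[of x E u] weak_class_eq_iff[of E x u]
        by (auto simp: K.admissible_def)
    qed
    have "weak_class (E \<union> {e1}) ` pverts G = ?\<theta> ` weak_class E ` pverts G'" if E: "K.admissible E" for E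
    proof -
      \<comment> \<open>The new vertex shares the class of \<open>u\<close>, so \<open>G\<close> has
        no more components than the multipath of \<open>G'\<close>.\<close>
      have "weak_class (E \<union> {e1}) v = weak_class (E \<union> {e1}) u"
        using E e1_class[of E v] e1_class[of E u] weak_class_refl[of u E] by (simp add: K.admissible_def)
      then have "weak_class (E \<union> {e1}) ` pverts G = weak_class (E \<union> {e1}) ` pverts G'"
        unfolding vertsG by simp
      also have "\<dots> = ?\<theta> ` weak_class E ` pverts G'"
        unfolding image_image using cls[OF E] by (intro image_cong) auto
      finally show ?thesis .
    qed
    then obtain \<alpha> where \<alpha>: "P.intertwiner K.F K.entry_map \<alpha>"
      by (rule P.reindex_intertwiner) (use cls vertsG(3) in auto)
    show "\<exists>f g. short_exact R (shift (multipath_complex R A G' rV' rE')) (multipath_complex R A G rV rE)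
        (tensor_complex R (multipath_complex R A G' rV' rE') A) f g"
      by (rule short_exact_multipath_complex[OF P.multipath_extension_axioms Q.multipath_extension_axioms
          matrix_complex_shift[OF K.multipath_complex_matrix] D \<alpha> \<beta> e1_new])
        (auto simp: G')
  next
    assume incoherent: "\<not> (snd e1 = u \<and> fst e2 = u \<or> fst e1 = u \<and> snd e2 = u)"
    \<comment> \<open>In \<open>G''\<close> neither \<open>u\<close> nor \<open>v\<close> is
      touched, so \<open>e1\<close> can be added whatever its orientation.\<close>
    have avoid: "v \<notin> Field E" "u \<notin> Field E" "E \<subseteq> parcs G'" if "L.admissible E" for E
      using that avoid_v[of E] avoid_u[of E] G''_sub by (auto simp: L.admissible_def)
    have "M.admissible (E \<union> {e1})" if E: "L.admissible E" for E
      using path_like_e1[of E] avoid[OF E] E e1 e1_cases G''_sub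
      by (auto simp: M.admissible_def L.admissible_def Field_def)
    then interpret P: multipath_extension R A G rV rE G'' rV'' rE'' "{e1}"
      by (intro multipath_extension.intro multipath_extension_axioms.intro M.multipath_context_axioms
          L.multipath_context_axioms G''_sub) (use e1_new G''_sub in auto)
    \<comment> \<open>Both endpoints of \<open>e1\<close> are isolated in \<open>E\<close>, so they
      form the separate component \<open>{u, v}\<close>, which provides the factor \<open>A\<close>
      of the subcomplex.\<close>
    have cls: "weak_class (E \<union> {e1}) x = (if x = u \<or> x = v then {u, v} else weak_class E x)"
      if "L.admissible E" for E x
      using e1_class[OF avoid(3)[OF that], of x] weak_class_not_Field[OF avoid(2)[OF that]] by auto
    have "weak_class (E \<union> {e1}) ` pverts G = insert {u, v} (weak_class E ` pverts G'')" if E: "L.admissible E" for E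
    proof -
      have "weak_class (E \<union> {e1}) ` pverts G'' = weak_class E ` pverts G''"
        using cls[OF E] vertsG by (intro image_cong) auto
      then show ?thesis
        unfolding vertsG using cls[OF E] by simp
    qed
    then obtain \<alpha> where \<alpha>: "P.intertwiner (\<lambda>H. tensor R (L.F H) A)
        (\<lambda>H H'. tensor_map_id R (L.F H') A (L.entry_map H H')) \<alpha>"
      by (rule P.adjoin_intertwiner) (use cls vertsG in auto)
    have C: "matrix_complex R (tensor_complex R (shift (multipath_complex R A G'' rV'' rE'')) A)
        (\<lambda>n. multipaths_of_size G'' (n - 1)) (\<lambda>H. tensor R (L.F H) A)
        (\<lambda>H H'. tensor_map_id R (L.F H') A (L.entry_map H H'))"
      by (rule matrix_complex_tensor[OF matrix_complex_shift[OF L.multipath_complex_matrix]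
          K.A.module_axioms L.entry_map_hom[OF mp mp]])
    have split: "E \<subseteq> parcs G' \<or> e1 \<in> E \<and> E - {e1} \<subseteq> parcs G''" if E: "E \<subseteq> parcs G" "path_like E" for E
    proof (cases "e1 \<in> E")
      case True
      \<comment> \<open>Incoherent arcs both leave \<open>u\<close> or both enter it, so together
        they violate one of the two degree conditions.\<close>
      have "e2 \<notin> E"
      proof
        assume "e2 \<in> E"
        with True E(2) e1_cases e2_cases incoherent ne show False
          by (auto simp: path_like_def single_valued_def)
      qed
      then show ?thesis
        using True E(1) by (auto simp: G'' G')
    qed (use E in \<open>auto simp: G'\<close>)
    show "\<exists>f g. short_exact R (tensor_complex R (shift (multipath_complex R A G'' rV'' rE'')) A)
        (multipath_complex R A G rV rE) (tensor_complex R (multipath_complex R A G' rV' rE') A) f g"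
      by (rule short_exact_multipath_complex[OF P.multipath_extension_axioms Q.multipath_extension_axioms
          C D \<alpha> \<beta> e1_new split])
  qed
qed

end
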